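(* Let $(A,\Delta,\epsilon,\Phi,\mathcal R)$ be a quasi-triangular quasi-Hopf (super)algebra. The element $$u=\sum S\big(Y_\nu\beta S(Z_\nu)\big)\,S(e^i)\,\alpha\,e_i\,X_\nu\,(-1)^{[e_i]+[X_\nu]}$$ is invertible and satisfies $S^2(a)=uau^{-1}$ for all $a\in A$. Moreover its inverse is given by $$u^{-1}=S^2(u^{-1})=\sum S^{-1}(X_\nu)\,S^{-1}(\alpha\bar e^i)\,\bar e_i\,Y_\nu\,\beta\, S(Z_\nu)\,(-1)^{[\bar e_i]}.$$
   Context: A quasi-Hopf (super)algebra $(A,\Delta,\epsilon,\Phi)$ is a unital associative $\mathbb Z_2$-graded algebra $A$ over a field $K$ (the ungraded case being $A$ concentrated in degree $0$; $[a]\in\mathbb Z_2$ is the degree of a homogeneous $a$; sign formulas are stated for homogeneous elements and extended linearly), with grading-preserving algebra homomorphisms $\epsilon:A\to K$, $\Delta:A\to A\otimes A$, an invertible homogeneous $\Phi\in A\otimes A\otimes A$, a graded algebra anti-homomorphism $S:A\to A$ (grading preserving, $S(ab)=(-1)^{[a][b]}S(b)S(a)$) and homogeneous $\alpha,\beta\in A$; $S$ is assumed bijective. Tensor products are multiplied by $(a\otimes b)(a'\otimes b')=(-1)^{[b][a']}aa'\otimes bb'$. Write $\Phi=\sum_\nu X_\nu\otimes Y_\nu\otimes Z_\nu$, $\Phi^{-1}=\sum_\nu\bar X_\nu\otimes\bar Y_\nu\otimes\bar Z_\nu$, $\Delta(a)=\sum a_{(1)}\otimes a_{(2)}$ (homogeneous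 components). The axioms are, for all $a\in A$: $(1\otimes\Delta)\Delta(a)=\Phi^{-1}(\Delta\otimes1)\Delta(a)\Phi$; $(\Delta\otimes1\otimes1)\Phi\cdot(1\otimes1\otimes\Delta)\Phi=(\Phi\otimes1)\cdot(1\otimes\Delta\otimes1)\Phi\cdot(1\otimes\Phi)$; $(\epsilon\otimes1)\Delta=1=(1\otimes\epsilon)\Delta$; $(1\otimes\epsilon\otimes1)\Phi=1$; $\sum S(a_{(1)})\alpha a_{(2)}=\epsilon(a)\alpha$; $\sum a_{(1)}\beta S(a_{(2)})=\epsilon(a)\beta$; $\sum\bar X_\nu\beta S(\bar Y_\nu)\alpha\bar Z_\nu=1$; $\sum S(X_\nu)\alpha Y_\nu\beta S(Z_\nu)=1$. These imply that $\Phi,\alpha,\beta$ are even. Let $T(a\otimes b)=(-1)^{[a][b]}b\otimes a$ and $\Delta^T=T\cdot\Delta$. $A$ is quasi-triangular if there is an invertible homogeneous $\mathcal R\in A\otimes A$ (it is then even) with $\Delta^T(a)\mathcal R=\mathcal R\Delta(a)$ for all $a\in A$, $(\Delta\otimes1)\mathcal R=\Phi^{-1}_{231}\mathcal R_{13}\Phi_{132}\mathcal R_{23}\Phi^{-1}_{123}$ and $(1\otimes\Delta)\mathcal R=\Phi_{312}\mathcal R_{13}\Phi^{-1}_{213}\mathcal R_{12}\Phi_{123}$, where $\Phi_{123}=\Phi$, $\Phi_{132}=(1\otimes T)\Phi$, $\Phi_{312}=(T\otimes1)(1\otimes T)\Phi$, $\Phi^{-1}_{213}=(T\otimes1)\Phi^{-1}$,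 $\Phi^{-1}_{231}=(1\otimes T)(T\otimes1)\Phi^{-1}$, and $\mathcal R_{ij}$ is $\mathcal R$ placed in tensor positions $i,j$. Write $\mathcal R=\sum_ie_i\otimes e^i$ and $\mathcal R^{-1}=\sum_i\bar e_i\otimes\bar e^i$ with homogeneous components. *)

theory Defs
  imports Complex_Main "HOL-Library.Poly_Mapping" "HOL-Library.Z2"
begin

section \<open>Tensor powers\<close>

text \<open>
  Let \<open>A\<close> be a vector space over \<open>K\<close>, with carrier the type \<open>'a\<close>, scalars \<open>'k\<close> and scalar
  multiplication \<open>scale\<close>. The tensor power \<open>A \<otimes> \<dots> \<otimes> A\<close> (\<open>n\<close> factors) is the free vector space on
  the lists of length \<open>n\<close> over \<open>A\<close> modulo the subspace spanned by the multilinearity relations.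
  We compute with elements of the free vector space, i.e. with formal sums of the words
  \<open>[a\<^sub>1, \<dots>, a\<^sub>n]\<close>, each standing for \<open>a\<^sub>1 \<otimes> \<dots> \<otimes> a\<^sub>n\<close>; equality in the tensor power is the
  congruence \<open>tens_eq scale\<close> modulo that subspace. The relations only relate words of equal
  length, so all \<open>n\<close> can be treated at once.
\<close>

type_synonym ('a, 'k) fsum = "'a list \<Rightarrow>\<^sub>0 'k"

definition fscale :: "'k::field \<Rightarrow> ('a, 'k) fsum \<Rightarrow> ('a, 'k) fsum" where
  "fscale k t = Poly_Mapping.map ((*) k) t"

definition pure_tens :: "'a list \<Rightarrow> ('a, 'k::field) fsum" where
  "pure_tens xs = Poly_Mapping.single xs 1"

text \<open>The linear extension of a map defined on words, with values in a vector space with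
  scalar multiplication \<open>sc\<close>.\<close>

definition lin_ext ::
  "('k::field \<Rightarrow> 'v \<Rightarrow> 'v::comm_monoid_add) \<Rightarrow> ('a list \<Rightarrow> 'v) \<Rightarrow> ('a, 'k) fsum \<Rightarrow> 'v" where
  "lin_ext sc f t = (\<Sum>xs\<in>Poly_Mapping.keys t. sc (Poly_Mapping.lookup t xs) (f xs))"

inductive_set multilinearity_relations ::
    "('k::field \<Rightarrow> 'a \<Rightarrow> 'a::ab_group_add) \<Rightarrow> ('a, 'k) fsum set"
  for scale :: "'k::field \<Rightarrow> 'a \<Rightarrow> 'a::ab_group_add" where
  additive: "pure_tens (us @ [a + b] @ vs) - pure_tens (us @ [a] @ vs) - pure_tens (us @ [b] @ vs)
      \<in> multilinearity_relations scale"
| scaling: "pure_tens (us @ [scale k a] @ vs) - fscale k (pure_tens (us @ [a] @ vs))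
      \<in> multilinearity_relations scale"

definition tens_eq ::
    "('k::field \<Rightarrow> 'a \<Rightarrow> 'a::ab_group_add) \<Rightarrow> ('a, 'k) fsum \<Rightarrow> ('a, 'k) fsum \<Rightarrow> bool" where
  "tens_eq scale s t \<longleftrightarrow> s - t \<in> module.span fscale (multilinearity_relations scale)"

definition tens :: "nat \<Rightarrow> ('a, 'k::field) fsum set" where
  "tens n = {t. \<forall>xs\<in>Poly_Mapping.keys t. length xs = n}"

definition insert_one :: "nat \<Rightarrow> ('a::one, 'k::field) fsum \<Rightarrow> ('a, 'k) fsum" where
  "insert_one i t = lin_ext fscale (\<lambda>xs. pure_tens (take i xs @ [1] @ drop i xs)) t"

text \<open>For a linear map \<open>f : A \<rightarrow> A \<otimes> A\<close>, the map \<open>1 \<otimes> \<dots> \<otimes> f \<otimes> \<dots> \<otimes> 1\<close> with \<open>f\<close> acting on the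
  factor at position \<open>i\<close>, and likewise for a linear form \<open>f : A \<rightarrow> K\<close>. Positions are counted
  from \<open>0\<close>. No signs occur, because these are only used for maps of degree \<open>0\<close>.\<close>

definition apply_at :: "nat \<Rightarrow> ('a \<Rightarrow> ('a, 'k::field) fsum) \<Rightarrow> ('a, 'k) fsum \<Rightarrow> ('a, 'k) fsum" where
  "apply_at i f t = lin_ext fscale
     (\<lambda>xs. lin_ext fscale (\<lambda>ys. pure_tens (take i xs @ ys @ drop (Suc i) xs)) (f (xs ! i))) t"

definition apply_form_at :: "nat \<Rightarrow> ('a \<Rightarrow> 'k::field) \<Rightarrow> ('a, 'k) fsum \<Rightarrow> ('a, 'k) fsum" where
  "apply_form_at i f t = lin_ext fscale
     (\<lambda>xs. fscale (f (xs ! i)) (pure_tens (take i xs @ drop (Suc i) xs))) t"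


section \<open>Graded tensors\<close>

text \<open>The type \<^typ>\<open>bit\<close> is the field of integers modulo \<open>2\<close>; \<open>ksign d\<close> is \<open>(-1)\<^sup>d\<close>.\<close>

definition ksign :: "bit \<Rightarrow> 'k::field" where
  "ksign d = (if d = 1 then -1 else 1)"

definition homogeneous :: "(bit \<Rightarrow> 'a set) \<Rightarrow> 'a \<Rightarrow> bool" where
  "homogeneous G a \<longleftrightarrow> (\<exists>d. a \<in> G d)"

text \<open>The degree \<open>[a]\<close> of a homogeneous \<open>a\<close>. The element \<open>0\<close> gets degree \<open>0\<close>, and the value at
  inhomogeneous elements is irrelevant.\<close>

definition deg :: "(bit \<Rightarrow> 'a set) \<Rightarrow> 'a \<Rightarrow> bit" where
  "deg G a = (if a \<in> G 0 then 0 else 1)"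

text \<open>A finite family of words with homogeneous letters that represents the tensor \<open>t\<close>, such as
  \<open>\<Phi> = \<Sum>\<^sub>\<nu> X\<^sub>\<nu> \<otimes> Y\<^sub>\<nu> \<otimes> Z\<^sub>\<nu>\<close>.\<close>

definition homogeneous_expansion ::
    "('k::field \<Rightarrow> 'a \<Rightarrow> 'a::ab_group_add) \<Rightarrow> (bit \<Rightarrow> 'a set) \<Rightarrow> ('a, 'k) fsum
      \<Rightarrow> 'i set \<Rightarrow> ('i \<Rightarrow> 'a list) \<Rightarrow> bool" where
  "homogeneous_expansion scale G t I w \<longleftrightarrow>
     finite I \<and> (\<forall>i\<in>I. \<forall>x\<in>set (w i). homogeneous G x) \<and> tens_eq scale t (\<Sum>i\<in>I. pure_tens (w i))"

locale superalgebra = vector_space scale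
  for scale :: "'k::field \<Rightarrow> 'a::ring_1 \<Rightarrow> 'a" +
  fixes G :: "bit \<Rightarrow> 'a set"
  assumes scale_mult_left: "scale k a * b = scale k (a * b)"
    and scale_mult_right: "a * scale k b = scale k (a * b)"
    and subspace_G: "subspace (G d)"
    and G_disjoint: "G 0 \<inter> G 1 = {0}"
    and G_decomp: "\<exists>b\<in>G 0. \<exists>c\<in>G 1. a = b + c"
    and G_one: "1 \<in> G 0"
    and G_mult: "a \<in> G c \<Longrightarrow> b \<in> G d \<Longrightarrow> a * b \<in> G (c + d)"
begin

abbreviation tens_equal (infix "\<approx>" 50) where
  "s \<approx> t \<equiv> tens_eq scale s t"

definition hpart :: "bit \<Rightarrow> 'a \<Rightarrow> 'a" where
  "hpart d a = (THE b. b \<in> G d \<and> a - b \<in> G (d + 1))"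

text \<open>The multiplication of \<open>A \<otimes> \<dots> \<otimes> A\<close>. On words with homogeneous letters of degrees
  \<open>p\<^sub>1, \<dots>, p\<^sub>n\<close> and \<open>q\<^sub>1, \<dots>, q\<^sub>n\<close>, iterating the rule
  \<open>(a \<otimes> b)(a' \<otimes> b') = (-1)\<^bsup>[b][a']\<^esup> aa' \<otimes> bb'\<close> yields the sign with exponent
  \<open>\<Sum>\<^sub>j\<^sub><\<^sub>i p\<^sub>i q\<^sub>j\<close>; general letters are first split into their homogeneous components.\<close>

definition koszul :: "bit list \<Rightarrow> bit list \<Rightarrow> bit" where
  "koszul p q = (\<Sum>i<length p. \<Sum>j<i. p ! i * q ! j)"

definition word_mult :: "'a list \<Rightarrow> 'a list \<Rightarrow> ('a, 'k) fsum" where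
  "word_mult xs ys = (\<Sum>p | length p = length xs. \<Sum>q | length q = length ys.
     fscale (ksign (koszul p q)) (pure_tens (map2 (*) (map2 hpart p xs) (map2 hpart q ys))))"

definition tmult :: "('a, 'k) fsum \<Rightarrow> ('a, 'k) fsum \<Rightarrow> ('a, 'k) fsum" (infixl "\<odot>" 70) where
  "s \<odot> t = lin_ext fscale (\<lambda>xs. lin_ext fscale (\<lambda>ys. word_mult xs ys) t) s"

definition tone :: "nat \<Rightarrow> ('a, 'k) fsum" where
  "tone n = pure_tens (replicate n 1)"

text \<open>The graded flip \<open>T\<close>, acting on the factors at positions \<open>i\<close> and \<open>i + 1\<close>.\<close>

definition flip_at :: "nat \<Rightarrow> ('a, 'k) fsum \<Rightarrow> ('a, 'k) fsum" where
  "flip_at i t = lin_ext fscale (\<lambda>xs. \<Sum>c\<in>UNIV. \<Sum>d\<in>UNIV. fscale (ksign (c * d))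
     (pure_tens (take i xs @ [hpart d (xs ! Suc i), hpart c (xs ! i)] @ drop (Suc (Suc i)) xs))) t"

definition homogeneous_tens :: "nat \<Rightarrow> bit \<Rightarrow> ('a, 'k) fsum set" where
  "homogeneous_tens n d = {t \<in> tens n. \<exists>s. t \<approx> s \<and>
     (\<forall>xs\<in>Poly_Mapping.keys s. \<exists>p. length p = n \<and> list_all2 (\<lambda>x c. x \<in> G c) xs p \<and> sum_list p = d)}"

end


section \<open>Quasi-triangular quasi-Hopf superalgebras\<close>

text \<open>The ungraded case is \<open>G 0 = UNIV\<close>, \<open>G 1 = {0}\<close>.\<close>

locale quasi_hopf_superalgebra = superalgebra scale G
  for scale :: "'k::field \<Rightarrow> 'a::ring_1 \<Rightarrow> 'a" and G :: "bit \<Rightarrow> 'a set" +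
  fixes \<Delta> :: "'a \<Rightarrow> ('a, 'k) fsum"
    and \<epsilon> :: "'a \<Rightarrow> 'k"
    and \<Phi> \<Phi>inv :: "('a, 'k) fsum"
    and S :: "'a \<Rightarrow> 'a"
    and \<alpha> \<beta> :: 'a
  assumes \<Delta>_tens: "\<Delta> a \<in> tens 2"
    and \<Delta>_add: "\<Delta> (a + b) \<approx> \<Delta> a + \<Delta> b"
    and \<Delta>_scale: "\<Delta> (scale k a) \<approx> fscale k (\<Delta> a)"
    and \<Delta>_one: "\<Delta> 1 \<approx> tone 2"
    and \<Delta>_mult: "\<Delta> (a * b) \<approx> \<Delta> a \<odot> \<Delta> b"
    and \<Delta>_grading: "a \<in> G d \<Longrightarrow> \<Delta> a \<in> homogeneous_tens 2 d"
    and \<epsilon>_linear: "Vector_Spaces.linear scale (*) \<epsilon>"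
    and \<epsilon>_one: "\<epsilon> 1 = 1"
    and \<epsilon>_mult: "\<epsilon> (a * b) = \<epsilon> a * \<epsilon> b"
    and \<epsilon>_grading: "a \<in> G 1 \<Longrightarrow> \<epsilon> a = 0"
    and \<Phi>_homogeneous: "\<exists>d. \<Phi> \<in> homogeneous_tens 3 d"
    and \<Phi>inv_tens: "\<Phi>inv \<in> tens 3"
    and \<Phi>_right_inv: "\<Phi> \<odot> \<Phi>inv \<approx> tone 3"
    and \<Phi>_left_inv: "\<Phi>inv \<odot> \<Phi> \<approx> tone 3"
    and S_linear: "Vector_Spaces.linear scale scale S"
    and S_one: "S 1 = 1"
    and S_grading: "a \<in> G d \<Longrightarrow> S a \<in> G d"
    and S_antimult: "a \<in> G c \<Longrightarrow> b \<in> G d \<Longrightarrow> S (a * b) = scale (ksign (c * d)) (S b * S a)"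
    and S_bij: "bij S"
    and \<alpha>_homogeneous: "homogeneous G \<alpha>"
    and \<beta>_homogeneous: "homogeneous G \<beta>"
    and quasi_coassoc:
      "apply_at 1 \<Delta> (\<Delta> a) \<approx> \<Phi>inv \<odot> apply_at 0 \<Delta> (\<Delta> a) \<odot> \<Phi>"
    and pentagon:
      "apply_at 0 \<Delta> \<Phi> \<odot> apply_at 2 \<Delta> \<Phi> \<approx>
       insert_one 3 \<Phi> \<odot> apply_at 1 \<Delta> \<Phi> \<odot> insert_one 0 \<Phi>"
    and counit_left: "apply_form_at 0 \<epsilon> (\<Delta> a) \<approx> pure_tens [a]"
    and counit_right: "apply_form_at 1 \<epsilon> (\<Delta> a) \<approx> pure_tens [a]"
    and counit_\<Phi>: "apply_form_at 1 \<epsilon> \<Phi> \<approx> tone 2"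
    and antipode_\<alpha>: "lin_ext scale (\<lambda>xs. S (xs ! 0) * \<alpha> * xs ! 1) (\<Delta> a) = scale (\<epsilon> a) \<alpha>"
    and antipode_\<beta>: "lin_ext scale (\<lambda>xs. xs ! 0 * \<beta> * S (xs ! 1)) (\<Delta> a) = scale (\<epsilon> a) \<beta>"
    and antipode_\<Phi>inv: "lin_ext scale (\<lambda>xs. xs ! 0 * \<beta> * S (xs ! 1) * \<alpha> * xs ! 2) \<Phi>inv = 1"
    and antipode_\<Phi>: "lin_ext scale (\<lambda>xs. S (xs ! 0) * \<alpha> * xs ! 1 * \<beta> * S (xs ! 2)) \<Phi> = 1"

text \<open>With \<open>\<Phi> = \<Sum> X \<otimes> Y \<otimes> Z\<close> and up to signs, \<open>\<Phi>\<^sub>1\<^sub>3\<^sub>2 = \<Sum> X \<otimes> Z \<otimes> Y\<close>, \<open>\<Phi>\<^sub>3\<^sub>1\<^sub>2 = \<Sum> Z \<otimes> X \<otimes> Y\<close>,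
  \<open>\<Phi>\<^sub>2\<^sub>1\<^sub>3 = \<Sum> Y \<otimes> X \<otimes> Z\<close> and \<open>\<Phi>\<^sub>2\<^sub>3\<^sub>1 = \<Sum> Y \<otimes> Z \<otimes> X\<close>.\<close>

locale quasi_triangular_quasi_hopf_superalgebra =
  quasi_hopf_superalgebra scale G \<Delta> \<epsilon> \<Phi> \<Phi>inv S \<alpha> \<beta>
  for scale :: "'k::field \<Rightarrow> 'a::ring_1 \<Rightarrow> 'a" and G \<Delta> \<epsilon> \<Phi> \<Phi>inv S \<alpha> \<beta> +
  fixes R Rinv :: "('a, 'k) fsum"
  assumes R_homogeneous: "\<exists>d. R \<in> homogeneous_tens 2 d"
    and Rinv_tens: "Rinv \<in> tens 2"
    and R_right_inv: "R \<odot> Rinv \<approx> tone 2"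
    and R_left_inv: "Rinv \<odot> R \<approx> tone 2"
    and R_intertwines: "flip_at 0 (\<Delta> a) \<odot> R \<approx> R \<odot> \<Delta> a"
    and hexagon_left:
      "apply_at 0 \<Delta> R \<approx>
       flip_at 1 (flip_at 0 \<Phi>inv) \<odot> insert_one 1 R \<odot> flip_at 1 \<Phi> \<odot> insert_one 0 R \<odot> \<Phi>inv"
    and hexagon_right:
      "apply_at 1 \<Delta> R \<approx>
       flip_at 0 (flip_at 1 \<Phi>) \<odot> insert_one 1 R \<odot> flip_at 0 \<Phi>inv \<odot> insert_one 2 R \<odot> \<Phi>"

end

theory Submission
  imports Defs
begin

text \<open>
  On a module \<open>V\<close> the element \<open>u\<close> is a map \<open>V \<rightarrow> V\<^sup>*\<^sup>*\<close> composed from a coevaluation of \<open>V\<^sup>*\<close>, the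
  associator \<open>\<Phi>\<close> and the form \<open>V \<otimes> V\<^sup>* \<rightarrow> V\<^sup>* \<otimes> V \<rightarrow> K\<close> that the braiding \<open>R\<close> and the evaluation
  define; this form is given by the element \<open>\<theta> = \<Sum> S(e') \<alpha> e\<close> (signs are left out here, and
  \<open>R = \<Sum> e \<otimes> e'\<close>, \<open>R\<^sup>-\<^sup>1 = \<Sum> f \<otimes> f'\<close>, \<open>\<Phi> = \<Sum> X \<otimes> Y \<otimes> Z\<close>). The candidate for the inverse is
  \<open>v = \<Sum> S\<^sup>-\<^sup>1(X) \<eta> Y \<beta> S(Z)\<close> with \<open>\<eta> = \<Sum> S\<^sup>-\<^sup>1(\<alpha> f') f\<close>.

  Naturality of \<open>R\<close> makes \<open>\<theta>\<close> and \<open>\<eta>\<close> invariant: \<open>\<Sum> S(a\<^sub>2) \<theta> a\<^sub>1 = \<epsilon>(a) \<theta>\<close> and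
  \<open>\<Sum> S\<^sup>-\<^sup>1(a\<^sub>1) \<eta> a\<^sub>2 = \<epsilon>(a) \<eta>\<close>. For such elements quasi-coassociativity alone gives
  \<open>S\<^sup>2(a) u = u a\<close> (\<open>to_double_dual_commute\<close>) and \<open>a v = v S\<^sup>2(a)\<close> (\<open>from_double_dual_commute\<close>), and
  the pentagon gives \<open>S(\<alpha>) u = \<theta>\<close> (\<open>S_\<alpha>_to_double_dual\<close>). Consequently
  \<open>u \<eta> = \<Sum> S(\<alpha> f') u f = \<Sum> S(f') \<theta> f = \<Sum> S(e' f') \<alpha> e f = \<alpha>\<close>, because \<open>R R\<^sup>-\<^sup>1 = 1 \<otimes> 1\<close>, and
  \<open>u v = \<Sum> S(X) u \<eta> Y \<beta> S(Z) = \<Sum> S(X) \<alpha> Y \<beta> S(Z) = 1\<close>. Since also \<open>v S\<^sup>2(u) = u v = 1\<close>, the element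
  \<open>v\<close> is a two-sided inverse, and \<open>S\<^sup>2(v) u = u v = 1\<close> shows that \<open>S\<^sup>2\<close> fixes it.

  Each of these identities contracts an equation between tensors with a multilinear map. Instead of
  computing in the quotient by the multilinearity relations, the proofs evaluate such equations by
  functionals (\<open>ev\<close>). The functionals see the degrees of the letters, so that Koszul signs are part of
  them, and only homogeneous letters have to be considered. The rules \<open>ev_tmult\<close> and \<open>ev_apply_at\<close>
  turn a product or a coproduct inside a tensor into nested evaluations; then an antipode or counit
  axiom collapses the innermost one. A sign that remains afterwards disappears for one of two
  reasons: the counit vanishes on odd elements, or \<open>\<Phi>\<close>, \<open>R\<close> and \<open>R\<^sup>-\<^sup>1\<close> are even. The tensors
  \<open>\<Phi>\<close> and \<open>R\<close> are even because a tensor power of \<open>\<epsilon>\<close> does not vanish at an invertible tensor.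
\<close>

text \<open>Degrees are handled by ring normalisation. These two rules would rewrite their sums and products
  into bit operations, for which it has no normal form.\<close>

declare add_bit_eq_xor [simp del] mult_bit_eq_and [simp del]

section \<open>Formal sums and linear extension\<close>

lemma lookup_fscale: "Poly_Mapping.lookup (fscale k t) x = k * Poly_Mapping.lookup t x"
  by (simp add: fscale_def map.rep_eq when_def)

lemma vector_space_fscale: "vector_space (fscale :: 'k::field \<Rightarrow> _)"
  by unfold_locales (auto intro!: poly_mapping_eqI simp: lookup_fscale lookup_add algebra_simps)

interpretation fsum: vector_space "fscale :: 'k::field \<Rightarrow> ('a, 'k) fsum \<Rightarrow> _"
  by (rule vector_space_fscale)

context vector_space
begin

lemma lin_ext_superset:
  assumes "finite A" "Poly_Mapping.keys t \<subseteq> A"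
  shows "lin_ext scale f t = (\<Sum>w\<in>A. scale (Poly_Mapping.lookup t w) (f w))"
  unfolding lin_ext_def using assms
  by (intro sum.mono_neutral_left) (auto simp: in_keys_iff)

lemma lin_ext_add: "lin_ext scale f (s + t) = lin_ext scale f s + lin_ext scale f t"
proof -
  let ?A = "Poly_Mapping.keys s \<union> Poly_Mapping.keys t \<union> Poly_Mapping.keys (s + t)"
  have "lin_ext scale f u = (\<Sum>w\<in>?A. scale (Poly_Mapping.lookup u w) (f w))"
    if "u \<in> {s, t, s + t}" for u
    using that by (intro lin_ext_superset) auto
  then show ?thesis
    by (simp add: lookup_add scale_left_distrib sum.distrib)
qed

lemma lin_ext_fscale: "lin_ext scale f (fscale k t) = scale k (lin_ext scale f t)"
proof -
  have "Poly_Mapping.keys (fscale k t) \<subseteq> Poly_Mapping.keys t"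
    by (auto simp: in_keys_iff lookup_fscale)
  then have "lin_ext scale f (fscale k t) =
      (\<Sum>w\<in>Poly_Mapping.keys t. scale (Poly_Mapping.lookup (fscale k t) w) (f w))"
    by (intro lin_ext_superset) auto
  then show ?thesis
    by (simp add: lin_ext_def lookup_fscale scale_sum_right)
qed

lemma lin_ext_zero [simp]: "lin_ext scale f 0 = 0"
  by (simp add: lin_ext_def)

lemma lin_ext_diff: "lin_ext scale f (s - t) = lin_ext scale f s - lin_ext scale f t"
  using lin_ext_add[of f "s - t" t] by simp

lemma lin_ext_sum: "lin_ext scale f (sum h A) = (\<Sum>i\<in>A. lin_ext scale f (h i))"
  by (induction A rule: infinite_finite_induct) (auto simp: lin_ext_add)

lemma lin_ext_pure [simp]: "lin_ext scale f (pure_tens w) = f w"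
  by (simp add: lin_ext_def pure_tens_def)

lemma lin_ext_comp:
  "lin_ext scale f (lin_ext fscale h t) = lin_ext scale (\<lambda>w. lin_ext scale f (h w)) t"
  by (simp add: lin_ext_def[of fscale] lin_ext_def[of scale "\<lambda>w. lin_ext scale f (h w)"]
      lin_ext_sum lin_ext_fscale)

lemma lin_ext_swap:
  "lin_ext scale (\<lambda>v. lin_ext scale (f v) t) s = lin_ext scale (\<lambda>w. lin_ext scale (\<lambda>v. f v w) s) t"
  unfolding lin_ext_def scale_sum_right by (subst sum.swap) (simp add: mult.commute)

lemma lin_ext_sum_fun:
  "lin_ext scale (\<lambda>w. \<Sum>i\<in>A. f i w) t = (\<Sum>i\<in>A. lin_ext scale (f i) t)"
  unfolding lin_ext_def scale_sum_right by (rule sum.swap)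

end

lemma lin_ext_cong:
  "(\<And>w. w \<in> Poly_Mapping.keys t \<Longrightarrow> f w = g w) \<Longrightarrow> lin_ext sc f t = lin_ext sc g t"
  by (simp add: lin_ext_def)

lemma keys_fscale: "Poly_Mapping.keys (fscale k t) \<subseteq> Poly_Mapping.keys t"
  by (auto simp: in_keys_iff lookup_fscale)

lemma tens_sum: "(\<And>i. i \<in> A \<Longrightarrow> h i \<in> tens n) \<Longrightarrow> sum h A \<in> tens n"
  by (induction A rule: infinite_finite_induct) (fastforce simp: tens_def dest: subsetD[OF keys_add])+

lemma tens_fscale: "t \<in> tens n \<Longrightarrow> fscale k t \<in> tens n"
  using keys_fscale[of k t] by (auto simp: tens_def)

lemma tens_pure [simp]: "pure_tens w \<in> tens n \<longleftrightarrow> length w = n"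
  by (auto simp: tens_def pure_tens_def)

lemma tens_lin_ext:
  assumes "t \<in> tens n" and "\<And>w. length w = n \<Longrightarrow> f w \<in> tens m"
  shows "lin_ext fscale f t \<in> tens m"
  unfolding lin_ext_def using assms by (intro tens_sum tens_fscale) (auto simp: tens_def)

lemma tens_insert_one: "t \<in> tens n \<Longrightarrow> insert_one i t \<in> tens (Suc n)"
  unfolding insert_one_def by (rule tens_lin_ext) auto

lemma tens_apply_at:
  assumes "t \<in> tens n" "i < n" "\<And>a. f a \<in> tens 2"
  shows "apply_at i f t \<in> tens (Suc n)"
  unfolding apply_at_def using assms
  by (intro tens_lin_ext[OF assms(1)] tens_lin_ext[OF assms(3)]) auto

lemma tens_apply_form_at: "t \<in> tens (Suc n) \<Longrightarrow> i \<le> n \<Longrightarrow> apply_form_at i f t \<in> tens n"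
  unfolding apply_form_at_def by (erule tens_lin_ext) (auto intro: tens_fscale)

section \<open>Sums over degrees\<close>

lemma UNIV_bit: "(UNIV :: bit set) = {0, 1}"
  by (auto intro: bit.exhaust)

lemma finite_bit_lists: "finite {p :: bit list. length p = n}"
proof -
  have "finite (UNIV :: bit set)"
    by (simp add: UNIV_bit)
  from finite_lists_length_eq[OF this, of n] show ?thesis
    by simp
qed

lemma sum_bit_lists_append:
  "(\<Sum>p | length (p :: bit list) = m + n. F p)
    = (\<Sum>p | length p = m. \<Sum>q | length q = n. F (p @ q))"
proof -
  have "(\<Sum>p | length p = m. \<Sum>q | length q = n. F (p @ q))
      = (\<Sum>(p, q)\<in>{p. length p = m} \<times> {q. length q = n}. F (p @ q))"
    by (simp add: sum.cartesian_product finite_bit_lists)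
  also have "\<dots> = (\<Sum>p | length p = m + n. F p)"
    by (rule sum.reindex_bij_witness[where i = "\<lambda>p. (take m p, drop m p)" and j = "\<lambda>(p, q). p @ q"])
      auto
  finally show ?thesis by simp
qed

lemma sum_bit_lists_1: "(\<Sum>p | length (p :: bit list) = Suc 0. F p) = (\<Sum>c\<in>UNIV. F [c])"
  by (rule sum.reindex_bij_witness[where i = "\<lambda>c. [c]" and j = hd]) (auto simp: length_Suc_conv)

lemma sum_bit_lists_Suc:
  "(\<Sum>p | length (p :: bit list) = Suc n. F p) = (\<Sum>c\<in>UNIV. \<Sum>p | length p = n. F (c # p))"
  using sum_bit_lists_append[where m = 1 and n = n and F = F] by (simp add: sum_bit_lists_1)

lemma sum_bit: "(\<Sum>c\<in>UNIV. F (c :: bit)) = F 0 + F 1"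
  by (simp add: UNIV_bit)

lemma ksign_add: "ksign (c + d) = (ksign c * ksign d :: 'k::field)"
  by (cases c; cases d) (auto simp: ksign_def)

lemma ksign_0 [simp]: "ksign 0 = 1"
  by (simp add: ksign_def)

lemma bit_add_self [simp]: "(c :: bit) + c = 0" "c + (c + d) = d"
  by (cases c; cases d; simp)+

lemma bit_mult_self [simp]: "(c :: bit) * c = c" "c * (c * d) = c * d"
  by (cases c; simp)+

context superalgebra
begin

section \<open>Homogeneous components\<close>

lemma zero_in_G [simp]: "0 \<in> G d"
  using subspace_G subspace_0 by blast

lemma G_add: "a \<in> G d \<Longrightarrow> b \<in> G d \<Longrightarrow> a + b \<in> G d"
  using subspace_G subspace_add by blast

lemma G_diff: "a \<in> G d \<Longrightarrow> b \<in> G d \<Longrightarrow> a - b \<in> G d"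
  using subspace_G subspace_diff by blast

lemma G_scale: "a \<in> G d \<Longrightarrow> scale k a \<in> G d"
  using subspace_G subspace_scale by blast

lemma G_independent: "a \<in> G d \<Longrightarrow> a \<in> G (d + 1) \<Longrightarrow> a = 0"
  using G_disjoint by (cases d) auto

lemma hpart_eqI:
  assumes "b \<in> G d" "a - b \<in> G (d + 1)"
  shows "hpart d a = b"
  unfolding hpart_def
proof (rule the_equality)
  fix c assume c: "c \<in> G d \<and> a - c \<in> G (d + 1)"
  have "c - b \<in> G d"
    using c assms G_diff by blast
  moreover have "c - b \<in> G (d + 1)"
    using G_diff[of "a - b" "d + 1" "a - c"] c assms by simp
  ultimately show "c = b"
    using G_independent[of "c - b" d] by simp
qed (use assms in simp)

lemma hpart_in_G [simp]: "hpart d a \<in> G d"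
  and diff_hpart_in_G: "a - hpart d a \<in> G (d + 1)"
proof -
  obtain b c where "b \<in> G 0" "c \<in> G 1" "a = b + c"
    using G_decomp by blast
  then have "\<exists>b\<in>G d. a - b \<in> G (d + 1)"
    by (cases d) (auto intro: bexI[of _ b] bexI[of _ c])
  then obtain b where "b \<in> G d" "a - b \<in> G (d + 1)"
    by blast
  then show "hpart d a \<in> G d" "a - hpart d a \<in> G (d + 1)"
    using hpart_eqI by metis+
qed

lemma hpart_same: "a \<in> G d \<Longrightarrow> hpart d a = a"
  by (rule hpart_eqI) auto

lemma hpart_other: "a \<in> G c \<Longrightarrow> c \<noteq> d \<Longrightarrow> hpart d a = 0"
  by (rule hpart_eqI) (cases c; cases d; auto)+

lemma hpart_sum: "hpart 0 a + hpart 1 a = a"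
proof -
  have "hpart 1 a = a - hpart 0 a"
    using diff_hpart_in_G[of a 0] by (intro hpart_eqI) auto
  then show ?thesis
    by simp
qed

lemma hpart_add: "hpart d (a + b) = hpart d a + hpart d b"
  using G_add[OF diff_hpart_in_G[of a d] diff_hpart_in_G[of b d]]
  by (intro hpart_eqI G_add) (auto simp: algebra_simps)

lemma hpart_scale: "hpart d (scale k a) = scale k (hpart d a)"
  using G_scale[OF diff_hpart_in_G[of a d], of k]
  by (intro hpart_eqI G_scale) (auto simp: scale_right_diff_distrib)

section \<open>Evaluating tensors by graded multilinear functionals\<close>

definition klin :: "('a \<Rightarrow> 'a) \<Rightarrow> bool" where
  "klin h \<longleftrightarrow> (\<forall>a b. h (a + b) = h a + h b) \<and> (\<forall>k a. h (scale k a) = scale k (h a))"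

lemma klin_add: "klin h \<Longrightarrow> h (a + b) = h a + h b"
  and klin_scale_arg: "klin h \<Longrightarrow> h (scale k a) = scale k (h a)"
  by (auto simp: klin_def)

lemma klin_zero: "klin h \<Longrightarrow> h 0 = 0"
  using klin_scale_arg[of h 0 0] by simp

lemma klin_sum: "klin h \<Longrightarrow> h (sum f A) = (\<Sum>i\<in>A. h (f i))"
  by (induction A rule: infinite_finite_induct) (auto simp: klin_zero klin_add)

lemma klin_id: "klin (\<lambda>x. x)"
  and klin_mult_left: "klin h \<Longrightarrow> klin (\<lambda>x. c * h x)"
  and klin_mult_right: "klin h \<Longrightarrow> klin (\<lambda>x. h x * c)"
  and klin_scale: "klin h \<Longrightarrow> klin (\<lambda>x. scale k (h x))"
  by (auto simp: klin_def algebra_simps scale_mult_left scale_mult_right mult.commute)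

lemma klin_hpart_parts: "klin h \<Longrightarrow> h (hpart 0 a) + h (hpart 1 a) = h a"
  by (metis klin_add hpart_sum)

text \<open>A functional takes the degrees \<open>p\<close> of the letters as an argument next to the letters
  themselves: a Koszul sign such as \<open>(-1)\<^bsup>[x][y]\<^esup>\<close> is not a linear function of \<open>x\<close>, but it is constant
  on each homogeneous component.\<close>

definition multilinear :: "nat \<Rightarrow> (bit list \<Rightarrow> 'a list \<Rightarrow> 'a) \<Rightarrow> bool" where
  "multilinear n f \<longleftrightarrow> (\<forall>p xs i. length p = n \<longrightarrow> length xs = n \<longrightarrow> i < n \<longrightarrow>
     klin (\<lambda>a. f p (xs[i := a])))"

text \<open>The value of a functional on a word with arbitrary letters: each letter is split into its two
  homogeneous components.\<close>

definition hsum :: "(bit list \<Rightarrow> 'a list \<Rightarrow> 'a) \<Rightarrow> 'a list \<Rightarrow> 'a" where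
  "hsum f w = (\<Sum>p | length p = length w. f p (map2 hpart p w))"

definition ev :: "nat \<Rightarrow> (bit list \<Rightarrow> 'a list \<Rightarrow> 'a) \<Rightarrow> ('a, 'k) fsum \<Rightarrow> 'a" where
  "ev n f t = lin_ext scale (\<lambda>w. if length w = n then hsum f w else 0) t"

definition homog :: "bit list \<Rightarrow> 'a list \<Rightarrow> bool" where
  "homog p xs \<longleftrightarrow> list_all2 (\<lambda>x c. x \<in> G c) xs p"

lemma homog_length: "homog p xs \<Longrightarrow> length xs = length p"
  by (auto simp: homog_def list_all2_lengthD)

lemma homog_Nil [simp]: "homog [] xs \<longleftrightarrow> xs = []"
  and homog_Cons [simp]: "homog (c # p) (x # xs) \<longleftrightarrow> x \<in> G c \<and> homog p xs"
  by (auto simp: homog_def)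

lemma homog_hpart: "length p = length w \<Longrightarrow> homog p (map2 hpart p w)"
  by (auto simp: homog_def list_all2_conv_all_nth)

lemma homog_nth: "homog p xs \<Longrightarrow> i < length p \<Longrightarrow> xs ! i \<in> G (p ! i)"
  by (auto simp: homog_def list_all2_conv_all_nth)

lemma homog_mult: "homog p xs \<Longrightarrow> homog q ys \<Longrightarrow> homog (map2 (+) p q) (map2 (*) xs ys)"
  by (auto simp: homog_def list_all2_conv_all_nth G_mult)

lemma multilinear_klin:
  "multilinear n f \<Longrightarrow> length p = n \<Longrightarrow> length xs = n \<Longrightarrow> i < n \<Longrightarrow> klin (\<lambda>a. f p (xs[i := a]))"
  by (simp add: multilinear_def)

lemma multilinear_zero:
  assumes "multilinear n f" "length p = n" "length xs = n" "i < n" "xs ! i = 0"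
  shows "f p xs = 0"
  using klin_zero[OF multilinear_klin[OF assms(1-4)]] assms(5) list_update_id[of xs i] by simp

lemma map2_hpart_update:
  "i < length p \<Longrightarrow> length p = length xs \<Longrightarrow>
    map2 hpart p (xs[i := a]) = (map2 hpart p xs)[i := hpart (p ! i) a]"
  by (auto intro!: nth_equalityI simp: nth_list_update)

lemma klin_hsum:
  assumes "multilinear n f" "length xs = n" "i < n"
  shows "klin (\<lambda>a. hsum f (xs[i := a]))"
proof -
  have "klin (\<lambda>a. f p ((map2 hpart p xs)[i := hpart (p ! i) a]))" if "length p = n" for p
    using multilinear_klin[OF assms(1) that _ assms(3), of "map2 hpart p xs"] assms that
    by (simp add: klin_def hpart_add hpart_scale)
  then show ?thesis
    using assms by (simp add: klin_def hsum_def map2_hpart_update sum.distrib scale_sum_right)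
qed

lemma ev_add: "ev n f (s + t) = ev n f s + ev n f t"
  and ev_diff: "ev n f (s - t) = ev n f s - ev n f t"
  and ev_fscale: "ev n f (fscale k t) = scale k (ev n f t)"
  and ev_sum: "ev n f (sum h A) = (\<Sum>i\<in>A. ev n f (h i))"
  by (simp_all add: ev_def lin_ext_add lin_ext_diff lin_ext_fscale lin_ext_sum)

lemma ev_pure: "ev n f (pure_tens w) = (if length w = n then hsum f w else 0)"
  by (simp add: ev_def)

lemma ev_lin_ext: "ev n f (lin_ext fscale h t) = lin_ext scale (\<lambda>w. ev n f (h w)) t"
  unfolding ev_def by (rule lin_ext_comp)

lemma ev_tens:
  "t \<in> tens n \<Longrightarrow> ev n f t = lin_ext scale (hsum f) t"
  unfolding ev_def by (rule lin_ext_cong) (auto simp: tens_def)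

text \<open>A multilinear functional vanishes on the multilinearity relations, so it is a function on the
  tensor power.\<close>

lemma ev_tens_eq:
  assumes "s \<approx> t" "multilinear n f"
  shows "ev n f s = ev n f t"
proof -
  have "ev n f d = 0" if "d \<in> fsum.span (multilinearity_relations scale)" for d
    using that
  proof (induction rule: fsum.span_induct)
    case base
    show ?case
      unfolding fsum.subspace_def by (auto simp: ev_add ev_fscale) (simp add: ev_def)
  next
    case (step d)
    have klin: "klin (\<lambda>a. hsum f (us @ [a] @ vs))" if "length us + length vs = n - 1" "0 < n" for us vs
      using klin_hsum[OF assms(2), of "us @ [0] @ vs" "length us"] that by simp
    from step show ?case
    proof cases
      case (additive us a b vs)
      then show ?thesis
        using klin_add[OF klin[of us vs]] by (auto simp: ev_diff ev_pure)
    next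
      case (scaling us k a vs)
      then show ?thesis
        using klin_scale_arg[OF klin[of us vs]] by (auto simp: ev_diff ev_fscale ev_pure)
    qed
  qed
  from this[of "s - t"] assms(1) show ?thesis
    by (simp add: tens_eq_def ev_diff)
qed

lemma ev_cong:
  assumes "\<And>p xs. length p = n \<Longrightarrow> homog p xs \<Longrightarrow> f p xs = g p xs"
  shows "ev n f t = ev n g t"
  unfolding ev_def hsum_def using assms by (intro lin_ext_cong) (auto intro!: sum.cong simp: homog_hpart)

text \<open>Of the summands of \<open>hsum\<close>, only the one at the degrees of \<open>w\<close> has no letter \<open>0\<close>.\<close>

lemma hsum_homog:
  assumes "multilinear n f" "homog p w" "length p = n"
  shows "hsum f w = f p w"
proof -
  have len: "length w = n"
    using assms homog_length by metis
  have "f q (map2 hpart q w) = 0" if "length q = n" "q \<noteq> p" for q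
  proof -
    have "\<exists>i<n. q ! i \<noteq> p ! i"
      using that assms(3) by (auto simp: list_eq_iff_nth_eq)
    then obtain i where "i < n" "q ! i \<noteq> p ! i"
      by blast
    then show ?thesis
      using assms that len by (intro multilinear_zero[of n f q _ i]) (auto simp: hpart_other[of _ "p ! i"] homog_nth)
  qed
  then have "hsum f w = (\<Sum>q\<in>{p}. f q (map2 hpart q w))"
    unfolding hsum_def using assms(3) len by (intro sum.mono_neutral_right finite_bit_lists) auto
  moreover have "map2 hpart p w = w"
    using assms len by (intro nth_equalityI) (auto simp: hpart_same homog_nth)
  ultimately show ?thesis
    by simp
qed

lemma ev_pure_homog:
  "multilinear n f \<Longrightarrow> homog p w \<Longrightarrow> length p = n \<Longrightarrow> ev n f (pure_tens w) = f p w"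
  by (auto simp: ev_pure hsum_homog dest: homog_length)

lemma klin_ev: "klin h \<Longrightarrow> ev n (\<lambda>p xs. h (f p xs)) t = h (ev n f t)"
  unfolding ev_def lin_ext_def hsum_def
  by (auto simp: klin_sum klin_scale_arg klin_zero intro!: sum.cong)

lemma klin_ev_fun:
  assumes "\<And>p xs. length p = n \<Longrightarrow> length xs = n \<Longrightarrow> klin (\<lambda>x. f x p xs)"
  shows "klin (\<lambda>x. ev n (f x) t)"
proof -
  have "hsum (f (x + y)) w = hsum (f x) w + hsum (f y) w" if "length w = n" for x y w
    using that by (auto simp: hsum_def klin_add[OF assms] sum.distrib[symmetric] intro!: sum.cong)
  moreover have "hsum (f (scale k x)) w = scale k (hsum (f x) w)" if "length w = n" for k x w
    using that by (auto simp: hsum_def klin_scale_arg[OF assms] scale_sum_right intro!: sum.cong)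
  ultimately show ?thesis
    by (auto simp: klin_def ev_def lin_ext_def sum.distrib[symmetric] scale_sum_right
        scale_right_distrib mult.commute intro!: sum.cong)
qed

text \<open>Fubini for the finite sums behind \<open>ev\<close>. It brings the sum over a coproduct to the inside,
  where an antipode axiom applies to it.\<close>

lemma ev_swap:
  "ev m (\<lambda>p xs. ev n (f p xs) t) s = ev n (\<lambda>q ys. ev m (\<lambda>p xs. f p xs q ys) s) t"
proof -
  have *: "(if length v = m then hsum (\<lambda>p xs. ev n (g p xs) u) v else 0) =
      lin_ext scale (\<lambda>w. if length v = m \<and> length w = n then
        \<Sum>p | length p = length v. hsum (g p (map2 hpart p v)) w else 0) u"
    for v m n u and g :: "bit list \<Rightarrow> 'a list \<Rightarrow> bit list \<Rightarrow> 'a list \<Rightarrow> 'a"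
  proof (cases "length v = m")
    case True
    then show ?thesis
      by (subst hsum_def) (auto simp: ev_def simp flip: lin_ext_sum_fun intro!: lin_ext_cong)
  qed (simp add: lin_ext_def)
  have "ev m (\<lambda>p xs. ev n (f p xs) t) s = lin_ext scale (\<lambda>v. lin_ext scale (\<lambda>w.
      if length v = m \<and> length w = n
      then \<Sum>p | length p = length v. hsum (f p (map2 hpart p v)) w else 0) t) s"
    by (subst ev_def) (simp only: *)
  also have "\<dots> = lin_ext scale (\<lambda>w. lin_ext scale (\<lambda>v. if length w = n \<and> length v = m
      then \<Sum>q | length q = length w. hsum (\<lambda>p xs. f p xs q (map2 hpart q w)) v else 0) s) t"
    by (subst lin_ext_swap, intro lin_ext_cong) (auto simp: hsum_def intro: sum.swap)
  also have "\<dots> = ev n (\<lambda>q ys. ev m (\<lambda>p xs. f p xs q ys) s) t"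
    by (subst ev_def) (simp only: *)
  finally show ?thesis .
qed

lemma hsum_append:
  "hsum f (us @ vs) = (\<Sum>p | length p = length us. \<Sum>q | length q = length vs.
     f (p @ q) (map2 hpart p us @ map2 hpart q vs))"
  by (simp add: hsum_def sum_bit_lists_append)

lemma hsum_Cons: "hsum f (x # xs) = (\<Sum>c\<in>UNIV. hsum (\<lambda>p ys. f (c # p) (hpart c x # ys)) xs)"
  by (simp add: hsum_def sum_bit_lists_Suc)

lemma hsum_Nil: "hsum f [] = f [] []"
  by (simp add: hsum_def)

section \<open>Products and structure maps under evaluation\<close>

lemma map2_update_left:
  "i < length xs \<Longrightarrow> length xs = length ys \<Longrightarrow>
    map2 f (xs[i := a]) ys = (map2 f xs ys)[i := f a (ys ! i)]"
  by (auto intro!: nth_equalityI simp: nth_list_update)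

lemma map2_update_right:
  "i < length xs \<Longrightarrow> length xs = length ys \<Longrightarrow>
    map2 f xs (ys[i := a]) = (map2 f xs ys)[i := f (xs ! i) a]"
  by (auto intro!: nth_equalityI simp: nth_list_update)

lemma klin_slot:
  assumes "multilinear n f" "length p = n" "length xs = n" "i < n" "klin h"
  shows "klin (\<lambda>a. f p (xs[i := h a]))"
  using multilinear_klin[OF assms(1-4)] assms(5) by (simp add: klin_def)

text \<open>The functional of the second factor of a product that \<open>f\<close> becomes once the first factor is the
  word \<open>xs\<close>.\<close>

abbreviation mult_fun ("\<mu>") where
  "\<mu> f p xs q ys \<equiv> scale (ksign (koszul p q)) (f (map2 (+) p q) (map2 (*) xs ys))"

lemma multilinear_mult_right:
  assumes f: "multilinear n f" and p: "length p = n" "length xs = n"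
  shows "multilinear n (\<mu> f p xs)"
  unfolding multilinear_def
proof (intro allI impI)
  fix q ys i assume q: "length (q :: bit list) = n" "length (ys :: 'a list) = n" "i < n"
  have "klin (\<lambda>a. f (map2 (+) p q) ((map2 (*) xs ys)[i := xs ! i * a]))"
    using p q by (intro klin_slot[OF f] klin_mult_left klin_id) auto
  then show "klin (\<lambda>a. \<mu> f p xs q (ys[i := a]))"
    using p q by (simp add: map2_update_right klin_scale)
qed

lemma multilinear_mult_left:
  assumes f: "multilinear n f"
  shows "multilinear n (\<lambda>p xs. ev n (\<mu> f p xs) t)"
  unfolding multilinear_def
proof (intro allI impI)
  fix p xs i assume p: "length (p :: bit list) = n" "length (xs :: 'a list) = n" "i < n"
  have "klin (\<lambda>a. \<mu> f p (xs[i := a]) q ys)" if q: "length q = n" "length ys = n" for q ys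
  proof -
    have "klin (\<lambda>a. f (map2 (+) p q) ((map2 (*) xs ys)[i := a * ys ! i]))"
      using p q by (intro klin_slot[OF f] klin_mult_right klin_id) auto
    then show ?thesis
      using p q by (simp add: map2_update_left klin_scale)
  qed
  then show "klin (\<lambda>a. ev n (\<mu> f p (xs[i := a])) t)"
    by (rule klin_ev_fun)
qed

lemma word_mult_tens: "length xs = n \<Longrightarrow> length ys = n \<Longrightarrow> word_mult xs ys \<in> tens n"
  unfolding word_mult_def by (intro tens_sum tens_fscale) auto

lemma tens_tmult: "s \<in> tens n \<Longrightarrow> t \<in> tens n \<Longrightarrow> s \<odot> t \<in> tens n"
  unfolding tmult_def by (intro tens_lin_ext word_mult_tens)

lemma ev_tmult:
  assumes "multilinear n f" "s \<in> tens n" "t \<in> tens n"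
  shows "ev n f (s \<odot> t) = ev n (\<lambda>p xs. ev n (\<mu> f p xs) t) s"
proof -
  have word: "ev n f (word_mult v w) = (\<Sum>p | length p = n. hsum (\<mu> f p (map2 hpart p v)) w)"
    if "length v = n" "length w = n" for v w
    using that unfolding word_mult_def hsum_def ev_sum ev_fscale
    by (auto simp: hsum_homog[OF assms(1) homog_mult] homog_hpart ev_pure intro!: sum.cong)
  have "ev n f (s \<odot> t) = lin_ext scale (\<lambda>v. lin_ext scale (\<lambda>w. ev n f (word_mult v w)) t) s"
    by (simp add: tmult_def ev_lin_ext)
  also have "\<dots> = lin_ext scale (\<lambda>v. lin_ext scale (\<lambda>w. \<Sum>p | length p = n. hsum (\<mu> f p (map2 hpart p v)) w) t) s"
    using assms(2,3) by (intro lin_ext_cong word) (auto simp: tens_def)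
  also have "\<dots> = lin_ext scale (hsum (\<lambda>p xs. ev n (\<mu> f p xs) t)) s"
    using assms(2)
    by (intro lin_ext_cong) (auto simp: tens_def lin_ext_sum_fun ev_tens[OF assms(3)] hsum_def[of "\<lambda>p xs. lin_ext scale (hsum (\<mu> f p xs)) t"])
  also have "\<dots> = ev n (\<lambda>p xs. ev n (\<mu> f p xs) t) s"
    by (simp add: ev_tens[OF assms(2)])
  finally show ?thesis .
qed

text \<open>Equality of tensors as functionals see it. In this form the congruence, associativity and unit laws
  of the product follow from \<open>ev_tmult\<close>: both sides become the same nested evaluation.\<close>

definition same_ev :: "nat \<Rightarrow> ('a, 'k) fsum \<Rightarrow> ('a, 'k) fsum \<Rightarrow> bool" where
  "same_ev n s t \<longleftrightarrow> (\<forall>f. multilinear n f \<longrightarrow> ev n f s = ev n f t)"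

lemma same_ev_refl: "same_ev n t t"
  and same_ev_sym: "same_ev n s t \<Longrightarrow> same_ev n t s"
  and same_ev_trans [trans]: "same_ev n r s \<Longrightarrow> same_ev n s t \<Longrightarrow> same_ev n r t"
  by (auto simp: same_ev_def)

lemma same_evD: "same_ev n s t \<Longrightarrow> multilinear n f \<Longrightarrow> ev n f s = ev n f t"
  by (simp add: same_ev_def)

lemma tens_eq_same_ev: "s \<approx> t \<Longrightarrow> same_ev n s t"
  by (simp add: same_ev_def ev_tens_eq)

lemma same_ev_tmult:
  assumes "same_ev n s s'" "same_ev n t t'" "s \<in> tens n" "t \<in> tens n" "s' \<in> tens n" "t' \<in> tens n"
  shows "same_ev n (s \<odot> t) (s' \<odot> t')"
  unfolding same_ev_def
proof (intro allI impI)
  fix f assume f: "multilinear n f"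
  have "ev n f (s \<odot> t) = ev n (\<lambda>p xs. ev n (\<mu> f p xs) t) s'"
    using ev_tmult[OF f] same_evD[OF assms(1) multilinear_mult_left[OF f]] assms by simp
  also have "\<dots> = ev n (\<lambda>p xs. ev n (\<mu> f p xs) t') s'"
    using f by (intro ev_cong same_evD[OF assms(2)] multilinear_mult_right) (auto dest: homog_length)
  also have "\<dots> = ev n f (s' \<odot> t')"
    using ev_tmult[OF f] assms by simp
  finally show "ev n f (s \<odot> t) = ev n f (s' \<odot> t')" .
qed

lemma koszul_add_left:
  "length p = length q \<Longrightarrow> koszul (map2 (+) p q) r = koszul p r + koszul q r"
  by (simp add: koszul_def algebra_simps sum.distrib)

lemma koszul_add_right:
  "length p = length q \<Longrightarrow> length q = length r \<Longrightarrow> koszul p (map2 (+) q r) = koszul p q + koszul p r"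
  by (simp add: koszul_def algebra_simps sum.distrib)

lemma same_ev_tmult_assoc:
  assumes "r \<in> tens n" "s \<in> tens n" "t \<in> tens n"
  shows "same_ev n (r \<odot> s \<odot> t) (r \<odot> (s \<odot> t))"
  unfolding same_ev_def
proof (intro allI impI)
  fix f assume f: "multilinear n f"
  have *: "\<mu> (\<lambda>p xs. ev n (\<mu> f p xs) t) p xs q ys = ev n (\<mu> (\<mu> f p xs) q ys) t"
    if "length p = n" "length q = n" "length xs = n" "length ys = n" for p xs q ys
    unfolding klin_ev[OF klin_scale[OF klin_id], symmetric]
  proof (rule ev_cong)
    fix r zs assume r: "length r = n" "homog r zs"
    have "map2 (+) (map2 (+) p q) r = map2 (+) p (map2 (+) q r)"
      using that r by (intro nth_equalityI) (auto simp: add.assoc)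
    moreover have "map2 (*) (map2 (*) xs ys) zs = map2 (*) xs (map2 (*) ys zs)"
      using that r by (intro nth_equalityI) (auto simp: mult.assoc dest: homog_length)
    ultimately show "scale (ksign (koszul p q)) (\<mu> f (map2 (+) p q) (map2 (*) xs ys) r zs)
        = \<mu> (\<mu> f p xs) q ys r zs"
      using that r by (simp add: koszul_add_left koszul_add_right ksign_add mult_ac)
  qed
  have "ev n f (r \<odot> s \<odot> t) = ev n (\<lambda>p xs. ev n (\<lambda>q ys. \<mu> (\<lambda>p xs. ev n (\<mu> f p xs) t) p xs q ys) s) r"
    using assms f by (simp add: ev_tmult tens_tmult multilinear_mult_left)
  also have "\<dots> = ev n (\<lambda>p xs. ev n (\<lambda>q ys. ev n (\<mu> (\<mu> f p xs) q ys) t) s) r"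
    by (intro ev_cong *) (auto dest: homog_length)
  also have "\<dots> = ev n (\<lambda>p xs. ev n (\<mu> f p xs) (s \<odot> t)) r"
    using assms f by (intro ev_cong ev_tmult[symmetric] multilinear_mult_right) (auto dest: homog_length)
  also have "\<dots> = ev n f (r \<odot> (s \<odot> t))"
    using assms f by (simp add: ev_tmult tens_tmult)
  finally show "ev n f (r \<odot> s \<odot> t) = ev n f (r \<odot> (s \<odot> t))" .
qed

lemma tens_tone [simp]: "tone n \<in> tens n"
  by (simp add: tone_def)

lemma homog_ones: "homog (replicate n 0) (replicate n 1)"
  by (simp add: homog_def list_all2_conv_all_nth G_one)

lemma ev_tone: "multilinear n f \<Longrightarrow> ev n f (tone n) = f (replicate n 0) (replicate n 1)"
  unfolding tone_def by (simp add: ev_pure_homog homog_ones)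

lemma same_ev_tone_left:
  assumes "t \<in> tens n"
  shows "same_ev n (tone n \<odot> t) t"
  unfolding same_ev_def
proof (intro allI impI)
  fix f assume f: "multilinear n f"
  have "ev n f (tone n \<odot> t) = ev n (\<mu> f (replicate n 0) (replicate n 1)) t"
    using assms f by (simp add: ev_tmult ev_tone multilinear_mult_left)
  also have "\<dots> = ev n f t"
  proof (rule ev_cong)
    fix q ys assume q: "length q = n" "homog q ys"
    have "koszul (replicate n 0) q = 0"
      by (simp add: koszul_def)
    moreover have "map2 (+) (replicate n 0) q = q" "map2 (*) (replicate n 1) ys = ys"
      using q by (auto intro!: nth_equalityI dest: homog_length)
    ultimately show "\<mu> f (replicate n 0) (replicate n 1) q ys = f q ys"
      by simp
  qed
  finally show "ev n f (tone n \<odot> t) = ev n f t" .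
qed

lemma same_ev_tone_right:
  assumes "t \<in> tens n"
  shows "same_ev n (t \<odot> tone n) t"
  unfolding same_ev_def
proof (intro allI impI)
  fix f assume f: "multilinear n f"
  have "ev n f (t \<odot> tone n) = ev n (\<lambda>p xs. ev n (\<mu> f p xs) (tone n)) t"
    using assms f by (simp add: ev_tmult)
  also have "\<dots> = ev n f t"
  proof (rule ev_cong)
    fix p xs assume p: "length p = n" "homog p xs"
    have "koszul p (replicate n 0) = 0"
      using p by (simp add: koszul_def)
    moreover have "map2 (+) p (replicate n 0) = p" "map2 (*) xs (replicate n 1) = xs"
      using p by (auto intro!: nth_equalityI dest: homog_length)
    ultimately show "ev n (\<mu> f p xs) (tone n) = f p xs"
      using p f by (subst ev_tone) (auto intro: multilinear_mult_right dest: homog_length)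
  qed
  finally show "ev n f (t \<odot> tone n) = ev n f t" .
qed

lemma same_ev_cancel_left:
  assumes "same_ev n (s' \<odot> s) (tone n)" "same_ev n (s \<odot> t) r"
    "s \<in> tens n" "s' \<in> tens n" "t \<in> tens n" "r \<in> tens n"
  shows "same_ev n t (s' \<odot> r)"
proof -
  have "same_ev n t (tone n \<odot> t)"
    using assms same_ev_tone_left same_ev_sym by blast
  also have "same_ev n \<dots> (s' \<odot> s \<odot> t)"
    using assms by (intro same_ev_tmult same_ev_sym[OF assms(1)] same_ev_refl tens_tmult) auto
  also have "same_ev n \<dots> (s' \<odot> (s \<odot> t))"
    using assms by (intro same_ev_tmult_assoc)
  also have "same_ev n \<dots> (s' \<odot> r)"
    using assms by (intro same_ev_tmult same_ev_refl tens_tmult) auto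
  finally show ?thesis .
qed

lemma same_ev_cancel_right:
  assumes "same_ev n (s \<odot> s') (tone n)" "same_ev n (t \<odot> s) r"
    "s \<in> tens n" "s' \<in> tens n" "t \<in> tens n" "r \<in> tens n"
  shows "same_ev n t (r \<odot> s')"
proof -
  have "same_ev n t (t \<odot> tone n)"
    using assms same_ev_tone_right same_ev_sym by blast
  also have "same_ev n \<dots> (t \<odot> (s \<odot> s'))"
    using assms by (intro same_ev_tmult same_ev_sym[OF assms(1)] same_ev_refl tens_tmult) auto
  also have "same_ev n \<dots> (t \<odot> s \<odot> s')"
    using assms by (intro same_ev_sym[OF same_ev_tmult_assoc])
  also have "same_ev n \<dots> (r \<odot> s')"
    using assms by (intro same_ev_tmult same_ev_refl tens_tmult) auto
  finally show ?thesis .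
qed

lemma hsum_linear_word:
  assumes "multilinear n (\<lambda>_. f)" "length us + length w = n"
  shows "hsum (\<lambda>_ ys. f (us @ ys)) w = f (us @ w)"
  using assms(2)
proof (induction w arbitrary: us)
  case Nil
  then show ?case
    by (simp add: hsum_Nil)
next
  case (Cons x w)
  have "hsum (\<lambda>_ ys. f (us @ hpart c x # ys)) w = f (us @ hpart c x # w)" for c
    using Cons.IH[of "us @ [hpart c x]"] Cons.prems by simp
  then show ?case
    using klin_hpart_parts[OF multilinear_klin[OF assms(1), of "replicate n 0" "us @ [x] @ w" "length us"], of x] Cons.prems
    by (simp add: hsum_Cons sum_bit)
qed

text \<open>A multilinear functional whose values do not depend on the degrees sums over the homogeneous
  components to its value at the whole letters. This is how the axioms for \<open>\<alpha>\<close> and \<open>\<beta>\<close>, which are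
  linear extensions, become statements about \<open>ev\<close>.\<close>

lemma lin_ext_eq_ev:
  assumes "multilinear n (\<lambda>_. f)" "t \<in> tens n"
  shows "lin_ext scale f t = ev n (\<lambda>_. f) t"
  using hsum_linear_word[OF assms(1), of "[]"] assms(2)
  by (auto simp: ev_tens tens_def intro!: lin_ext_cong)

lemma klin_ev_map:
  assumes "multilinear m g" "\<And>a b. D (a + b) \<approx> D a + D b" "\<And>k a. D (scale k a) \<approx> fscale k (D a)"
  shows "klin (\<lambda>a. ev m g (D a))"
  using ev_tens_eq[OF assms(2,1)] ev_tens_eq[OF assms(3,1)]
  by (simp add: klin_def ev_add ev_fscale)

lemma split_word:
  assumes "i < length w"
  obtains us x vs where "w = us @ x # vs" "length us = i"
  using id_take_nth_drop[OF assms] assms by (metis length_take min.absorb4)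

lemma hsum_split:
  "hsum f (us @ x # vs) = (\<Sum>p | length p = length us. \<Sum>c\<in>UNIV. \<Sum>q | length q = length vs.
     f (p @ c # q) (map2 hpart p us @ hpart c x # map2 hpart q vs))"
  by (simp add: hsum_append sum_bit_lists_Suc)

lemma ev_apply_at:
  assumes f: "multilinear (Suc n) f" and t: "t \<in> tens n" and i: "i < n"
    and D: "\<And>a. D a \<in> tens 2" "\<And>a b. D (a + b) \<approx> D a + D b" "\<And>k a. D (scale k a) \<approx> fscale k (D a)"
  shows "ev (Suc n) f (apply_at i D t) = ev n (\<lambda>p xs. ev 2 (\<lambda>q ys.
      f (take i p @ q @ drop (Suc i) p) (take i xs @ ys @ drop (Suc i) xs)) (D (xs ! i))) t"
    (is "_ = ev n ?g t")
proof -
  have "ev (Suc n) f (lin_ext fscale (\<lambda>ys. pure_tens (take i w @ ys @ drop (Suc i) w)) (D (w ! i)))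
      = hsum ?g w" if w: "length w = n" for w
  proof -
    obtain us x vs where [simp]: "w = us @ x # vs" "length us = i"
      using split_word i w by metis
    let ?h = "\<lambda>p p' q ys. f (p @ q @ p') (map2 hpart p us @ ys @ map2 hpart p' vs)"
    have ml: "multilinear 2 (?h p p')" if "length p = length us" "length p' = length vs" for p p'
      unfolding multilinear_def
    proof (intro allI impI)
      fix q ys and j :: nat assume q: "length (q :: bit list) = 2" "length (ys :: 'a list) = 2" "j < 2"
      have "klin (\<lambda>a. f (p @ q @ p') ((map2 hpart p us @ ys @ map2 hpart p' vs)[i + j := a]))"
        using that q w by (intro multilinear_klin[OF f]) auto
      then show "klin (\<lambda>a. ?h p p' q (ys[j := a]))"
        using that q by (simp add: list_update_append)
    qed
    have "ev (Suc n) f (lin_ext fscale (\<lambda>ys. pure_tens (us @ ys @ vs)) (D x))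
      = lin_ext scale (\<lambda>ys. hsum f (us @ ys @ vs)) (D x)"
      using D(1)[of x] w by (auto simp: ev_lin_ext ev_pure tens_def intro!: lin_ext_cong)
    also have "\<dots> = lin_ext scale (\<lambda>ys. \<Sum>p | length p = length us. \<Sum>p' | length p' = length vs.
        hsum (?h p p') ys) (D x)"
      by (rule lin_ext_cong, simp add: hsum_append sum_bit_lists_append hsum_def)
        (intro sum.cong refl sum.swap)
    also have "\<dots> = (\<Sum>p | length p = length us. \<Sum>p' | length p' = length vs. ev 2 (?h p p') (D x))"
      by (simp add: lin_ext_sum_fun ev_tens[OF D(1)])
    also have "\<dots> = (\<Sum>p | length p = length us. \<Sum>p' | length p' = length vs.
        \<Sum>c\<in>UNIV. ev 2 (?h p p') (D (hpart c x)))"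
      using klin_hpart_parts[OF klin_ev_map[OF ml D(2,3)], of _ _ x]
      by (intro sum.cong refl) (simp add: sum_bit)
    also have "\<dots> = hsum ?g w"
      unfolding \<open>w = us @ x # vs\<close> hsum_split \<open>length us = i\<close>[symmetric]
      by (intro sum.cong refl, subst sum.swap) (auto intro!: sum.cong simp: nth_append)
    finally show ?thesis
      by (simp add: nth_append)
  qed
  then show ?thesis
    unfolding apply_at_def ev_lin_ext[of "Suc n"] ev_tens[OF t] using t
    by (intro lin_ext_cong) (auto simp: tens_def)
qed

lemma ev_apply_form_at:
  assumes t: "t \<in> tens (Suc n)" and i: "i \<le> n" and \<phi>: "\<And>a b. \<phi> (a + b) = \<phi> a + \<phi> b"
  shows "ev n f (apply_form_at i \<phi> t) = ev (Suc n) (\<lambda>p xs.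
      scale (\<phi> (xs ! i)) (f (take i p @ drop (Suc i) p) (take i xs @ drop (Suc i) xs))) t"
    (is "_ = ev _ ?g t")
proof -
  have "scale (\<phi> (w ! i)) (ev n f (pure_tens (take i w @ drop (Suc i) w))) = hsum ?g w"
    if w: "length w = Suc n" for w
  proof -
    obtain us x vs where [simp]: "w = us @ x # vs" "length us = i"
      using split_word i w by (metis le_imp_less_Suc)
    have "\<phi> (hpart 0 x) + \<phi> (hpart 1 x) = \<phi> x"
      by (metis \<phi> hpart_sum)
    then have parts: "(\<Sum>c\<in>UNIV. scale (\<phi> (hpart c x)) y) = scale (\<phi> x) y" for y
      by (simp add: sum_bit flip: scale_left_distrib)
    have "hsum ?g w = (\<Sum>p | length p = length us. \<Sum>c\<in>UNIV. \<Sum>q | length q = length vs.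
        scale (\<phi> (hpart c x)) (f (p @ q) (map2 hpart p us @ map2 hpart q vs)))"
      unfolding \<open>w = us @ x # vs\<close> hsum_split \<open>length us = i\<close>[symmetric]
      by (intro sum.cong refl) (auto simp: nth_append)
    also have "\<dots> = (\<Sum>p | length p = length us. \<Sum>q | length q = length vs.
        scale (\<phi> x) (f (p @ q) (map2 hpart p us @ map2 hpart q vs)))"
      by (rule sum.cong[OF refl], subst sum.swap) (simp only: parts)
    also have "\<dots> = scale (\<phi> x) (hsum f (us @ vs))"
      by (simp only: hsum_append scale_sum_right)
    also have "\<dots> = scale (\<phi> (w ! i)) (ev n f (pure_tens (take i w @ drop (Suc i) w)))"
      using w \<open>length us = i\<close> by (auto simp: ev_pure nth_append)
    finally show ?thesis ..
  qed
  then show ?thesis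
    unfolding apply_form_at_def ev_lin_ext ev_tens[OF t] using t
    by (intro lin_ext_cong) (auto simp: tens_def ev_fscale)
qed

lemma ev_insert_one:
  assumes f: "multilinear (Suc n) f" and t: "t \<in> tens n" and i: "i \<le> n"
  shows "ev (Suc n) f (insert_one i t) =
    ev n (\<lambda>p xs. f (take i p @ 0 # drop i p) (take i xs @ 1 # drop i xs)) t" (is "_ = ev n ?g t")
proof -
  have "hsum f (take i w @ 1 # drop i w) = hsum ?g w" if w: "length w = n" for w
  proof -
    define us vs where "us = take i w" and "vs = drop i w"
    have [simp]: "length us = i"
      using i w by (auto simp: us_def)
    have "f (p @ 1 # q) (map2 hpart p us @ 0 # map2 hpart q vs) = 0"
      if "length p = i" "length q = length vs" for p q
      using that w i by (intro multilinear_zero[OF f, of _ _ i]) (auto simp: nth_append us_def vs_def)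
    then have "hsum f (us @ 1 # vs) = (\<Sum>p | length p = length us. \<Sum>q | length q = length vs.
        f (p @ 0 # q) (map2 hpart p us @ 1 # map2 hpart q vs))"
      unfolding hsum_split
      by (auto simp: sum_bit hpart_same[OF G_one] hpart_other[OF G_one] intro!: sum.cong)
    also have "\<dots> = hsum ?g (us @ vs)"
      unfolding hsum_append by (intro sum.cong refl) auto
    finally show ?thesis
      by (simp add: us_def vs_def)
  qed
  then show ?thesis
    unfolding insert_one_def ev_lin_ext ev_tens[OF t] using t i
    by (intro lin_ext_cong) (auto simp: tens_def ev_pure)
qed

lemma ev_flip:
  assumes f: "multilinear 2 f" and t: "t \<in> tens 2"
  shows "ev 2 f (flip_at 0 t) =
    ev 2 (\<lambda>p xs. scale (ksign (p ! 0 * p ! 1)) (f [p ! 1, p ! 0] [xs ! 1, xs ! 0])) t"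
proof -
  have "ev 2 f (pure_tens [hpart d y, hpart c x]) = f [d, c] [hpart d y, hpart c x]" for c d x y
    using f by (intro ev_pure_homog) auto
  then have "(\<Sum>c\<in>UNIV. \<Sum>d\<in>UNIV. scale (ksign (c * d)) (ev 2 f (pure_tens [hpart d y, hpart c x])))
      = hsum (\<lambda>p xs. scale (ksign (p ! 0 * p ! 1)) (f [p ! 1, p ! 0] [xs ! 1, xs ! 0])) [x, y]" for x y
    by (simp add: hsum_Cons hsum_Nil)
  then show ?thesis
    unfolding flip_at_def ev_lin_ext ev_tens[OF t] ev_sum ev_fscale using t
    by (intro lin_ext_cong) (auto simp: tens_def numeral_2_eq_2 length_Suc_conv)
qed

text \<open>Homogeneity as seen by functionals. In contrast to \<open>homogeneous_tens\<close> it can be shown for a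
  tensor such as an inverse, for which no expansion into homogeneous words is given.\<close>

definition of_degree :: "nat \<Rightarrow> bit \<Rightarrow> ('a, 'k) fsum \<Rightarrow> bool" where
  "of_degree n d t \<longleftrightarrow> (\<forall>f g. multilinear n f \<longrightarrow> multilinear n g \<longrightarrow>
     (\<forall>p xs. length p = n \<longrightarrow> homog p xs \<longrightarrow> sum_list p = d \<longrightarrow> f p xs = g p xs) \<longrightarrow> ev n f t = ev n g t)"

lemma ev_zero: "ev n (\<lambda>p xs. 0) t = 0"
  by (simp add: ev_def hsum_def lin_ext_def if_distrib cong: if_cong)

lemma homogeneous_tens_of_degree:
  assumes "t \<in> homogeneous_tens n d"
  shows "of_degree n d t"
  unfolding of_degree_def
proof (intro allI impI)
  fix f g assume f: "multilinear n f" and g: "multilinear n g"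
    and fg: "\<forall>p xs. length p = n \<longrightarrow> homog p xs \<longrightarrow> sum_list p = d \<longrightarrow> f p xs = g p xs"
  obtain s where s: "t \<approx> s" "\<And>w. w \<in> Poly_Mapping.keys s \<Longrightarrow> \<exists>p. length p = n \<and> homog p w \<and> sum_list p = d"
    using assms unfolding homogeneous_tens_def homog_def[symmetric] by auto
  have "ev n f s = ev n g s"
    unfolding ev_def
  proof (rule lin_ext_cong)
    fix w assume "w \<in> Poly_Mapping.keys s"
    then obtain p where "length p = n" "homog p w" "sum_list p = d"
      using s(2) by blast
    then show "(if length w = n then hsum f w else 0) = (if length w = n then hsum g w else 0)"
      using f g fg by (simp add: hsum_homog)
  qed
  then show "ev n f t = ev n g t"
    using ev_tens_eq[OF s(1)] f g by simp
qed

lemma homogeneous_tens_tens: "t \<in> homogeneous_tens n d \<Longrightarrow> t \<in> tens n"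
  by (simp add: homogeneous_tens_def)

definition odd_part :: "('a, 'k) fsum \<Rightarrow> ('a, 'k) fsum" where
  "odd_part t = lin_ext fscale
     (\<lambda>w. \<Sum>p | length p = length w \<and> sum_list p = 1. pure_tens (map2 hpart p w)) t"

lemma tens_odd_part: "t \<in> tens n \<Longrightarrow> odd_part t \<in> tens n"
  unfolding odd_part_def by (erule tens_lin_ext) (auto intro!: tens_sum)

lemma ev_add_fun: "ev n (\<lambda>p xs. f p xs + g p xs) t = ev n f t + ev n g t"
proof -
  have "hsum (\<lambda>p xs. f p xs + g p xs) w = hsum f w + hsum g w" for w
    by (simp add: hsum_def sum.distrib)
  then show ?thesis
    by (auto simp: ev_def lin_ext_def scale_right_distrib simp flip: sum.distrib intro!: sum.cong)
qed

lemma multilinear_restrict: "multilinear n f \<Longrightarrow> multilinear n (\<lambda>p xs. if P p then f p xs else 0)"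
  by (simp add: multilinear_def klin_def)

lemma ev_odd_part:
  assumes "multilinear n f" "t \<in> tens n"
  shows "ev n f (odd_part t) = ev n (\<lambda>p xs. if sum_list p = 1 then f p xs else 0) t"
proof -
  have "ev n f (\<Sum>p | length p = n \<and> sum_list p = 1. pure_tens (map2 hpart p w))
      = hsum (\<lambda>p xs. if sum_list p = 1 then f p xs else 0) w" if w: "length w = n" for w
  proof -
    have "ev n f (\<Sum>p | length p = n \<and> sum_list p = 1. pure_tens (map2 hpart p w))
        = (\<Sum>p | length p = n \<and> sum_list p = 1. f p (map2 hpart p w))"
      unfolding ev_sum using w assms(1) by (intro sum.cong ev_pure_homog) (auto simp: homog_hpart)
    also have "\<dots> = hsum (\<lambda>p xs. if sum_list p = 1 then f p xs else 0) w"
      using w by (simp add: hsum_def flip: sum.inter_filter[OF finite_bit_lists])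
    finally show ?thesis .
  qed
  then show ?thesis
    unfolding odd_part_def ev_lin_ext ev_tens[OF assms(2)] using assms(2)
    by (intro lin_ext_cong) (auto simp: tens_def)
qed

lemma tmult_zero_right [simp]: "s \<odot> 0 = 0"
  by (simp add: tmult_def lin_ext_def)

lemma sum_list_map2_add: "length p = length q \<Longrightarrow> sum_list (map2 (+) p q) = sum_list p + sum_list (q :: bit list)"
  by (induction p q rule: list_induct2) (auto simp: algebra_simps)

text \<open>If \<open>s\<close> is even, then \<open>s\<close> times the odd part of \<open>t\<close> is the odd part of \<open>s \<odot> t\<close>, which is \<open>0\<close>
  because the unit is even. Multiplying by \<open>t\<close> from the left shows that the odd part of \<open>t\<close> is
  \<open>0\<close>.\<close>

lemma of_degree_inverse:
  assumes s: "of_degree n 0 s" "s \<in> tens n" and t: "t \<in> tens n"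
    and st: "same_ev n (s \<odot> t) (tone n)" and ts: "same_ev n (t \<odot> s) (tone n)"
  shows "of_degree n 0 t"
proof -
  have "same_ev n (s \<odot> odd_part t) 0"
    unfolding same_ev_def
  proof (intro allI impI)
    fix f assume f: "multilinear n f"
    let ?f = "\<lambda>p xs. if sum_list p = 1 then f p xs else 0"
    have f': "multilinear n ?f"
      using f by (rule multilinear_restrict)
    have "ev n f (s \<odot> odd_part t) = ev n (\<lambda>p xs. ev n (\<mu> f p xs) (odd_part t)) s"
      using f s t by (simp add: ev_tmult tens_odd_part)
    also have "\<dots> = ev n (\<lambda>p xs. ev n (\<mu> ?f p xs) t) s"
    proof -
      have "ev n (\<mu> f p xs) (odd_part t) = ev n (\<mu> ?f p xs) t"
        if "length p = n" "homog p xs" "sum_list p = 0" for p xs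
      proof -
        have "ev n (\<mu> f p xs) (odd_part t) = ev n (\<lambda>q ys. if sum_list q = 1 then \<mu> f p xs q ys else 0) t"
          using that f t by (intro ev_odd_part multilinear_mult_right) (auto dest: homog_length)
        also have "\<dots> = ev n (\<mu> ?f p xs) t"
          using that by (intro ev_cong) (simp add: sum_list_map2_add)
        finally show ?thesis .
      qed
      then show ?thesis
        using s(1) multilinear_mult_left[OF f] multilinear_mult_left[OF f'] unfolding of_degree_def by blast
    qed
    also have "\<dots> = ev n ?f (s \<odot> t)"
      using f' s t by (simp add: ev_tmult)
    also have "\<dots> = ev n ?f (tone n)"
      by (rule same_evD[OF st f'])
    also have "\<dots> = 0"
      by (simp add: ev_tone[OF f'] sum_list_replicate)
    finally show "ev n f (s \<odot> odd_part t) = ev n f 0"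
      by (simp add: ev_def)
  qed
  moreover have "(0 :: ('a, 'k) fsum) \<in> tens n"
    by (simp add: tens_def)
  ultimately have odd: "same_ev n (odd_part t) 0"
    using same_ev_cancel_left[OF ts, of "odd_part t" 0] s t tens_odd_part by simp
  show ?thesis
    unfolding of_degree_def
  proof (intro allI impI)
    fix f g assume f: "multilinear n f" and g: "multilinear n g"
      and fg: "\<forall>p xs. length p = n \<longrightarrow> homog p xs \<longrightarrow> sum_list p = 0 \<longrightarrow> f p xs = g p xs"
    let ?odd = "\<lambda>f p xs. if sum_list p = 1 then f p xs else 0"
    let ?even = "\<lambda>f p xs. if sum_list p = 0 then f p xs else (0 :: 'a)"
    have split: "ev n f t = ev n (?even f) t" if "multilinear n f" for f
    proof -
      have "ev n f t = ev n (\<lambda>p xs. ?even f p xs + ?odd f p xs) t"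
        by (intro ev_cong) auto
      also have "\<dots> = ev n (?even f) t + ev n (?odd f) t"
        by (rule ev_add_fun)
      also have "ev n (?odd f) t = 0"
        using ev_odd_part[OF that t] same_evD[OF odd that] by (simp add: ev_def)
      finally show ?thesis
        by simp
    qed
    show "ev n f t = ev n g t"
      unfolding split[OF f] split[OF g] using fg by (intro ev_cong) auto
  qed
qed

lemma ev_expansion:
  assumes "multilinear n f" "homogeneous_expansion scale G t I w" "\<And>i. i \<in> I \<Longrightarrow> length (w i) = n"
  shows "ev n f t = (\<Sum>i\<in>I. f (map (deg G) (w i)) (w i))"
proof -
  have t: "t \<approx> (\<Sum>i\<in>I. pure_tens (w i))"
    and hom: "\<And>i x. i \<in> I \<Longrightarrow> x \<in> set (w i) \<Longrightarrow> homogeneous G x"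
    using assms(2) by (auto simp: homogeneous_expansion_def)
  have "x \<in> G (deg G x)" if x: "homogeneous G x" for x
  proof -
    obtain d where "x \<in> G d"
      using x by (auto simp: homogeneous_def)
    then show ?thesis
      by (cases d) (auto simp: deg_def)
  qed
  then have "homog (map (deg G) (w i)) (w i)" if "i \<in> I" for i
    using hom[OF that] by (auto simp: homog_def list_all2_conv_all_nth)
  then show ?thesis
    using assms(1,3) by (auto simp: ev_tens_eq[OF t] ev_sum intro!: sum.cong ev_pure_homog)
qed

section \<open>Functionals on two, three and four factors\<close>

text \<open>Functionals in curried form, where each letter and its degree have a name.\<close>

lemma length_2_conv: "length xs = 2 \<longleftrightarrow> (\<exists>x y. xs = [x, y])"
  and length_3_conv: "length xs = 3 \<longleftrightarrow> (\<exists>x y z. xs = [x, y, z])"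
  and length_4_conv: "length xs = 4 \<longleftrightarrow> (\<exists>x y z t. xs = [x, y, z, t])"
  by (auto simp: eval_nat_numeral length_Suc_conv)

lemma less_2_conv: "(i::nat) < 2 \<longleftrightarrow> i = 0 \<or> i = 1"
  and less_3_conv: "(i::nat) < 3 \<longleftrightarrow> i = 0 \<or> i = 1 \<or> i = 2"
  and less_4_conv: "(i::nat) < 4 \<longleftrightarrow> i = 0 \<or> i = 1 \<or> i = 2 \<or> i = 3"
  by auto

definition fun2 :: "(bit \<Rightarrow> 'a \<Rightarrow> bit \<Rightarrow> 'a \<Rightarrow> 'a) \<Rightarrow> bit list \<Rightarrow> 'a list \<Rightarrow> 'a" where
  "fun2 f = (\<lambda>p xs. f (p ! 0) (xs ! 0) (p ! 1) (xs ! 1))"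
definition fun3 ::
  "(bit \<Rightarrow> 'a \<Rightarrow> bit \<Rightarrow> 'a \<Rightarrow> bit \<Rightarrow> 'a \<Rightarrow> 'a) \<Rightarrow> bit list \<Rightarrow> 'a list \<Rightarrow> 'a" where
  "fun3 f = (\<lambda>p xs. f (p ! 0) (xs ! 0) (p ! 1) (xs ! 1) (p ! 2) (xs ! 2))"
definition fun4 ::
  "(bit \<Rightarrow> 'a \<Rightarrow> bit \<Rightarrow> 'a \<Rightarrow> bit \<Rightarrow> 'a \<Rightarrow> bit \<Rightarrow> 'a \<Rightarrow> 'a) \<Rightarrow> bit list \<Rightarrow> 'a list \<Rightarrow> 'a" where
  "fun4 f = (\<lambda>p xs. f (p ! 0) (xs ! 0) (p ! 1) (xs ! 1) (p ! 2) (xs ! 2) (p ! 3) (xs ! 3))"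

lemma fun2_simp [simp]: "fun2 f [p, q] [x, y] = f p x q y"
  and fun3_simp [simp]: "fun3 g [p, q, r] [x, y, z] = g p x q y r z"
  and fun4_simp [simp]: "fun4 h [p, q, r, s] [x, y, z, t] = h p x q y r z s t"
  by (simp_all add: fun2_def fun3_def fun4_def numeral_2_eq_2 numeral_3_eq_3)

definition ev2 :: "(bit \<Rightarrow> 'a \<Rightarrow> bit \<Rightarrow> 'a \<Rightarrow> 'a) \<Rightarrow> ('a, 'k) fsum \<Rightarrow> 'a" where
  "ev2 f = ev 2 (fun2 f)"
definition ev3 :: "(bit \<Rightarrow> 'a \<Rightarrow> bit \<Rightarrow> 'a \<Rightarrow> bit \<Rightarrow> 'a \<Rightarrow> 'a) \<Rightarrow> ('a, 'k) fsum \<Rightarrow> 'a" where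
  "ev3 f = ev 3 (fun3 f)"
definition ev4 ::
  "(bit \<Rightarrow> 'a \<Rightarrow> bit \<Rightarrow> 'a \<Rightarrow> bit \<Rightarrow> 'a \<Rightarrow> bit \<Rightarrow> 'a \<Rightarrow> 'a) \<Rightarrow> ('a, 'k) fsum \<Rightarrow> 'a" where
  "ev4 f = ev 4 (fun4 f)"

definition ml2 :: "(bit \<Rightarrow> 'a \<Rightarrow> bit \<Rightarrow> 'a \<Rightarrow> 'a) \<Rightarrow> bool" where
  "ml2 f \<longleftrightarrow> (\<forall>p q x y. klin (\<lambda>a. f p a q y) \<and> klin (\<lambda>a. f p x q a))"
definition ml3 :: "(bit \<Rightarrow> 'a \<Rightarrow> bit \<Rightarrow> 'a \<Rightarrow> bit \<Rightarrow> 'a \<Rightarrow> 'a) \<Rightarrow> bool" where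
  "ml3 f \<longleftrightarrow> (\<forall>p q r x y z.
     klin (\<lambda>a. f p a q y r z) \<and> klin (\<lambda>a. f p x q a r z) \<and> klin (\<lambda>a. f p x q y r a))"
definition ml4 :: "(bit \<Rightarrow> 'a \<Rightarrow> bit \<Rightarrow> 'a \<Rightarrow> bit \<Rightarrow> 'a \<Rightarrow> bit \<Rightarrow> 'a \<Rightarrow> 'a) \<Rightarrow> bool" where
  "ml4 f \<longleftrightarrow> (\<forall>p q r s x y z t.
     klin (\<lambda>a. f p a q y r z s t) \<and> klin (\<lambda>a. f p x q a r z s t) \<and>
     klin (\<lambda>a. f p x q y r a s t) \<and> klin (\<lambda>a. f p x q y r z s a))"

lemma ml2I:
  assumes "\<And>p q y. klin (\<lambda>a. f p a q y)" "\<And>p q x. klin (\<lambda>a. f p x q a)"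
  shows "ml2 f"
  using assms by (simp add: ml2_def)

lemma ml3I:
  assumes "\<And>p q r y z. klin (\<lambda>a. f p a q y r z)" "\<And>p q r x z. klin (\<lambda>a. f p x q a r z)"
    "\<And>p q r x y. klin (\<lambda>a. f p x q y r a)"
  shows "ml3 f"
  using assms by (simp add: ml3_def)

lemma ml4I:
  assumes "\<And>p q r s y z t. klin (\<lambda>a. f p a q y r z s t)" "\<And>p q r s x z t. klin (\<lambda>a. f p x q a r z s t)"
    "\<And>p q r s x y t. klin (\<lambda>a. f p x q y r a s t)" "\<And>p q r s x y z. klin (\<lambda>a. f p x q y r z s a)"
  shows "ml4 f"
  using assms by (simp add: ml4_def)

lemma klin_comp: "klin g \<Longrightarrow> klin h \<Longrightarrow> klin (\<lambda>a. g (h a))"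
  by (simp add: klin_def)

lemma ml2_klin:
  assumes "ml2 f" "klin h"
  shows "klin (\<lambda>a. f p (h a) q y)" "klin (\<lambda>a. f p x q (h a))"
  using assms by (auto simp: ml2_def klin_def)

lemma ml3_klin:
  assumes "ml3 f" "klin h"
  shows "klin (\<lambda>a. f p (h a) q y r z)" "klin (\<lambda>a. f p x q (h a) r z)" "klin (\<lambda>a. f p x q y r (h a))"
  using assms by (auto simp: ml3_def klin_def)

lemma ml4_klin:
  assumes "ml4 f" "klin h"
  shows "klin (\<lambda>a. f p (h a) q y r z s w)" "klin (\<lambda>a. f p x q (h a) r z s w)"
    "klin (\<lambda>a. f p x q y r (h a) s w)" "klin (\<lambda>a. f p x q y r z s (h a))"
  using assms by (auto simp: ml4_def klin_def)

lemma multilinear_fun2: "ml2 f \<Longrightarrow> multilinear 2 (fun2 f)"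
  by (auto simp: multilinear_def ml2_def length_2_conv less_2_conv)

lemma multilinear_fun3: "ml3 f \<Longrightarrow> multilinear 3 (fun3 f)"
  by (auto simp: multilinear_def ml3_def length_3_conv less_3_conv numeral_2_eq_2)

lemma multilinear_fun4: "ml4 f \<Longrightarrow> multilinear 4 (fun4 f)"
  by (auto simp: multilinear_def ml4_def length_4_conv less_4_conv numeral_2_eq_2 numeral_3_eq_3)

lemma homog_2: "length p = 2 \<Longrightarrow> homog p xs \<Longrightarrow> \<exists>a b x y. p = [a, b] \<and> xs = [x, y] \<and> x \<in> G a \<and> y \<in> G b"
  and homog_3: "length p = 3 \<Longrightarrow> homog p xs \<Longrightarrow>
    \<exists>a b c x y z. p = [a, b, c] \<and> xs = [x, y, z] \<and> x \<in> G a \<and> y \<in> G b \<and> z \<in> G c"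
  and homog_4: "length p = 4 \<Longrightarrow> homog p xs \<Longrightarrow> \<exists>a b c d x y z t. p = [a, b, c, d] \<and> xs = [x, y, z, t] \<and>
    x \<in> G a \<and> y \<in> G b \<and> z \<in> G c \<and> t \<in> G d"
  by (auto simp: homog_def list_all2_Cons2 length_2_conv length_3_conv length_4_conv)

lemma ev2_cong: "(\<And>p x q y. x \<in> G p \<Longrightarrow> y \<in> G q \<Longrightarrow> f p x q y = g p x q y) \<Longrightarrow> ev2 f t = ev2 g t"
  unfolding ev2_def by (rule ev_cong) (auto dest!: homog_2)

lemma ev3_cong: "(\<And>p x q y r z. x \<in> G p \<Longrightarrow> y \<in> G q \<Longrightarrow> z \<in> G r \<Longrightarrow>
    f p x q y r z = g p x q y r z) \<Longrightarrow> ev3 f t = ev3 g t"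
  unfolding ev3_def by (rule ev_cong) (auto dest!: homog_3)

lemma ev4_cong: "(\<And>p x q y r z s w. x \<in> G p \<Longrightarrow> y \<in> G q \<Longrightarrow> z \<in> G r \<Longrightarrow> w \<in> G s \<Longrightarrow>
    f p x q y r z s w = g p x q y r z s w) \<Longrightarrow> ev4 f t = ev4 g t"
  unfolding ev4_def by (rule ev_cong) (auto dest!: homog_4)

lemma klin_ev2: "klin h \<Longrightarrow> ev2 (\<lambda>p x q y. h (f p x q y)) t = h (ev2 f t)"
  and klin_ev3: "klin h \<Longrightarrow> ev3 (\<lambda>p x q y r z. h (f' p x q y r z)) t = h (ev3 f' t)"
  and klin_ev4: "klin h \<Longrightarrow> ev4 (\<lambda>p x q y r z s w. h (f'' p x q y r z s w)) t = h (ev4 f'' t)"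
  unfolding ev2_def ev3_def ev4_def fun2_def fun3_def fun4_def by (rule klin_ev, assumption)+

lemma klin_ev2_fun: "(\<And>p x q y. klin (\<lambda>a. f a p x q y)) \<Longrightarrow> klin (\<lambda>a. ev2 (f a) t)"
  and klin_ev3_fun: "(\<And>p x q y r z. klin (\<lambda>a. f' a p x q y r z)) \<Longrightarrow> klin (\<lambda>a. ev3 (f' a) t)"
  and klin_ev4_fun: "(\<And>p x q y r z s w. klin (\<lambda>a. f'' a p x q y r z s w)) \<Longrightarrow> klin (\<lambda>a. ev4 (f'' a) t)"
  unfolding ev2_def ev3_def ev4_def fun2_def fun3_def fun4_def
  by (rule klin_ev_fun, blast)+

lemma ev22_swap: "ev2 (\<lambda>p x q y. ev2 (f2 p x q y) t) s = ev2 (\<lambda>p' x' q' y'. ev2 (\<lambda>p x q y. f2 p x q y p' x' q' y') s) t"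
  and ev23_swap: "ev2 (\<lambda>p x q y. ev3 (f3 p x q y) t) s
    = ev3 (\<lambda>p' x' q' y' r' z'. ev2 (\<lambda>p x q y. f3 p x q y p' x' q' y' r' z') s) t"
  and ev24_swap: "ev2 (\<lambda>p x q y. ev4 (f4 p x q y) t) s
    = ev4 (\<lambda>p' x' q' y' r' z' s' w'. ev2 (\<lambda>p x q y. f4 p x q y p' x' q' y' r' z' s' w') s) t"
  unfolding ev2_def ev3_def ev4_def fun2_def fun3_def fun4_def
  by (rule ev_swap)+

lemma koszul_2: "koszul [a, b] [c, d] = b * c"
  and koszul_3: "koszul [a, b, a'] [c, d, c'] = b * c + a' * (c + d)"
  and koszul_4: "koszul [a, b, a', b'] [c, d, c', d'] = b * c + a' * (c + d) + b' * (c + d + c')"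
  by (simp_all add: koszul_def eval_nat_numeral algebra_simps)

lemma ev2_tmult:
  assumes "ml2 f" "s \<in> tens 2" "t \<in> tens 2"
  shows "ev2 f (s \<odot> t) = ev2 (\<lambda>p x q y. ev2 (\<lambda>p' x' q' y'.
    scale (ksign (q * p')) (f (p + p') (x * x') (q + q') (y * y'))) t) s"
  unfolding ev2_def ev_tmult[OF multilinear_fun2[OF assms(1)] assms(2,3)]
  by (intro ev_cong) (auto dest!: homog_2 simp: fun2_def[of "\<lambda>p x q y. ev 2 _ _"] koszul_2 intro!: ev_cong)

lemma ev3_tmult:
  assumes "ml3 f" "s \<in> tens 3" "t \<in> tens 3"
  shows "ev3 f (s \<odot> t) = ev3 (\<lambda>p x q y r z. ev3 (\<lambda>p' x' q' y' r' z'.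
    scale (ksign (q * p' + r * (p' + q'))) (f (p + p') (x * x') (q + q') (y * y') (r + r') (z * z'))) t) s"
  unfolding ev3_def ev_tmult[OF multilinear_fun3[OF assms(1)] assms(2,3)]
  by (intro ev_cong) (auto dest!: homog_3 simp: koszul_3 intro!: ev_cong)

lemma ev4_tmult:
  assumes "ml4 f" "s \<in> tens 4" "t \<in> tens 4"
  shows "ev4 f (s \<odot> t) = ev4 (\<lambda>p x q y r z v w. ev4 (\<lambda>p' x' q' y' r' z' v' w'.
    scale (ksign (q * p' + r * (p' + q') + v * (p' + q' + r')))
      (f (p + p') (x * x') (q + q') (y * y') (r + r') (z * z') (v + v') (w * w'))) t) s"
  unfolding ev4_def ev_tmult[OF multilinear_fun4[OF assms(1)] assms(2,3)]
  by (intro ev_cong) (auto dest!: homog_4 simp: koszul_4 intro!: ev_cong)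

lemma ev2_same: "same_ev 2 s t \<Longrightarrow> ml2 f \<Longrightarrow> ev2 f s = ev2 f t"
  and ev3_same: "same_ev 3 s t \<Longrightarrow> ml3 g \<Longrightarrow> ev3 g s = ev3 g t"
  and ev4_same: "same_ev 4 s t \<Longrightarrow> ml4 h \<Longrightarrow> ev4 h s = ev4 h t"
  by (simp_all add: ev2_def ev3_def ev4_def same_evD multilinear_fun2 multilinear_fun3 multilinear_fun4)

lemma ev2_tone: "ml2 f \<Longrightarrow> ev2 f (tone 2) = f 0 1 0 1"
  and ev3_tone: "ml3 g \<Longrightarrow> ev3 g (tone 3) = g 0 1 0 1 0 1"
  by (simp_all add: ev2_def ev3_def ev_tone multilinear_fun2 multilinear_fun3)
    (simp_all add: fun2_def fun3_def)

lemma ev4_tone: "ml4 f \<Longrightarrow> ev4 f (tone 4) = f 0 1 0 1 0 1 0 1"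
  by (simp add: ev4_def ev_tone multilinear_fun4) (simp add: fun4_def)

lemma same_ev_3I:
  assumes "\<And>f. ml3 f \<Longrightarrow> ev3 f s = ev3 f t"
  shows "same_ev 3 s t"
  unfolding same_ev_def
proof (intro allI impI)
  fix f assume f: "multilinear 3 f"
  define g where "g = (\<lambda>p x q y r z. f [p, q, r] [x, y, z])"
  have slot: "klin (\<lambda>a. f [p, q, r] ([x, y, z][i := a]))" if "i < 3" for p q r x y z i
    using multilinear_klin[OF f, of "[p, q, r]" "[x, y, z]"] that by simp
  have "ml3 g"
    unfolding g_def using slot[of 0] slot[of 1] slot[of 2]
    by (intro ml3I) (simp_all add: numeral_2_eq_2)
  moreover have "ev 3 f u = ev3 g u" for u
    unfolding ev3_def g_def by (intro ev_cong) (auto dest!: homog_3)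
  ultimately show "ev 3 f s = ev 3 f t"
    using assms by simp
qed

lemma same_ev_4I:
  assumes "\<And>f. ml4 f \<Longrightarrow> ev4 f s = ev4 f t"
  shows "same_ev 4 s t"
  unfolding same_ev_def
proof (intro allI impI)
  fix f assume f: "multilinear 4 f"
  define g where "g = (\<lambda>p x q y r z s w. f [p, q, r, s] [x, y, z, w])"
  have slot: "klin (\<lambda>a. f [p, q, r, s] ([x, y, z, w][i := a]))" if "i < 4" for p q r s x y z w i
    using multilinear_klin[OF f, of "[p, q, r, s]" "[x, y, z, w]"] that by simp
  have "ml4 g"
    unfolding g_def using slot[of 0] slot[of 1] slot[of 2] slot[of 3]
    by (intro ml4I) (simp_all add: numeral_2_eq_2 numeral_3_eq_3)
  moreover have "ev 4 f u = ev4 g u" for u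
    unfolding ev4_def g_def by (intro ev_cong) (auto dest!: homog_4)
  ultimately show "ev 4 f s = ev 4 f t"
    using assms by simp
qed

lemma ev2_degree:
  assumes "of_degree 2 d t" "ml2 f" "ml2 g"
    "\<And>p x q y. x \<in> G p \<Longrightarrow> y \<in> G q \<Longrightarrow> p + q = d \<Longrightarrow> f p x q y = g p x q y"
  shows "ev2 f t = ev2 g t"
proof -
  have "fun2 f p xs = fun2 g p xs" if "length p = 2" "homog p xs" "sum_list p = d" for p xs
    using homog_2[OF that(1,2)] that(3) assms(4) by auto
  then show ?thesis
    using assms(1-3) by (simp add: ev2_def of_degree_def multilinear_fun2)
qed

lemma ev3_degree:
  assumes "of_degree 3 d t" "ml3 f" "ml3 g"
    "\<And>p x q y r z. x \<in> G p \<Longrightarrow> y \<in> G q \<Longrightarrow> z \<in> G r \<Longrightarrow> p + q + r = d \<Longrightarrow>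
      f p x q y r z = g p x q y r z"
  shows "ev3 f t = ev3 g t"
proof -
  have "fun3 f p xs = fun3 g p xs" if "length p = 3" "homog p xs" "sum_list p = d" for p xs
    using homog_3[OF that(1,2)] that(3) assms(4) by (auto simp: add.assoc)
  then show ?thesis
    using assms(1-3) by (simp add: ev3_def of_degree_def multilinear_fun3)
qed

lemma lin_ext_eq_ev2:
  assumes "ml2 (\<lambda>p x q y. f x y)" "t \<in> tens 2"
  shows "lin_ext scale (\<lambda>xs. f (xs ! 0) (xs ! 1)) t = ev2 (\<lambda>p x q y. f x y) t"
  using lin_ext_eq_ev[of 2 "\<lambda>xs. f (xs ! 0) (xs ! 1)"] assms
    multilinear_fun2[of "\<lambda>p x q y. f x y"] by (simp add: ev2_def fun2_def)

lemma lin_ext_eq_ev3: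
  assumes "ml3 (\<lambda>p x q y r z. f x y z)" "t \<in> tens 3"
  shows "lin_ext scale (\<lambda>xs. f (xs ! 0) (xs ! 1) (xs ! 2)) t = ev3 (\<lambda>p x q y r z. f x y z) t"
  using lin_ext_eq_ev[of 3 "\<lambda>xs. f (xs ! 0) (xs ! 1) (xs ! 2)"] assms
    multilinear_fun3[of "\<lambda>p x q y r z. f x y z"] by (simp add: ev3_def fun3_def)

lemma ev2_flip:
  assumes "ml2 f" "t \<in> tens 2"
  shows "ev2 f (flip_at 0 t) = ev2 (\<lambda>p x q y. scale (ksign (p * q)) (f q y p x)) t"
  unfolding ev2_def using ev_flip[OF multilinear_fun2[OF assms(1)] assms(2)]
  by (simp add: fun2_def)

lemma tens_flip: "t \<in> tens 2 \<Longrightarrow> flip_at 0 t \<in> tens 2"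
  unfolding flip_at_def by (erule tens_lin_ext) (auto intro!: tens_sum tens_fscale)

lemma ev2_expansion:
  assumes "ml2 f" "homogeneous_expansion scale G t I (\<lambda>i. [x i, y i])"
  shows "ev2 f t = (\<Sum>i\<in>I. f (deg G (x i)) (x i) (deg G (y i)) (y i))"
  unfolding ev2_def using ev_expansion[OF multilinear_fun2[OF assms(1)] assms(2)] by simp

lemma ev3_expansion:
  assumes "ml3 f" "homogeneous_expansion scale G t I (\<lambda>i. [x i, y i, z i])"
  shows "ev3 f t = (\<Sum>i\<in>I. f (deg G (x i)) (x i) (deg G (y i)) (y i) (deg G (z i)) (z i))"
  unfolding ev3_def using ev_expansion[OF multilinear_fun3[OF assms(1)] assms(2)] by simp

lemma ev4_insert_first:
  assumes "ml4 f" "t \<in> tens 3"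
  shows "ev4 f (insert_one 0 t) = ev3 (\<lambda>p x q y r z. f 0 1 p x q y r z) t"
  unfolding ev4_def ev3_def using ev_insert_one[of 3 "fun4 f" t 0] multilinear_fun4[OF assms(1)] assms(2)
  by (auto dest!: homog_3 intro!: ev_cong)

lemma ev4_insert_last:
  assumes "ml4 f" "t \<in> tens 3"
  shows "ev4 f (insert_one 3 t) = ev3 (\<lambda>p x q y r z. f p x q y r z 0 1) t"
  unfolding ev4_def ev3_def using ev_insert_one[of 3 "fun4 f" t 3] multilinear_fun4[OF assms(1)] assms(2)
  by (auto dest!: homog_3 intro!: ev_cong)

end

context quasi_hopf_superalgebra
begin

section \<open>The axioms of a quasi-Hopf superalgebra on functionals\<close>

lemma klin_S_arg: "klin S"
  using S_linear by (simp add: klin_def linear_iff Vector_Spaces.linear_iff)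

lemma \<epsilon>_add: "\<epsilon> (a + b) = \<epsilon> a + \<epsilon> b"
  and \<epsilon>_scale: "\<epsilon> (scale k a) = k * \<epsilon> a"
  using \<epsilon>_linear by (simp_all add: Vector_Spaces.linear_iff)

lemma \<epsilon>_sum: "\<epsilon> (sum f A) = (\<Sum>i\<in>A. \<epsilon> (f i))"
  using \<epsilon>_scale[of 0 0] by (induction A rule: infinite_finite_induct) (auto simp: \<epsilon>_add)

lemma klin_S: "klin h \<Longrightarrow> klin (\<lambda>x. S (h x))"
  by (rule klin_comp[OF klin_S_arg])

lemma klin_\<epsilon>: "klin h \<Longrightarrow> klin (\<lambda>x. scale (\<epsilon> (h x)) c)"
  by (simp add: klin_def \<epsilon>_add \<epsilon>_scale scale_left_distrib)

lemma klin_\<Delta>: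
  assumes "ml2 f" "klin h"
  shows "klin (\<lambda>x. ev2 f (\<Delta> (h x)))"
  using klin_comp[OF klin_ev_map[OF multilinear_fun2[OF assms(1)] \<Delta>_add \<Delta>_scale] assms(2)]
  by (simp add: ev2_def)

lemma S_zero: "S 0 = 0" and S_add: "S (a + b) = S a + S b" and S_scale: "S (scale k a) = scale k (S a)"
  using klin_zero[OF klin_S_arg] klin_add[OF klin_S_arg] klin_scale_arg[OF klin_S_arg] by auto

lemma S_inv [simp]: "S (inv S a) = a" "inv S (S a) = a"
  using S_bij by (simp_all add: bij_is_surj surj_f_inv_f bij_is_inj)

lemma inv_S_add: "inv S (a + b) = inv S a + inv S b"
  and inv_S_scale: "inv S (scale k a) = scale k (inv S a)"
  by (metis S_add S_inv, metis S_scale S_inv)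

lemma klin_inv_S: "klin h \<Longrightarrow> klin (\<lambda>x. inv S (h x))"
  by (simp add: klin_def inv_S_add inv_S_scale)

text \<open>Applied backwards, these rules prove that a functional given by a term is multilinear.\<close>

lemmas ml_intros = ml2I ml3I ml4I klin_id klin_mult_left klin_mult_right klin_scale klin_S klin_inv_S klin_\<epsilon> klin_\<Delta>
  klin_ev2_fun klin_ev3_fun klin_ev4_fun

lemma \<epsilon>_odd: "a \<in> G p \<Longrightarrow> p \<noteq> 0 \<Longrightarrow> \<epsilon> a = 0"
  using \<epsilon>_grading by (cases p) auto

lemma \<Phi>_tens: "\<Phi> \<in> tens 3"
  using \<Phi>_homogeneous homogeneous_tens_tens by blast

lemma \<Delta>_degree:
  assumes "a \<in> G d" "ml2 f" "ml2 g"
    "\<And>p x q y. x \<in> G p \<Longrightarrow> y \<in> G q \<Longrightarrow> p + q = d \<Longrightarrow> f p x q y = g p x q y"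
  shows "ev2 f (\<Delta> a) = ev2 g (\<Delta> a)"
  using ev2_degree[OF homogeneous_tens_of_degree[OF \<Delta>_grading[OF assms(1)]] assms(2-4)] .

lemma tens_\<Delta>_at: "t \<in> tens n \<Longrightarrow> i < n \<Longrightarrow> apply_at i \<Delta> t \<in> tens (Suc n)"
  by (rule tens_apply_at) (auto simp: \<Delta>_tens)

lemma ev3_\<Delta>_0:
  assumes "ml3 f" "t \<in> tens 2"
  shows "ev3 f (apply_at 0 \<Delta> t)
    = ev2 (\<lambda>p x q y. ev2 (\<lambda>p\<^sub>1 x\<^sub>1 p\<^sub>2 x\<^sub>2. f p\<^sub>1 x\<^sub>1 p\<^sub>2 x\<^sub>2 q y) (\<Delta> x)) t"
  unfolding ev3_def ev2_def
  using ev_apply_at[of 2 "fun3 f" t 0 \<Delta>] multilinear_fun3[OF assms(1)] assms(2) \<Delta>_tens \<Delta>_add \<Delta>_scale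
  by (auto dest!: homog_2 intro!: ev_cong)

lemma ev3_\<Delta>_1:
  assumes "ml3 f" "t \<in> tens 2"
  shows "ev3 f (apply_at 1 \<Delta> t)
    = ev2 (\<lambda>p x q y. ev2 (\<lambda>q\<^sub>1 y\<^sub>1 q\<^sub>2 y\<^sub>2. f p x q\<^sub>1 y\<^sub>1 q\<^sub>2 y\<^sub>2) (\<Delta> y)) t"
  unfolding ev3_def ev2_def
  using ev_apply_at[of 2 "fun3 f" t 1 \<Delta>] multilinear_fun3[OF assms(1)] assms(2) \<Delta>_tens \<Delta>_add \<Delta>_scale
  by (auto dest!: homog_2 intro!: ev_cong)

lemma ev4_\<Delta>_0:
  assumes "ml4 f" "t \<in> tens 3"
  shows "ev4 f (apply_at 0 \<Delta> t)
    = ev3 (\<lambda>p x q y r z. ev2 (\<lambda>p\<^sub>1 x\<^sub>1 p\<^sub>2 x\<^sub>2. f p\<^sub>1 x\<^sub>1 p\<^sub>2 x\<^sub>2 q y r z) (\<Delta> x)) t"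
  unfolding ev4_def ev3_def ev2_def
  using ev_apply_at[of 3 "fun4 f" t 0 \<Delta>] multilinear_fun4[OF assms(1)] assms(2) \<Delta>_tens \<Delta>_add \<Delta>_scale
  by (auto dest!: homog_2 homog_3 intro!: ev_cong)

lemma ev4_\<Delta>_1:
  assumes "ml4 f" "t \<in> tens 3"
  shows "ev4 f (apply_at 1 \<Delta> t)
    = ev3 (\<lambda>p x q y r z. ev2 (\<lambda>q\<^sub>1 y\<^sub>1 q\<^sub>2 y\<^sub>2. f p x q\<^sub>1 y\<^sub>1 q\<^sub>2 y\<^sub>2 r z) (\<Delta> y)) t"
  unfolding ev4_def ev3_def ev2_def
  using ev_apply_at[of 3 "fun4 f" t 1 \<Delta>] multilinear_fun4[OF assms(1)] assms(2) \<Delta>_tens \<Delta>_add \<Delta>_scale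
  by (auto dest!: homog_2 homog_3 intro!: ev_cong)

lemma ev4_\<Delta>_2:
  assumes "ml4 f" "t \<in> tens 3"
  shows "ev4 f (apply_at 2 \<Delta> t)
    = ev3 (\<lambda>p x q y r z. ev2 (\<lambda>r\<^sub>1 z\<^sub>1 r\<^sub>2 z\<^sub>2. f p x q y r\<^sub>1 z\<^sub>1 r\<^sub>2 z\<^sub>2) (\<Delta> z)) t"
  unfolding ev4_def ev3_def ev2_def
  using ev_apply_at[of 3 "fun4 f" t 2 \<Delta>] multilinear_fun4[OF assms(1)] assms(2) \<Delta>_tens \<Delta>_add \<Delta>_scale
  by (auto dest!: homog_2 homog_3 intro!: ev_cong)

lemma antipode_\<alpha>_ev: "klin h \<Longrightarrow> ev2 (\<lambda>p x q y. h (S x * \<alpha> * y)) (\<Delta> a) = scale (\<epsilon> a) (h \<alpha>)"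
proof -
  assume h: "klin h"
  have "ml2 (\<lambda>p x q y. S x * \<alpha> * y)"
    by (intro ml_intros)
  then have "ev2 (\<lambda>p x q y. S x * \<alpha> * y) (\<Delta> a) = scale (\<epsilon> a) \<alpha>"
    using antipode_\<alpha>[of a] lin_ext_eq_ev2[OF _ \<Delta>_tens, of "\<lambda>x y. S x * \<alpha> * y" a] by simp
  then show ?thesis
    by (simp only: klin_ev2[OF h] klin_scale_arg[OF h])
qed

lemma antipode_\<beta>_ev: "klin h \<Longrightarrow> ev2 (\<lambda>p x q y. h (x * \<beta> * S y)) (\<Delta> a) = scale (\<epsilon> a) (h \<beta>)"
proof -
  assume h: "klin h"
  have "ml2 (\<lambda>p x q y. x * \<beta> * S y)"
    by (intro ml_intros)
  then have "ev2 (\<lambda>p x q y. x * \<beta> * S y) (\<Delta> a) = scale (\<epsilon> a) \<beta>"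
    using antipode_\<beta>[of a] lin_ext_eq_ev2[OF _ \<Delta>_tens, of "\<lambda>x y. x * \<beta> * S y" a] by simp
  then show ?thesis
    by (simp only: klin_ev2[OF h] klin_scale_arg[OF h])
qed

lemma antipode_\<Phi>inv_ev: "ev3 (\<lambda>p x q y r z. x * \<beta> * S y * \<alpha> * z) \<Phi>inv = 1"
proof -
  have "ml3 (\<lambda>p x q y r z. x * \<beta> * S y * \<alpha> * z)"
    by (intro ml_intros)
  from lin_ext_eq_ev3[OF this \<Phi>inv_tens] show ?thesis
    using antipode_\<Phi>inv by simp
qed

lemma antipode_\<Phi>_ev: "ev3 (\<lambda>p x q y r z. S x * \<alpha> * y * \<beta> * S z) \<Phi> = 1"
proof -
  have "ml3 (\<lambda>p x q y r z. S x * \<alpha> * y * \<beta> * S z)"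
    by (intro ml_intros)
  from lin_ext_eq_ev3[OF this \<Phi>_tens] show ?thesis
    using antipode_\<Phi> by simp
qed

lemma multilinear_1: "(\<And>p. klin (f p)) \<Longrightarrow> multilinear 1 (\<lambda>p xs. f (p ! 0) (xs ! 0))"
  by (auto simp: multilinear_def length_Suc_conv)

lemma counit_left_ev:
  assumes "\<And>p. klin (f p)" "a \<in> G d"
  shows "ev2 (\<lambda>p x q y. scale (\<epsilon> x) (f q y)) (\<Delta> a) = f d a"
proof -
  let ?f = "\<lambda>p xs. f (p ! 0) (xs ! 0)"
  have ml: "multilinear 1 ?f"
    by (rule multilinear_1[OF assms(1)])
  have "ev2 (\<lambda>p x q y. scale (\<epsilon> x) (f q y)) (\<Delta> a) = ev 1 ?f (apply_form_at 0 \<epsilon> (\<Delta> a))"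
    unfolding ev2_def using ev_apply_form_at[of "\<Delta> a" 1 0 \<epsilon> ?f] \<Delta>_tens \<epsilon>_add
    by (auto simp: numeral_2_eq_2 fun2_def length_Suc_conv intro!: ev_cong dest!: homog_length)
  also have "\<dots> = ev 1 ?f (pure_tens [a])"
    by (rule ev_tens_eq[OF counit_left ml])
  also have "\<dots> = f d a"
    using ev_pure_homog[OF ml, of "[d]" "[a]"] assms(2) by simp
  finally show ?thesis .
qed

lemma counit_right_ev:
  assumes "\<And>p. klin (f p)" "a \<in> G d"
  shows "ev2 (\<lambda>p x q y. scale (\<epsilon> y) (f p x)) (\<Delta> a) = f d a"
proof -
  let ?f = "\<lambda>p xs. f (p ! 0) (xs ! 0)"
  have ml: "multilinear 1 ?f"
    by (rule multilinear_1[OF assms(1)])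
  have "ev2 (\<lambda>p x q y. scale (\<epsilon> y) (f p x)) (\<Delta> a) = ev 1 ?f (apply_form_at 1 \<epsilon> (\<Delta> a))"
    unfolding ev2_def using ev_apply_form_at[of "\<Delta> a" 1 1 \<epsilon> ?f] \<Delta>_tens \<epsilon>_add
    by (auto simp: numeral_2_eq_2 fun2_def length_Suc_conv intro!: ev_cong dest!: homog_length)
  also have "\<dots> = ev 1 ?f (pure_tens [a])"
    by (rule ev_tens_eq[OF counit_right ml])
  also have "\<dots> = f d a"
    using ev_pure_homog[OF ml, of "[d]" "[a]"] assms(2) by simp
  finally show ?thesis .
qed

lemma counit_\<Phi>_ev:
  assumes "ml2 f"
  shows "ev3 (\<lambda>p x q y r z. scale (\<epsilon> y) (f p x r z)) \<Phi> = f 0 1 0 1"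
proof -
  have "ev3 (\<lambda>p x q y r z. scale (\<epsilon> y) (f p x r z)) \<Phi> = ev2 f (apply_form_at 1 \<epsilon> \<Phi>)"
    unfolding ev2_def ev3_def using ev_apply_form_at[of \<Phi> 2 1 \<epsilon> "fun2 f"] \<Phi>_tens \<epsilon>_add
    by (auto intro!: ev_cong dest!: homog_3)
  also have "\<dots> = f 0 1 0 1"
    using ev2_same[OF tens_eq_same_ev[OF counit_\<Phi>] assms] ev2_tone[OF assms] by simp
  finally show ?thesis .
qed

lemma ev3_counit:
  assumes "t \<in> tens 4"
  shows "ev3 f (apply_form_at 1 \<epsilon> t) = ev4 (\<lambda>p x q y r z s w. scale (\<epsilon> y) (f p x r z s w)) t"
    and "ev3 f (apply_form_at 2 \<epsilon> t) = ev4 (\<lambda>p x q y r z s w. scale (\<epsilon> z) (f p x q y s w)) t"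
  unfolding ev3_def ev4_def
  using ev_apply_form_at[of t 3 1 \<epsilon> "fun3 f"] ev_apply_form_at[of t 3 2 \<epsilon> "fun3 f"] assms \<epsilon>_add
  by (auto intro!: ev_cong dest!: homog_4)

section \<open>Parity of the structure elements\<close>

lemma \<epsilon>_prod_odd:
  assumes "homog p xs" "sum_list p = 1"
  shows "prod_list (map \<epsilon> xs) = 0"
  using assms
proof (induction p arbitrary: xs)
  case (Cons c p)
  obtain y ys where [simp]: "xs = y # ys"
    using Cons.prems(1) by (cases xs) (auto simp: homog_def)
  show ?case
    using Cons \<epsilon>_odd[of y c] by (cases "c = 0") auto
qed simp

lemma \<epsilon>_prod_mult: "length xs = length ys \<Longrightarrow>
    prod_list (map \<epsilon> (map2 (*) xs ys)) = prod_list (map \<epsilon> xs) * prod_list (map \<epsilon> ys)"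
  by (induction xs ys rule: list_induct2) (auto simp: \<epsilon>_mult)

text \<open>The map \<open>\<epsilon> \<otimes> \<dots> \<otimes> \<epsilon>\<close> is multiplicative, because \<open>\<epsilon>\<close> kills every word for which a sign occurs.
  So its value at an invertible tensor is not \<open>0\<close>, whereas it vanishes in odd degree.\<close>

lemma of_degree_invertible:
  assumes s: "s \<in> homogeneous_tens n d" and t: "t \<in> tens n" and inv: "s \<odot> t \<approx> tone n"
  shows "of_degree n 0 s"
proof -
  define f :: "bit list \<Rightarrow> 'a list \<Rightarrow> 'a" where "f = (\<lambda>p xs. scale (prod_list (map \<epsilon> xs)) 1)"
  have f: "multilinear n f"
    unfolding multilinear_def f_def
    by (auto simp: klin_def upd_conv_take_nth_drop \<epsilon>_add \<epsilon>_scale algebra_simps)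
  have "d = 0"
  proof (rule ccontr)
    assume "d \<noteq> 0"
    then have d: "d = 1"
      by (cases d) auto
    have "(1 :: 'a) = ev n f (s \<odot> t)"
      using ev_tens_eq[OF inv f] ev_tone[OF f] by (simp add: f_def map_replicate_const \<epsilon>_one prod_list_replicate)
    also have "\<dots> = ev n (\<lambda>p xs. ev n (\<mu> f p xs) t) s"
      using f homogeneous_tens_tens[OF s] t by (rule ev_tmult)
    also have "\<dots> = ev n (\<lambda>p xs. 0) s"
    proof -
      have "ev n (\<mu> f p xs) t = 0" if "length p = n" "homog p xs" "sum_list p = d" for p xs
      proof -
        have "ev n (\<mu> f p xs) t = ev n (\<lambda>q ys. 0) t"
          using that d \<epsilon>_prod_odd[of p xs]
          by (intro ev_cong) (auto simp: f_def \<epsilon>_prod_mult simp del: map_map dest!: homog_length)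
        then show ?thesis
          by (simp add: ev_zero)
      qed
      moreover have "multilinear n (\<lambda>p xs. 0)"
        by (simp add: multilinear_def klin_def)
      ultimately show ?thesis
        using homogeneous_tens_of_degree[OF s] multilinear_mult_left[OF f] unfolding of_degree_def by blast
    qed
    finally show False
      by (simp add: ev_zero)
  qed
  then show ?thesis
    using homogeneous_tens_of_degree[OF s] by simp
qed

lemma \<Phi>_even: "of_degree 3 0 \<Phi>"
  using \<Phi>_homogeneous of_degree_invertible[OF _ \<Phi>inv_tens \<Phi>_right_inv] by blast

text \<open>Applying \<open>\<epsilon>\<close> to \<open>\<Sum> S(X) \<alpha> Y \<beta> S(Z) = 1\<close> shows that \<open>\<epsilon> \<alpha>\<close> and \<open>\<epsilon> \<beta>\<close> are not \<open>0\<close>.\<close>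

lemma \<alpha>_even: "\<alpha> \<in> G 0"
  and \<beta>_even: "\<beta> \<in> G 0"
proof -
  have "1 = \<epsilon> (lin_ext scale (\<lambda>xs. S (xs ! 0) * \<alpha> * xs ! 1 * \<beta> * S (xs ! 2)) \<Phi>)"
    using antipode_\<Phi> \<epsilon>_one by simp
  also have "\<dots> = (\<Sum>w\<in>Poly_Mapping.keys \<Phi>. \<epsilon> (scale (Poly_Mapping.lookup \<Phi> w)
      (S (w ! 0) * \<alpha> * w ! 1 * \<beta> * S (w ! 2))))"
    unfolding lin_ext_def by (rule \<epsilon>_sum)
  finally have "\<epsilon> \<alpha> \<noteq> 0" "\<epsilon> \<beta> \<noteq> 0"
    by (auto simp: \<epsilon>_scale \<epsilon>_mult)
  then show "\<alpha> \<in> G 0" "\<beta> \<in> G 0"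
    using \<alpha>_homogeneous \<beta>_homogeneous \<epsilon>_odd unfolding homogeneous_def by metis+
qed

lemma inv_S_grading:
  assumes "a \<in> G d"
  shows "inv S a \<in> G d"
proof -
  define b where "b = inv S a - hpart d (inv S a)"
  have "b \<in> G (d + 1)"
    unfolding b_def by (rule diff_hpart_in_G)
  have "S (hpart d (inv S a)) + S b = a"
    unfolding S_add[symmetric] b_def by simp
  then have "S b = a - S (hpart d (inv S a))"
    by (simp add: algebra_simps)
  then have "S b \<in> G d"
    using assms by (simp add: G_diff S_grading)
  then have "S b = 0"
    using G_independent S_grading[OF \<open>b \<in> G (d + 1)\<close>] by blast
  then have "b = 0"
    by (metis S_inv(2) S_zero)
  then show ?thesis
    unfolding b_def by (metis eq_iff_diff_eq_0 hpart_in_G)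
qed

lemma inv_S_antimult:
  assumes "a \<in> G c" "b \<in> G d"
  shows "inv S (a * b) = scale (ksign (c * d)) (inv S b * inv S a)"
proof -
  have "S (scale (ksign (c * d)) (inv S b * inv S a)) = a * b"
    using S_antimult[OF inv_S_grading[OF assms(2)] inv_S_grading[OF assms(1)]]
    by (simp add: S_scale mult.commute flip: ksign_add)
  then show ?thesis
    by (metis S_inv(2))
qed

text \<open>The rules below contain the position \<open>1\<close>, which would not match \<open>Suc 0\<close>.\<close>

declare One_nat_def [simp del]

section \<open>Counits of the associator\<close>

text \<open>The axioms only contain \<open>(1 \<otimes> \<epsilon> \<otimes> 1)\<Phi> = 1\<close>. A counit applied to the second factor of the pentagon
  turns it into \<open>\<Phi> = \<Phi> \<cdot> (1 \<otimes> (\<epsilon> \<otimes> 1 \<otimes> 1)\<Phi>)\<close>, and applied to the third factor into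
  \<open>\<Phi> = ((1 \<otimes> 1 \<otimes> \<epsilon>)\<Phi> \<otimes> 1) \<cdot> \<Phi>\<close>; cancelling \<open>\<Phi>\<close> gives the other two counit identities.\<close>

lemma tens_\<Phi>_\<Delta> [simp]: "i < 3 \<Longrightarrow> apply_at i \<Delta> \<Phi> \<in> tens 4"
  using tens_\<Delta>_at[OF \<Phi>_tens] by simp

lemma tens_insert_\<Phi> [simp]: "insert_one i \<Phi> \<in> tens 4" "insert_one i \<Phi>inv \<in> tens 4"
  using tens_insert_one[OF \<Phi>_tens] tens_insert_one[OF \<Phi>inv_tens] by simp_all

lemma tens_counit [simp]: "t \<in> tens 4 \<Longrightarrow> i \<le> 3 \<Longrightarrow> apply_form_at i \<epsilon> t \<in> tens 3"
  using tens_apply_form_at[of t 3 i] by simp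

lemma ml3_counit:
  assumes "ml3 f"
  shows "ml4 (\<lambda>p x q y r z s w. scale (\<epsilon> y) (f p x r z s w))"
    and "ml4 (\<lambda>p x q y r z s w. scale (\<epsilon> z) (f p x q y s w))"
  by (intro ml_intros ml3_klin[OF assms])+

lemma same_ev_counit:
  assumes "same_ev 4 s t" "s \<in> tens 4" "t \<in> tens 4"
  shows "same_ev 3 (apply_form_at 1 \<epsilon> s) (apply_form_at 1 \<epsilon> t)"
    and "same_ev 3 (apply_form_at 2 \<epsilon> s) (apply_form_at 2 \<epsilon> t)"
  by (rule same_ev_3I, unfold ev3_counit[OF assms(2)] ev3_counit[OF assms(3)],
      rule ev4_same[OF assms(1)], erule ml3_counit)+

text \<open>The signs agree because \<open>\<epsilon>\<close> vanishes unless the letters in its slot are even.\<close>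

lemma counit_tmult:
  assumes s: "s \<in> tens 4" and t: "t \<in> tens 4"
  shows "same_ev 3 (apply_form_at 1 \<epsilon> (s \<odot> t)) (apply_form_at 1 \<epsilon> s \<odot> apply_form_at 1 \<epsilon> t)"
    and "same_ev 3 (apply_form_at 2 \<epsilon> (s \<odot> t)) (apply_form_at 2 \<epsilon> s \<odot> apply_form_at 2 \<epsilon> t)"
proof -
  have c: "apply_form_at 1 \<epsilon> s \<in> tens 3" "apply_form_at 1 \<epsilon> t \<in> tens 3"
    "apply_form_at 2 \<epsilon> s \<in> tens 3" "apply_form_at 2 \<epsilon> t \<in> tens 3"
    using s t by simp_all
  show "same_ev 3 (apply_form_at 1 \<epsilon> (s \<odot> t)) (apply_form_at 1 \<epsilon> s \<odot> apply_form_at 1 \<epsilon> t)"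
  proof (rule same_ev_3I)
    fix f assume f: "ml3 f"
    show "ev3 f (apply_form_at 1 \<epsilon> (s \<odot> t)) = ev3 f (apply_form_at 1 \<epsilon> s \<odot> apply_form_at 1 \<epsilon> t)"
      unfolding ev3_counit(1)[OF tens_tmult[OF s t]] ev4_tmult[OF ml3_counit(1)[OF f] s t]
        ev3_tmult[OF f c(1,2)]
        ev3_counit(1)[OF s] ev3_counit(1)[OF t] klin_ev4[OF klin_scale[OF klin_id], symmetric]
    proof (intro ev4_cong)
      fix p q r v p' q' r' v' :: bit and x y z w x' y' z' w'
      assume "y \<in> G q" "y' \<in> G q'"
      then have "\<epsilon> (y * y') = 0 \<or> q = 0 \<and> q' = 0"
        using \<epsilon>_odd \<epsilon>_mult by (metis mult_eq_0_iff)
      then show "scale (ksign (q * p' + r * (p' + q') + v * (p' + q' + r')))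
          (scale (\<epsilon> (y * y')) (f (p + p') (x * x') (r + r') (z * z') (v + v') (w * w')))
        = scale (\<epsilon> y) (scale (\<epsilon> y') (scale (ksign (r * p' + v * (p' + r')))
          (f (p + p') (x * x') (r + r') (z * z') (v + v') (w * w'))))"
        by (auto simp: \<epsilon>_mult mult_ac)
    qed
  qed
  show "same_ev 3 (apply_form_at 2 \<epsilon> (s \<odot> t)) (apply_form_at 2 \<epsilon> s \<odot> apply_form_at 2 \<epsilon> t)"
  proof (rule same_ev_3I)
    fix f assume f: "ml3 f"
    show "ev3 f (apply_form_at 2 \<epsilon> (s \<odot> t)) = ev3 f (apply_form_at 2 \<epsilon> s \<odot> apply_form_at 2 \<epsilon> t)"
      unfolding ev3_counit(2)[OF tens_tmult[OF s t]] ev4_tmult[OF ml3_counit(2)[OF f] s t]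
        ev3_tmult[OF f c(3,4)]
        ev3_counit(2)[OF s] ev3_counit(2)[OF t] klin_ev4[OF klin_scale[OF klin_id], symmetric]
    proof (intro ev4_cong)
      fix p q r v p' q' r' v' :: bit and x y z w x' y' z' w'
      assume "z \<in> G r" "z' \<in> G r'"
      then have "\<epsilon> (z * z') = 0 \<or> r = 0 \<and> r' = 0"
        using \<epsilon>_odd \<epsilon>_mult by (metis mult_eq_0_iff)
      then show "scale (ksign (q * p' + r * (p' + q') + v * (p' + q' + r')))
          (scale (\<epsilon> (z * z')) (f (p + p') (x * x') (q + q') (y * y') (v + v') (w * w')))
        = scale (\<epsilon> z) (scale (\<epsilon> z') (scale (ksign (q * p' + v * (p' + q')))
          (f (p + p') (x * x') (q + q') (y * y') (v + v') (w * w'))))"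
        by (auto simp: \<epsilon>_mult mult_ac)
    qed
  qed
qed

lemma counit_\<Delta>:
  shows "same_ev 3 (apply_form_at 1 \<epsilon> (apply_at 0 \<Delta> \<Phi>)) \<Phi>"
    and "same_ev 3 (apply_form_at 1 \<epsilon> (apply_at 1 \<Delta> \<Phi>)) \<Phi>"
    and "same_ev 3 (apply_form_at 1 \<epsilon> (apply_at 2 \<Delta> \<Phi>)) (tone 3)"
    and "same_ev 3 (apply_form_at 2 \<epsilon> (apply_at 0 \<Delta> \<Phi>)) (tone 3)"
    and "same_ev 3 (apply_form_at 2 \<epsilon> (apply_at 1 \<Delta> \<Phi>)) \<Phi>"
    and "same_ev 3 (apply_form_at 2 \<epsilon> (apply_at 2 \<Delta> \<Phi>)) \<Phi>"
proof -
  have 0: "apply_at i \<Delta> \<Phi> \<in> tens 4" if "i < 3" for i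
    using that by simp
  note \<Delta>s = ev4_\<Delta>_0[OF _ \<Phi>_tens] ev4_\<Delta>_1[OF _ \<Phi>_tens] ev4_\<Delta>_2[OF _ \<Phi>_tens]
  show "same_ev 3 (apply_form_at 1 \<epsilon> (apply_at 0 \<Delta> \<Phi>)) \<Phi>"
  proof (rule same_ev_3I)
    fix f assume f: "ml3 f"
    have "ev3 f (apply_form_at 1 \<epsilon> (apply_at 0 \<Delta> \<Phi>)) = ev3 (\<lambda>p x q y r z.
        ev2 (\<lambda>p\<^sub>1 x\<^sub>1 p\<^sub>2 x\<^sub>2. scale (\<epsilon> x\<^sub>2) (f p\<^sub>1 x\<^sub>1 q y r z)) (\<Delta> x)) \<Phi>"
      by (simp add: ev3_counit \<Delta>s ml3_counit[OF f])
    also have "\<dots> = ev3 f \<Phi>"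
      by (intro ev3_cong counit_right_ev ml3_klin[OF f] klin_id)
    finally show "ev3 f (apply_form_at 1 \<epsilon> (apply_at 0 \<Delta> \<Phi>)) = ev3 f \<Phi>" .
  qed
  show "same_ev 3 (apply_form_at 1 \<epsilon> (apply_at 1 \<Delta> \<Phi>)) \<Phi>"
  proof (rule same_ev_3I)
    fix f assume f: "ml3 f"
    have "ev3 f (apply_form_at 1 \<epsilon> (apply_at 1 \<Delta> \<Phi>)) = ev3 (\<lambda>p x q y r z.
        ev2 (\<lambda>q\<^sub>1 y\<^sub>1 q\<^sub>2 y\<^sub>2. scale (\<epsilon> y\<^sub>1) (f p x q\<^sub>2 y\<^sub>2 r z)) (\<Delta> y)) \<Phi>"
      by (simp add: ev3_counit \<Delta>s ml3_counit[OF f])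
    also have "\<dots> = ev3 f \<Phi>"
      by (intro ev3_cong counit_left_ev ml3_klin[OF f] klin_id)
    finally show "ev3 f (apply_form_at 1 \<epsilon> (apply_at 1 \<Delta> \<Phi>)) = ev3 f \<Phi>" .
  qed
  show "same_ev 3 (apply_form_at 2 \<epsilon> (apply_at 1 \<Delta> \<Phi>)) \<Phi>"
  proof (rule same_ev_3I)
    fix f assume f: "ml3 f"
    have "ev3 f (apply_form_at 2 \<epsilon> (apply_at 1 \<Delta> \<Phi>)) = ev3 (\<lambda>p x q y r z.
        ev2 (\<lambda>q\<^sub>1 y\<^sub>1 q\<^sub>2 y\<^sub>2. scale (\<epsilon> y\<^sub>2) (f p x q\<^sub>1 y\<^sub>1 r z)) (\<Delta> y)) \<Phi>"
      by (simp add: ev3_counit \<Delta>s ml3_counit[OF f])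
    also have "\<dots> = ev3 f \<Phi>"
      by (intro ev3_cong counit_right_ev ml3_klin[OF f] klin_id)
    finally show "ev3 f (apply_form_at 2 \<epsilon> (apply_at 1 \<Delta> \<Phi>)) = ev3 f \<Phi>" .
  qed
  show "same_ev 3 (apply_form_at 2 \<epsilon> (apply_at 2 \<Delta> \<Phi>)) \<Phi>"
  proof (rule same_ev_3I)
    fix f assume f: "ml3 f"
    have "ev3 f (apply_form_at 2 \<epsilon> (apply_at 2 \<Delta> \<Phi>)) = ev3 (\<lambda>p x q y r z.
        ev2 (\<lambda>r\<^sub>1 z\<^sub>1 r\<^sub>2 z\<^sub>2. scale (\<epsilon> z\<^sub>1) (f p x q y r\<^sub>2 z\<^sub>2)) (\<Delta> z)) \<Phi>"
      by (simp add: ev3_counit \<Delta>s ml3_counit[OF f])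
    also have "\<dots> = ev3 f \<Phi>"
      by (intro ev3_cong counit_left_ev ml3_klin[OF f] klin_id)
    finally show "ev3 f (apply_form_at 2 \<epsilon> (apply_at 2 \<Delta> \<Phi>)) = ev3 f \<Phi>" .
  qed
  show "same_ev 3 (apply_form_at 1 \<epsilon> (apply_at 2 \<Delta> \<Phi>)) (tone 3)"
  proof (rule same_ev_3I)
    fix f assume f: "ml3 f"
    have f': "ml2 (\<lambda>r\<^sub>1 z\<^sub>1 r\<^sub>2 z\<^sub>2. f p x r\<^sub>1 z\<^sub>1 r\<^sub>2 z\<^sub>2)" for p x
      by (intro ml_intros ml3_klin[OF f])
    have g: "ml2 (\<lambda>p x r z. ev2 (\<lambda>r\<^sub>1 z\<^sub>1 r\<^sub>2 z\<^sub>2. f p x r\<^sub>1 z\<^sub>1 r\<^sub>2 z\<^sub>2) (\<Delta> z))"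
      by (intro ml_intros ml3_klin[OF f])
    show "ev3 f (apply_form_at 1 \<epsilon> (apply_at 2 \<Delta> \<Phi>)) = ev3 f (tone 3)"
      using counit_\<Phi>_ev[OF g] ev2_same[OF tens_eq_same_ev[OF \<Delta>_one] f'] ev2_tone[OF f'] ev3_tone[OF f]
      by (simp add: ev3_counit(1)[OF 0] \<Delta>s ml3_counit[OF f] klin_ev2[OF klin_scale[OF klin_id]])
  qed
  show "same_ev 3 (apply_form_at 2 \<epsilon> (apply_at 0 \<Delta> \<Phi>)) (tone 3)"
  proof (rule same_ev_3I)
    fix f assume f: "ml3 f"
    have f': "ml2 (\<lambda>r\<^sub>1 z\<^sub>1 r\<^sub>2 z\<^sub>2. f r\<^sub>1 z\<^sub>1 r\<^sub>2 z\<^sub>2 p x)" for p x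
      by (intro ml_intros ml3_klin[OF f])
    have g: "ml2 (\<lambda>r z p x. ev2 (\<lambda>r\<^sub>1 z\<^sub>1 r\<^sub>2 z\<^sub>2. f r\<^sub>1 z\<^sub>1 r\<^sub>2 z\<^sub>2 p x) (\<Delta> z))"
      by (intro ml_intros ml3_klin[OF f])
    show "ev3 f (apply_form_at 2 \<epsilon> (apply_at 0 \<Delta> \<Phi>)) = ev3 f (tone 3)"
      using counit_\<Phi>_ev[OF g] ev2_same[OF tens_eq_same_ev[OF \<Delta>_one] f'] ev2_tone[OF f'] ev3_tone[OF f]
      by (simp add: ev3_counit(2)[OF 0] \<Delta>s ml3_counit[OF f] klin_ev2[OF klin_scale[OF klin_id]])
  qed
qed

lemma counit_insert:
  shows "same_ev 3 (apply_form_at 1 \<epsilon> (insert_one 3 \<Phi>)) (tone 3)"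
    and "same_ev 3 (apply_form_at 2 \<epsilon> (insert_one 0 \<Phi>)) (tone 3)"
proof -
  show "same_ev 3 (apply_form_at 1 \<epsilon> (insert_one 3 \<Phi>)) (tone 3)"
  proof (rule same_ev_3I)
    fix f assume f: "ml3 f"
    have "ml2 (\<lambda>p x q y. f p x q y 0 1)"
      by (intro ml_intros ml3_klin[OF f])
    from counit_\<Phi>_ev[OF this] show "ev3 f (apply_form_at 1 \<epsilon> (insert_one 3 \<Phi>)) = ev3 f (tone 3)"
      by (simp add: ev3_counit(1) ev4_insert_last \<Phi>_tens ml3_counit[OF f] ev3_tone[OF f])
  qed
  show "same_ev 3 (apply_form_at 2 \<epsilon> (insert_one 0 \<Phi>)) (tone 3)"
  proof (rule same_ev_3I)
    fix f assume f: "ml3 f"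
    have "ml2 (\<lambda>p x q y. f 0 1 p x q y)"
      by (intro ml_intros ml3_klin[OF f])
    from counit_\<Phi>_ev[OF this] show "ev3 f (apply_form_at 2 \<epsilon> (insert_one 0 \<Phi>)) = ev3 f (tone 3)"
      by (simp add: ev3_counit(2) ev4_insert_first \<Phi>_tens ml3_counit[OF f] ev3_tone[OF f])
  qed
qed

lemmas pentagon_same_ev = tens_eq_same_ev[OF pentagon]

lemma counit_\<Phi>_first: "same_ev 3 (apply_form_at 1 \<epsilon> (insert_one 0 \<Phi>)) (tone 3)" (is "same_ev 3 ?W _")
proof -
  have "same_ev 3 (\<Phi> \<odot> tone 3) (apply_form_at 1 \<epsilon> (apply_at 0 \<Delta> \<Phi>) \<odot> apply_form_at 1 \<epsilon> (apply_at 2 \<Delta> \<Phi>))"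
    by (intro same_ev_tmult same_ev_sym[OF counit_\<Delta>(1)] same_ev_sym[OF counit_\<Delta>(3)]) (simp_all add: \<Phi>_tens)
  also have "same_ev 3 \<dots> (apply_form_at 1 \<epsilon> (apply_at 0 \<Delta> \<Phi> \<odot> apply_at 2 \<Delta> \<Phi>))"
    by (intro same_ev_sym[OF counit_tmult(1)]) simp_all
  also have "same_ev 3 \<dots> (apply_form_at 1 \<epsilon> (insert_one 3 \<Phi> \<odot> apply_at 1 \<Delta> \<Phi> \<odot> insert_one 0 \<Phi>))"
    using same_ev_counit(1)[OF pentagon_same_ev] by (simp add: tens_tmult)
  also have "same_ev 3 \<dots> (apply_form_at 1 \<epsilon> (insert_one 3 \<Phi> \<odot> apply_at 1 \<Delta> \<Phi>) \<odot> ?W)"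
    by (intro counit_tmult(1)) (simp_all add: tens_tmult)
  also have "same_ev 3 \<dots> (apply_form_at 1 \<epsilon> (insert_one 3 \<Phi>) \<odot> apply_form_at 1 \<epsilon> (apply_at 1 \<Delta> \<Phi>) \<odot> ?W)"
    by (intro same_ev_tmult counit_tmult(1) same_ev_refl) (simp_all add: tens_tmult)
  also have "same_ev 3 \<dots> (tone 3 \<odot> \<Phi> \<odot> ?W)"
    using counit_insert(1) counit_\<Delta>(2) by (intro same_ev_tmult same_ev_refl) (simp_all add: tens_tmult \<Phi>_tens)
  also have "same_ev 3 \<dots> (\<Phi> \<odot> ?W)"
    by (intro same_ev_tmult same_ev_tone_left same_ev_refl) (simp_all add: tens_tmult \<Phi>_tens)
  finally have "same_ev 3 (\<Phi> \<odot> ?W) \<Phi>"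
    using same_ev_tone_right[OF \<Phi>_tens] same_ev_sym same_ev_trans by blast
  from same_ev_cancel_left[OF tens_eq_same_ev[OF \<Phi>_left_inv] this] have "same_ev 3 ?W (\<Phi>inv \<odot> \<Phi>)"
    by (simp add: \<Phi>_tens \<Phi>inv_tens)
  then show ?thesis
    using tens_eq_same_ev[OF \<Phi>_left_inv] by (rule same_ev_trans)
qed

lemma counit_\<Phi>_last: "same_ev 3 (apply_form_at 2 \<epsilon> (insert_one 3 \<Phi>)) (tone 3)" (is "same_ev 3 ?W _")
proof -
  have "same_ev 3 \<Phi> (tone 3 \<odot> \<Phi>)"
    by (rule same_ev_sym[OF same_ev_tone_left[OF \<Phi>_tens]])
  also have "same_ev 3 \<dots> (apply_form_at 2 \<epsilon> (apply_at 0 \<Delta> \<Phi>) \<odot> apply_form_at 2 \<epsilon> (apply_at 2 \<Delta> \<Phi>))"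
    by (intro same_ev_tmult same_ev_sym[OF counit_\<Delta>(4)] same_ev_sym[OF counit_\<Delta>(6)]) (simp_all add: \<Phi>_tens)
  also have "same_ev 3 \<dots> (apply_form_at 2 \<epsilon> (apply_at 0 \<Delta> \<Phi> \<odot> apply_at 2 \<Delta> \<Phi>))"
    by (intro same_ev_sym[OF counit_tmult(2)]) simp_all
  also have "same_ev 3 \<dots> (apply_form_at 2 \<epsilon> (insert_one 3 \<Phi> \<odot> apply_at 1 \<Delta> \<Phi> \<odot> insert_one 0 \<Phi>))"
    using same_ev_counit(2)[OF pentagon_same_ev] by (simp add: tens_tmult)
  also have "same_ev 3 \<dots> (apply_form_at 2 \<epsilon> (insert_one 3 \<Phi> \<odot> apply_at 1 \<Delta> \<Phi>) \<odot> apply_form_at 2 \<epsilon> (insert_one 0 \<Phi>))"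
    by (intro counit_tmult(2)) (simp_all add: tens_tmult)
  also have "same_ev 3 \<dots> (?W \<odot> apply_form_at 2 \<epsilon> (apply_at 1 \<Delta> \<Phi>) \<odot> apply_form_at 2 \<epsilon> (insert_one 0 \<Phi>))"
    by (intro same_ev_tmult counit_tmult(2) same_ev_refl) (simp_all add: tens_tmult)
  also have "same_ev 3 \<dots> (?W \<odot> \<Phi> \<odot> tone 3)"
    using counit_insert(2) counit_\<Delta>(5) by (intro same_ev_tmult same_ev_refl) (simp_all add: tens_tmult \<Phi>_tens)
  also have "same_ev 3 \<dots> (?W \<odot> \<Phi>)"
    by (intro same_ev_tone_right) (simp add: tens_tmult \<Phi>_tens)
  finally have "same_ev 3 (?W \<odot> \<Phi>) \<Phi>"
    by (rule same_ev_sym)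
  from same_ev_cancel_right[OF tens_eq_same_ev[OF \<Phi>_right_inv] this] have "same_ev 3 ?W (\<Phi> \<odot> \<Phi>inv)"
    by (simp add: \<Phi>_tens \<Phi>inv_tens)
  then show ?thesis
    using tens_eq_same_ev[OF \<Phi>_right_inv] by (rule same_ev_trans)
qed

lemma counit_\<Phi>_first_ev:
  assumes f: "ml2 f"
  shows "ev3 (\<lambda>p x q y r z. scale (\<epsilon> x) (f q y r z)) \<Phi> = f 0 1 0 1"
proof -
  have g: "ml3 (\<lambda>p x q y r z. scale (\<epsilon> x) (f q y r z))"
    by (intro ml_intros ml2_klin[OF f])
  show ?thesis
    using ev3_same[OF counit_\<Phi>_first g]
    by (simp add: ev3_counit(1) ev4_insert_first \<Phi>_tens ml3_counit[OF g] ev3_tone[OF g] \<epsilon>_one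
        del: scale_scale)
qed

lemma counit_\<Phi>_last_ev:
  assumes f: "ml2 f"
  shows "ev3 (\<lambda>p x q y r z. scale (\<epsilon> z) (f p x q y)) \<Phi> = f 0 1 0 1"
proof -
  have g: "ml3 (\<lambda>p x q y r z. scale (\<epsilon> z) (f p x q y))"
    by (intro ml_intros ml2_klin[OF f])
  show ?thesis
    using ev3_same[OF counit_\<Phi>_last g]
    by (simp add: ev3_counit(2) ev4_insert_last \<Phi>_tens ml3_counit[OF g] ev3_tone[OF g] \<epsilon>_one
        del: scale_scale)
qed

section \<open>Quasi-coassociativity and the pentagon in cancelled form\<close>

lemma quasi_coassoc_conj:
  "same_ev 3 (\<Phi> \<odot> apply_at 1 \<Delta> (\<Delta> a)) (apply_at 0 \<Delta> (\<Delta> a) \<odot> \<Phi>)"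
proof -
  let ?l = "apply_at 0 \<Delta> (\<Delta> a)" and ?r = "apply_at 1 \<Delta> (\<Delta> a)"
  have [simp]: "?l \<in> tens 3" "?r \<in> tens 3"
    using tens_\<Delta>_at[OF \<Delta>_tens, of 0] tens_\<Delta>_at[OF \<Delta>_tens, of 1] by simp_all
  note [simp] = \<Phi>_tens \<Phi>inv_tens
  have "same_ev 3 (\<Phi> \<odot> ?r) (\<Phi> \<odot> (\<Phi>inv \<odot> ?l \<odot> \<Phi>))"
    by (intro same_ev_tmult same_ev_refl tens_eq_same_ev[OF quasi_coassoc]) (simp_all add: tens_tmult)
  also have "same_ev 3 \<dots> (\<Phi> \<odot> (\<Phi>inv \<odot> (?l \<odot> \<Phi>)))"
    by (intro same_ev_tmult same_ev_refl same_ev_tmult_assoc) (simp_all add: tens_tmult)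
  also have "same_ev 3 \<dots> (\<Phi> \<odot> \<Phi>inv \<odot> (?l \<odot> \<Phi>))"
    by (intro same_ev_sym[OF same_ev_tmult_assoc]) (simp_all add: tens_tmult)
  also have "same_ev 3 \<dots> (tone 3 \<odot> (?l \<odot> \<Phi>))"
    by (intro same_ev_tmult same_ev_refl tens_eq_same_ev[OF \<Phi>_right_inv]) (simp_all add: tens_tmult)
  also have "same_ev 3 \<dots> (?l \<odot> \<Phi>)"
    by (intro same_ev_tone_left) (simp add: tens_tmult)
  finally show ?thesis .
qed

text \<open>The pentagon with the factor \<open>1 \<otimes> \<Phi>\<close> moved to the other side.\<close>

lemma pentagon_cancelled:
  "same_ev 4 (apply_at 0 \<Delta> \<Phi> \<odot> (apply_at 2 \<Delta> \<Phi> \<odot> insert_one 0 \<Phi>inv)) (insert_one 3 \<Phi> \<odot> apply_at 1 \<Delta> \<Phi>)"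
proof -
  have inv: "same_ev 4 (insert_one 0 \<Phi> \<odot> insert_one 0 \<Phi>inv) (tone 4)"
  proof (rule same_ev_4I)
    fix f assume f: "ml4 f"
    have g: "ml3 (f 0 1)"
      using f by (simp add: ml4_def ml3_def)
    have "ev4 f (insert_one 0 \<Phi> \<odot> insert_one 0 \<Phi>inv) =
      ev4 (\<lambda>p x q y r z v w. ev4 (\<lambda>p' x' q' y' r' z' v' w'.
        scale (ksign (q * p' + r * (p' + q') + v * (p' + q' + r')))
          (f (p + p') (x * x') (q + q') (y * y') (r + r') (z * z') (v + v') (w * w')))
        (insert_one 0 \<Phi>inv)) (insert_one 0 \<Phi>)"
      by (intro ev4_tmult f) simp_all
    also have "\<dots> = ev3 (\<lambda>q y r z v w. ev4 (\<lambda>p' x' q' y' r' z' v' w'.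
        scale (ksign (q * p' + r * (p' + q') + v * (p' + q' + r')))
          (f (0 + p') (1 * x') (q + q') (y * y') (r + r') (z * z') (v + v') (w * w')))
        (insert_one 0 \<Phi>inv)) \<Phi>"
      by (intro ev4_insert_first \<Phi>_tens ml_intros ml4_klin[OF f])
    also have "\<dots> = ev3 (\<lambda>q y r z v w. ev3 (\<lambda>q' y' r' z' v' w'.
        scale (ksign (q * 0 + r * (0 + q') + v * (0 + q' + r')))
          (f (0 + 0) (1 * 1) (q + q') (y * y') (r + r') (z * z') (v + v') (w * w'))) \<Phi>inv) \<Phi>"
      by (intro ev3_cong ev4_insert_first \<Phi>inv_tens ml_intros ml4_klin[OF f])
    also have "\<dots> = ev3 (f 0 1) (\<Phi> \<odot> \<Phi>inv)"
      unfolding ev3_tmult[OF g \<Phi>_tens \<Phi>inv_tens] by simp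
    also have "\<dots> = ev4 f (tone 4)"
      using ev3_same[OF tens_eq_same_ev[OF \<Phi>_right_inv] g] by (simp add: ev3_tone[OF g] ev4_tone[OF f])
    finally show "ev4 f (insert_one 0 \<Phi> \<odot> insert_one 0 \<Phi>inv) = ev4 f (tone 4)" .
  qed
  have "same_ev 4 (apply_at 0 \<Delta> \<Phi> \<odot> apply_at 2 \<Delta> \<Phi> \<odot> insert_one 0 \<Phi>inv)
      (apply_at 0 \<Delta> \<Phi> \<odot> (apply_at 2 \<Delta> \<Phi> \<odot> insert_one 0 \<Phi>inv))"
    by (intro same_ev_tmult_assoc) simp_all
  moreover have "same_ev 4 (insert_one 3 \<Phi> \<odot> apply_at 1 \<Delta> \<Phi>)
      (apply_at 0 \<Delta> \<Phi> \<odot> apply_at 2 \<Delta> \<Phi> \<odot> insert_one 0 \<Phi>inv)"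
    by (intro same_ev_cancel_right[OF inv same_ev_sym[OF pentagon_same_ev]]) (simp_all add: tens_tmult)
  ultimately show ?thesis
    using same_ev_sym same_ev_trans by blast
qed

section \<open>Pairings and double duals\<close>

text \<open>Invariant pairings between a module \<open>V\<close> and its dual \<open>V\<^sup>*\<close>, on which \<open>A\<close> acts through \<open>S\<close>: a
  twisted pairing \<open>\<theta>\<close> defines the \<open>A\<close>-invariant form \<open>v \<otimes> \<xi> \<mapsto> \<xi>(\<theta>v)\<close> on \<open>V \<otimes> V\<^sup>*\<close>, in the order
  opposite to that of the form \<open>\<xi> \<otimes> v \<mapsto> \<xi>(\<alpha>v)\<close> on \<open>V\<^sup>* \<otimes> V\<close>, up to signs. A predual pairing \<open>\<eta>\<close>
  defines an invariant form \<open>\<xi> \<otimes> v \<mapsto> \<xi>(\<eta>v)\<close> for the dual on which \<open>A\<close> acts through \<open>S\<^sup>-\<^sup>1\<close>.\<close>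

definition twisted_pairing :: "'a \<Rightarrow> bool" where
  "twisted_pairing \<theta> \<longleftrightarrow> (\<forall>d. \<forall>a\<in>G d.
     ev2 (\<lambda>p x q y. scale (ksign (p * q)) (S y * \<theta> * x)) (\<Delta> a) = scale (\<epsilon> a) \<theta>)"

definition predual_pairing :: "'a \<Rightarrow> bool" where
  "predual_pairing \<eta> \<longleftrightarrow> (\<forall>d. \<forall>a\<in>G d.
     ev2 (\<lambda>p x q y. inv S x * \<eta> * y) (\<Delta> a) = scale (\<epsilon> a) \<eta>)"

text \<open>The composite \<open>V \<rightarrow> V \<otimes> (V\<^sup>* \<otimes> V\<^sup>*\<^sup>*) \<rightarrow> (V \<otimes> V\<^sup>*) \<otimes> V\<^sup>*\<^sup>* \<rightarrow> V\<^sup>*\<^sup>*\<close> of a coevaluation, the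
  associator and the pairing \<open>\<theta>\<close>. For the pairing given by the braiding this is \<open>u\<close>.\<close>

definition to_double_dual :: "'a \<Rightarrow> 'a" where
  "to_double_dual \<theta> = ev3 (\<lambda>p x q y r z. scale (ksign (p * (q + r))) (S (y * \<beta> * S z) * \<theta> * x)) \<Phi>"

definition from_double_dual :: "'a \<Rightarrow> 'a" where
  "from_double_dual \<eta> = ev3 (\<lambda>p x q y r z. inv S x * \<eta> * (y * \<beta> * S z)) \<Phi>"

lemma twisted_pairing_ev:
  assumes "twisted_pairing \<theta>" "klin h" "a \<in> G d"
  shows "ev2 (\<lambda>p x q y. h (scale (ksign (p * q)) (S y * \<theta> * x))) (\<Delta> a) = scale (\<epsilon> a) (h \<theta>)"
proof -
  have "ev2 (\<lambda>p x q y. scale (ksign (p * q)) (S y * \<theta> * x)) (\<Delta> a) = scale (\<epsilon> a) \<theta>"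
    using assms(1,3) by (auto simp: twisted_pairing_def)
  then show ?thesis
    by (simp only: klin_ev2[OF assms(2)]) (rule klin_scale_arg[OF assms(2)])
qed

lemma predual_pairing_ev:
  assumes "predual_pairing \<eta>" "klin h" "a \<in> G d"
  shows "ev2 (\<lambda>p x q y. h (inv S x * \<eta> * y)) (\<Delta> a) = scale (\<epsilon> a) (h \<eta>)"
proof -
  have "ev2 (\<lambda>p x q y. inv S x * \<eta> * y) (\<Delta> a) = scale (\<epsilon> a) \<eta>"
    using assms(1,3) by (auto simp: predual_pairing_def)
  then show ?thesis
    by (simp only: klin_ev2[OF assms(2)]) (rule klin_scale_arg[OF assms(2)])
qed

text \<open>Both sides arise by contracting \<open>\<Phi> \<cdot> (1 \<otimes> \<Delta>)\<Delta>(a) = (\<Delta> \<otimes> 1)\<Delta>(a) \<cdot> \<Phi>\<close> with the functional that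
  takes \<open>\<Phi>\<close> to \<open>to_double_dual \<theta>\<close>. On the left the axiom for \<open>\<beta>\<close> absorbs the last two factors of
  the iterated coproduct, on the right the invariance of \<open>\<theta>\<close> absorbs the first two. The sign left
  over after an absorption is \<open>1\<close>, because the counit vanishes on odd elements.\<close>

lemma to_double_dual_commute:
  assumes \<theta>: "twisted_pairing \<theta>" and a: "a \<in> G d"
  shows "to_double_dual \<theta> * a = S (S a) * to_double_dual \<theta>" (is "?U * a = _")
proof -
  define F where "F = (\<lambda>p x q y r z. scale (ksign (p * (q + r))) (S (y * \<beta> * S z) * \<theta> * x))"
  have F: "ml3 F"
    unfolding F_def by (intro ml_intros)
  have "ev3 F (\<Phi> \<odot> apply_at 1 \<Delta> (\<Delta> a)) = ev3 (\<lambda>p x q y r z. ev3 (\<lambda>p' x' q' y' r' z'.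
      scale (ksign (q * p' + r * (p' + q'))) (F (p + p') (x * x') (q + q') (y * y') (r + r') (z * z')))
      (apply_at 1 \<Delta> (\<Delta> a))) \<Phi>"
    by (intro ev3_tmult F \<Phi>_tens tens_\<Delta>_at[of _ 2, simplified] \<Delta>_tens) simp
  also have "\<dots> = ev3 (\<lambda>p x q y r z. F p x q y r z * a) \<Phi>"
  proof (rule ev3_cong)
    fix p q r x y z assume h: "x \<in> G p" "y \<in> G q" "z \<in> G r"
    have "ev3 (\<lambda>p' x' q' y' r' z'.
      scale (ksign (q * p' + r * (p' + q'))) (F (p + p') (x * x') (q + q') (y * y') (r + r') (z * z')))
      (apply_at 1 \<Delta> (\<Delta> a))
    = ev2 (\<lambda>p' a1 q' a2. ev2 (\<lambda>q1 b1 q2 b2. 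
         scale (ksign (q * p' + r * (p' + q1))) (F (p + p') (x * a1) (q + q1) (y * b1) (r + q2) (z * b2))) (\<Delta> a2)) (\<Delta> a)"
      unfolding F_def by (intro ev3_\<Delta>_1 \<Delta>_tens ml_intros)
    also have "\<dots> = ev2 (\<lambda>p' a1 q' a2. ev2 (\<lambda>q1 b1 q2 b2. 
         scale (ksign (q * p' + r * (p' + q') + (p + p') * (q + r + q')))
           (S (y * (b1 * \<beta> * S b2) * S z) * \<theta> * (x * a1))) (\<Delta> a2)) (\<Delta> a)"
    proof (rule ev2_cong)
      fix p' q' a1 a2 assume a1: "a1 \<in> G p'" "a2 \<in> G q'"
      show "ev2 (\<lambda>q1 b1 q2 b2. 
         scale (ksign (q * p' + r * (p' + q1))) (F (p + p') (x * a1) (q + q1) (y * b1) (r + q2) (z * b2))) (\<Delta> a2)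
        = ev2 (\<lambda>q1 b1 q2 b2. 
         scale (ksign (q * p' + r * (p' + q') + (p + p') * (q + r + q')))
           (S (y * (b1 * \<beta> * S b2) * S z) * \<theta> * (x * a1))) (\<Delta> a2)"
        \<comment> \<open>The degrees of the two letters of \<open>\<Delta> a2\<close> add up to that of \<open>a2\<close>, so the sign becomes constant.\<close>
      proof (rule \<Delta>_degree[OF a1(2)])
        fix q1 q2 b1 b2 assume b: "b1 \<in> G q1" "b2 \<in> G q2" "q1 + q2 = q'"
        have "S (z * b2) = scale (ksign (r * q2)) (S b2 * S z)"
          using S_antimult h b by blast
        then show "scale (ksign (q * p' + r * (p' + q1))) (F (p + p') (x * a1) (q + q1) (y * b1) (r + q2) (z * b2))
          = scale (ksign (q * p' + r * (p' + q') + (p + p') * (q + r + q')))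
           (S (y * (b1 * \<beta> * S b2) * S z) * \<theta> * (x * a1))"
          unfolding b(3)[symmetric] F_def
          by (simp add: scale_mult_left scale_mult_right S_scale mult.assoc flip: ksign_add)
            (simp add: algebra_simps)
      qed (unfold F_def, (intro ml_intros)+)
    qed
    also have "\<dots> = ev2 (\<lambda>p' a1 q' a2. scale (\<epsilon> a2)
         (scale (ksign (q * p' + r * (p' + q') + (p + p') * (q + r + q')))
           (S (y * \<beta> * S z) * \<theta> * (x * a1)))) (\<Delta> a)"
      by (intro ev2_cong antipode_\<beta>_ev ml_intros)
    also have "\<dots> = ev2 (\<lambda>p' a1 q' a2. scale (\<epsilon> a2) (F p x q y r z * a1)) (\<Delta> a)"
    proof (rule ev2_cong)
      fix p' q' a1 a2 assume a1: "a1 \<in> G p'" "a2 \<in> G q'"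
      show "scale (\<epsilon> a2) (scale (ksign (q * p' + r * (p' + q') + (p + p') * (q + r + q')))
           (S (y * \<beta> * S z) * \<theta> * (x * a1))) = scale (\<epsilon> a2) (F p x q y r z * a1)"
        using \<epsilon>_odd[OF a1(2)] 
        by (cases "q' = 0") (auto simp: F_def scale_mult_left mult.assoc algebra_simps)
    qed
    also have "\<dots> = F p x q y r z * a"
      using a by (intro counit_right_ev ml_intros)
    finally show "ev3 (\<lambda>p' x' q' y' r' z'.
      scale (ksign (q * p' + r * (p' + q'))) (F (p + p') (x * x') (q + q') (y * y') (r + r') (z * z')))
      (apply_at 1 \<Delta> (\<Delta> a)) = F p x q y r z * a" .
  qed
  also have "\<dots> = ?U * a"
    unfolding to_double_dual_def F_def by (rule klin_ev3) (intro ml_intros)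
  finally have right: "ev3 F (\<Phi> \<odot> apply_at 1 \<Delta> (\<Delta> a)) = ?U * a" .
  have "ev3 F (apply_at 0 \<Delta> (\<Delta> a) \<odot> \<Phi>) = ev3 (\<lambda>p x q y r z. ev3 (\<lambda>p' x' q' y' r' z'.
      scale (ksign (q * p' + r * (p' + q'))) (F (p + p') (x * x') (q + q') (y * y') (r + r') (z * z')))
      \<Phi>) (apply_at 0 \<Delta> (\<Delta> a))"
    by (intro ev3_tmult F \<Phi>_tens tens_\<Delta>_at[of _ 2, simplified] \<Delta>_tens) simp
  also have "\<dots> = ev2 (\<lambda>q c r b. ev2 (\<lambda>q\<^sub>1 c\<^sub>1 q\<^sub>2 c\<^sub>2. ev3 (\<lambda>p' x' q' y' r' z'.
      scale (ksign (q\<^sub>2 * p' + r * (p' + q'))) (F (q\<^sub>1 + p') (c\<^sub>1 * x') (q\<^sub>2 + q') (c\<^sub>2 * y') (r + r') (b * z')))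
      \<Phi>) (\<Delta> c)) (\<Delta> a)"
    unfolding F_def by (intro ev3_\<Delta>_0 \<Delta>_tens ml_intros)
  also have "\<dots> = ev2 (\<lambda>q c r b. ev3 (\<lambda>p' x' q' y' r' z'. ev2 (\<lambda>q\<^sub>1 c\<^sub>1 q\<^sub>2 c\<^sub>2.
      scale (ksign (q\<^sub>2 * p' + r * (p' + q'))) (F (q\<^sub>1 + p') (c\<^sub>1 * x') (q\<^sub>2 + q') (c\<^sub>2 * y') (r + r') (b * z')))
      (\<Delta> c)) \<Phi>) (\<Delta> a)"
    unfolding ev23_swap ..
  also have "\<dots> = ev2 (\<lambda>q c r b. ev3 (\<lambda>p' x' q' y' r' z'. scale (\<epsilon> c) (S (S b) * F p' x' q' y' r' z')) \<Phi>) (\<Delta> a)"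
  proof (intro ev2_cong ev3_cong)
    fix q r p' q' r' c b x' y' z'
    assume h: "c \<in> G q" "b \<in> G r" "x' \<in> G p'" "y' \<in> G q'" "z' \<in> G r'"
    \<comment> \<open>The exponent of the sign once the factor \<open>(-1)\<^bsup>q\<^sub>1 q\<^sub>2\<^esup>\<close> of a twisted pairing is split off.\<close>
    let ?k = "q * (r + q' + r') + p' * (q' + r')"
    have "ev2 (\<lambda>q\<^sub>1 c\<^sub>1 q\<^sub>2 c\<^sub>2. scale (ksign (q\<^sub>2 * p' + r * (p' + q')))
        (F (q\<^sub>1 + p') (c\<^sub>1 * x') (q\<^sub>2 + q') (c\<^sub>2 * y') (r + r') (b * z'))) (\<Delta> c)
      = ev2 (\<lambda>q\<^sub>1 c\<^sub>1 q\<^sub>2 c\<^sub>2. scale (ksign ?k) (S (S b) * S (y' * \<beta> * S z') *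
        scale (ksign (q\<^sub>1 * q\<^sub>2)) (S c\<^sub>2 * \<theta> * c\<^sub>1) * x')) (\<Delta> c)"
    proof (rule \<Delta>_degree[OF h(1)])
      fix q\<^sub>1 q\<^sub>2 c\<^sub>1 c\<^sub>2 assume c: "c\<^sub>1 \<in> G q\<^sub>1" "c\<^sub>2 \<in> G q\<^sub>2" "q\<^sub>1 + q\<^sub>2 = q"
      let ?w = "y' * \<beta> * S z'"
      have w: "?w \<in> G (q' + r')"
        using G_mult[OF G_mult[OF h(4) \<beta>_even] S_grading[OF h(5)]] by simp
      have "S (b * z') = scale (ksign (r * r')) (S z' * S b)"
        using S_antimult h by blast
      moreover have "S (c\<^sub>2 * ?w * S b) = scale (ksign ((q\<^sub>2 + (q' + r')) * r)) (S (S b) * S (c\<^sub>2 * ?w))"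
        by (rule S_antimult[OF G_mult[OF c(2) w] S_grading[OF h(2)]])
      moreover have "S (c\<^sub>2 * ?w) = scale (ksign (q\<^sub>2 * (q' + r'))) (S ?w * S c\<^sub>2)"
        by (rule S_antimult[OF c(2) w])
      ultimately show "scale (ksign (q\<^sub>2 * p' + r * (p' + q')))
          (F (q\<^sub>1 + p') (c\<^sub>1 * x') (q\<^sub>2 + q') (c\<^sub>2 * y') (r + r') (b * z'))
        = scale (ksign ?k) (S (S b) * S ?w * scale (ksign (q\<^sub>1 * q\<^sub>2)) (S c\<^sub>2 * \<theta> * c\<^sub>1) * x')"
        unfolding c(3)[symmetric] F_def
        by (simp add: scale_mult_left scale_mult_right S_scale mult.assoc flip: ksign_add)
          (simp add: algebra_simps)
    qed (unfold F_def, (intro ml_intros)+)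
    also have "\<dots> = scale (\<epsilon> c) (scale (ksign ?k) (S (S b) * S (y' * \<beta> * S z') * \<theta> * x'))"
      using h(1) by (intro twisted_pairing_ev[OF \<theta>] ml_intros)
    also have "\<dots> = scale (\<epsilon> c) (S (S b) * F p' x' q' y' r' z')"
      using \<epsilon>_odd[OF h(1)] by (cases "q = 0") (auto simp: F_def scale_mult_right mult.assoc)
    finally show "ev2 (\<lambda>q\<^sub>1 c\<^sub>1 q\<^sub>2 c\<^sub>2. scale (ksign (q\<^sub>2 * p' + r * (p' + q')))
        (F (q\<^sub>1 + p') (c\<^sub>1 * x') (q\<^sub>2 + q') (c\<^sub>2 * y') (r + r') (b * z'))) (\<Delta> c)
      = scale (\<epsilon> c) (S (S b) * F p' x' q' y' r' z')" .
  qed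
  also have "\<dots> = ev2 (\<lambda>q c r b. scale (\<epsilon> c) (S (S b) * ?U)) (\<Delta> a)"
    unfolding to_double_dual_def F_def by (intro ev2_cong klin_ev3 ml_intros)
  also have "\<dots> = S (S a) * ?U"
    using a by (intro counit_left_ev ml_intros)
  finally show ?thesis
    using right ev3_same[OF quasi_coassoc_conj F] by simp
qed

text \<open>The same contraction for \<open>\<eta>\<close>. Here \<open>a\<close> passes the whole of \<open>\<Phi>\<close>, which causes no sign since \<open>\<Phi>\<close>
  is even.\<close>

lemma from_double_dual_commute:
  assumes \<eta>: "predual_pairing \<eta>" and a: "a \<in> G d"
  shows "inv S a * from_double_dual \<eta> = from_double_dual \<eta> * S a" (is "_ * ?V = _")
proof -
  define F where "F = (\<lambda>(p::bit) x (q::bit) y (r::bit) z. inv S x * \<eta> * (y * \<beta> * S z))"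
  have F: "ml3 F"
    unfolding F_def by (intro ml_intros)
  have "ev3 F (\<Phi> \<odot> apply_at 1 \<Delta> (\<Delta> a)) = ev3 (\<lambda>p x q y r z. ev3 (\<lambda>p' x' q' y' r' z'.
      scale (ksign (q * p' + r * (p' + q'))) (F (p + p') (x * x') (q + q') (y * y') (r + r') (z * z')))
      (apply_at 1 \<Delta> (\<Delta> a))) \<Phi>"
    by (intro ev3_tmult F \<Phi>_tens tens_\<Delta>_at[of _ 2, simplified] \<Delta>_tens) simp
  also have "\<dots> = ev3 (\<lambda>p x q y r z. ev2 (\<lambda>p' b q' c. ev2 (\<lambda>q\<^sub>1 c\<^sub>1 q\<^sub>2 c\<^sub>2.
      scale (ksign (q * p' + r * (p' + q\<^sub>1))) (F (p + p') (x * b) (q + q\<^sub>1) (y * c\<^sub>1) (r + q\<^sub>2) (z * c\<^sub>2)))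
      (\<Delta> c)) (\<Delta> a)) \<Phi>"
    unfolding F_def by (intro ev3_cong ev3_\<Delta>_1 \<Delta>_tens ml_intros)
  also have "\<dots> = ev3 (\<lambda>p x q y r z. scale (ksign ((p + q + r) * d)) (inv S a * F p x q y r z)) \<Phi>"
  proof (rule ev3_cong)
    fix p q r x y z assume h: "x \<in> G p" "y \<in> G q" "z \<in> G r"
    have "ev2 (\<lambda>p' b q' c. ev2 (\<lambda>q\<^sub>1 c\<^sub>1 q\<^sub>2 c\<^sub>2. scale (ksign (q * p' + r * (p' + q\<^sub>1)))
        (F (p + p') (x * b) (q + q\<^sub>1) (y * c\<^sub>1) (r + q\<^sub>2) (z * c\<^sub>2))) (\<Delta> c)) (\<Delta> a)
      = ev2 (\<lambda>p' b q' c. scale (\<epsilon> c) (scale (ksign ((p + q + r) * p')) (inv S b * F p x q y r z))) (\<Delta> a)"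
    proof (rule ev2_cong)
      fix p' q' b c assume b: "b \<in> G p'" "c \<in> G q'"
      let ?k = "(p + q + r) * p' + r * q'"
      have "ev2 (\<lambda>q\<^sub>1 c\<^sub>1 q\<^sub>2 c\<^sub>2. scale (ksign (q * p' + r * (p' + q\<^sub>1)))
          (F (p + p') (x * b) (q + q\<^sub>1) (y * c\<^sub>1) (r + q\<^sub>2) (z * c\<^sub>2))) (\<Delta> c)
        = ev2 (\<lambda>q\<^sub>1 c\<^sub>1 q\<^sub>2 c\<^sub>2. scale (ksign ?k)
          (inv S b * (inv S x * \<eta> * (y * (c\<^sub>1 * \<beta> * S c\<^sub>2) * S z)))) (\<Delta> c)"
      proof (rule \<Delta>_degree[OF b(2)])
        fix q\<^sub>1 q\<^sub>2 c\<^sub>1 c\<^sub>2 assume c: "c\<^sub>1 \<in> G q\<^sub>1" "c\<^sub>2 \<in> G q\<^sub>2" "q\<^sub>1 + q\<^sub>2 = q'"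
        have "S (z * c\<^sub>2) = scale (ksign (r * q\<^sub>2)) (S c\<^sub>2 * S z)"
          using S_antimult h c by blast
        moreover have "inv S (x * b) = scale (ksign (p * p')) (inv S b * inv S x)"
          using inv_S_antimult h b by blast
        ultimately show "scale (ksign (q * p' + r * (p' + q\<^sub>1)))
            (F (p + p') (x * b) (q + q\<^sub>1) (y * c\<^sub>1) (r + q\<^sub>2) (z * c\<^sub>2))
          = scale (ksign ?k) (inv S b * (inv S x * \<eta> * (y * (c\<^sub>1 * \<beta> * S c\<^sub>2) * S z)))"
          unfolding c(3)[symmetric] F_def
          by (simp add: scale_mult_left scale_mult_right mult.assoc flip: ksign_add)
            (simp add: algebra_simps)
      qed (unfold F_def, (intro ml_intros)+)
      also have "\<dots> = scale (\<epsilon> c) (scale (ksign ?k) (inv S b * F p x q y r z))"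
        unfolding F_def by (intro antipode_\<beta>_ev ml_intros)
      also have "\<dots> = scale (\<epsilon> c) (scale (ksign ((p + q + r) * p')) (inv S b * F p x q y r z))"
        using \<epsilon>_odd[OF b(2)] by (cases "q' = 0") auto
      finally show "ev2 (\<lambda>q\<^sub>1 c\<^sub>1 q\<^sub>2 c\<^sub>2. scale (ksign (q * p' + r * (p' + q\<^sub>1)))
          (F (p + p') (x * b) (q + q\<^sub>1) (y * c\<^sub>1) (r + q\<^sub>2) (z * c\<^sub>2))) (\<Delta> c)
        = scale (\<epsilon> c) (scale (ksign ((p + q + r) * p')) (inv S b * F p x q y r z))" .
    qed
    also have "\<dots> = scale (ksign ((p + q + r) * d)) (inv S a * F p x q y r z)"
      using a by (intro counit_right_ev ml_intros)
    finally show "ev2 (\<lambda>p' b q' c. ev2 (\<lambda>q\<^sub>1 c\<^sub>1 q\<^sub>2 c\<^sub>2. scale (ksign (q * p' + r * (p' + q\<^sub>1)))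
        (F (p + p') (x * b) (q + q\<^sub>1) (y * c\<^sub>1) (r + q\<^sub>2) (z * c\<^sub>2))) (\<Delta> c)) (\<Delta> a)
      = scale (ksign ((p + q + r) * d)) (inv S a * F p x q y r z)" .
  qed
  also have "\<dots> = ev3 (\<lambda>p x q y r z. inv S a * F p x q y r z) \<Phi>"
    unfolding F_def by (intro ev3_degree[OF \<Phi>_even] ml_intros) simp
  also have "\<dots> = inv S a * ?V"
    unfolding from_double_dual_def F_def by (intro klin_ev3 ml_intros)
  finally have right: "ev3 F (\<Phi> \<odot> apply_at 1 \<Delta> (\<Delta> a)) = inv S a * ?V" .
  have "ev3 F (apply_at 0 \<Delta> (\<Delta> a) \<odot> \<Phi>) = ev3 (\<lambda>p x q y r z. ev3 (\<lambda>p' x' q' y' r' z'.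
      scale (ksign (q * p' + r * (p' + q'))) (F (p + p') (x * x') (q + q') (y * y') (r + r') (z * z')))
      \<Phi>) (apply_at 0 \<Delta> (\<Delta> a))"
    by (intro ev3_tmult F \<Phi>_tens tens_\<Delta>_at[of _ 2, simplified] \<Delta>_tens) simp
  also have "\<dots> = ev2 (\<lambda>q c r b. ev2 (\<lambda>q\<^sub>1 c\<^sub>1 q\<^sub>2 c\<^sub>2. ev3 (\<lambda>p' x' q' y' r' z'.
      scale (ksign (q\<^sub>2 * p' + r * (p' + q'))) (F (q\<^sub>1 + p') (c\<^sub>1 * x') (q\<^sub>2 + q') (c\<^sub>2 * y') (r + r') (b * z')))
      \<Phi>) (\<Delta> c)) (\<Delta> a)"
    unfolding F_def by (intro ev3_\<Delta>_0 \<Delta>_tens ml_intros)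
  also have "\<dots> = ev2 (\<lambda>q c r b. ev3 (\<lambda>p' x' q' y' r' z'. ev2 (\<lambda>q\<^sub>1 c\<^sub>1 q\<^sub>2 c\<^sub>2.
      scale (ksign (q\<^sub>2 * p' + r * (p' + q'))) (F (q\<^sub>1 + p') (c\<^sub>1 * x') (q\<^sub>2 + q') (c\<^sub>2 * y') (r + r') (b * z')))
      (\<Delta> c)) \<Phi>) (\<Delta> a)"
    unfolding ev23_swap ..
  also have "\<dots> = ev2 (\<lambda>q c r b. ev3 (\<lambda>p' x' q' y' r' z'. scale (\<epsilon> c)
      (scale (ksign (r * (p' + q' + r'))) (F p' x' q' y' r' z' * S b))) \<Phi>) (\<Delta> a)"
  proof (intro ev2_cong ev3_cong)
    fix q r p' q' r' c b x' y' z'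
    assume h: "c \<in> G q" "b \<in> G r" "x' \<in> G p'" "y' \<in> G q'" "z' \<in> G r'"
    let ?k = "q * p' + r * (p' + q' + r')"
    have "ev2 (\<lambda>q\<^sub>1 c\<^sub>1 q\<^sub>2 c\<^sub>2. scale (ksign (q\<^sub>2 * p' + r * (p' + q')))
        (F (q\<^sub>1 + p') (c\<^sub>1 * x') (q\<^sub>2 + q') (c\<^sub>2 * y') (r + r') (b * z'))) (\<Delta> c)
      = ev2 (\<lambda>q\<^sub>1 c\<^sub>1 q\<^sub>2 c\<^sub>2. scale (ksign ?k)
        (inv S x' * (inv S c\<^sub>1 * \<eta> * c\<^sub>2) * (y' * \<beta> * S z') * S b)) (\<Delta> c)"
    proof (rule \<Delta>_degree[OF h(1)])
      fix q\<^sub>1 q\<^sub>2 c\<^sub>1 c\<^sub>2 assume c: "c\<^sub>1 \<in> G q\<^sub>1" "c\<^sub>2 \<in> G q\<^sub>2" "q\<^sub>1 + q\<^sub>2 = q"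
      have "S (b * z') = scale (ksign (r * r')) (S z' * S b)"
        using S_antimult h by blast
      moreover have "inv S (c\<^sub>1 * x') = scale (ksign (q\<^sub>1 * p')) (inv S x' * inv S c\<^sub>1)"
        using inv_S_antimult h c by blast
      ultimately show "scale (ksign (q\<^sub>2 * p' + r * (p' + q')))
          (F (q\<^sub>1 + p') (c\<^sub>1 * x') (q\<^sub>2 + q') (c\<^sub>2 * y') (r + r') (b * z'))
        = scale (ksign ?k) (inv S x' * (inv S c\<^sub>1 * \<eta> * c\<^sub>2) * (y' * \<beta> * S z') * S b)"
        unfolding c(3)[symmetric] F_def
        by (simp add: scale_mult_left scale_mult_right mult.assoc flip: ksign_add)
          (simp add: algebra_simps)
    qed (unfold F_def, (intro ml_intros)+)
    also have "\<dots> = scale (\<epsilon> c) (scale (ksign ?k) (inv S x' * \<eta> * (y' * \<beta> * S z') * S b))"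
      using h(1) by (intro predual_pairing_ev[OF \<eta>] ml_intros)
    also have "\<dots> = scale (\<epsilon> c) (scale (ksign (r * (p' + q' + r'))) (F p' x' q' y' r' z' * S b))"
      using \<epsilon>_odd[OF h(1)] by (cases "q = 0") (auto simp: F_def mult.assoc)
    finally show "ev2 (\<lambda>q\<^sub>1 c\<^sub>1 q\<^sub>2 c\<^sub>2. scale (ksign (q\<^sub>2 * p' + r * (p' + q')))
        (F (q\<^sub>1 + p') (c\<^sub>1 * x') (q\<^sub>2 + q') (c\<^sub>2 * y') (r + r') (b * z'))) (\<Delta> c)
      = scale (\<epsilon> c) (scale (ksign (r * (p' + q' + r'))) (F p' x' q' y' r' z' * S b))" .
  qed
  also have "\<dots> = ev2 (\<lambda>q c r b. ev3 (\<lambda>p' x' q' y' r' z'. scale (\<epsilon> c) (F p' x' q' y' r' z' * S b)) \<Phi>) (\<Delta> a)"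
    unfolding F_def by (intro ev2_cong ev3_degree[OF \<Phi>_even] ml_intros) simp
  also have "\<dots> = ev2 (\<lambda>q c r b. scale (\<epsilon> c) (?V * S b)) (\<Delta> a)"
    unfolding from_double_dual_def F_def by (intro ev2_cong klin_ev3 ml_intros)
  also have "\<dots> = ?V * S a"
    using a by (intro counit_left_ev ml_intros)
  finally show ?thesis
    using right ev3_same[OF quasi_coassoc_conj F] by simp
qed

text \<open>In the language of modules: pairing \<open>V\<^sup>*\<^sup>*\<close> with \<open>V\<^sup>*\<close> after \<open>V \<rightarrow> V\<^sup>*\<^sup>*\<close> gives back the pairing \<open>\<theta>\<close> of \<open>V\<close>
  with \<open>V\<^sup>*\<close>, by a zigzag identity for \<open>V\<^sup>*\<close>. The proof contracts the cancelled pentagon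
  \<open>(\<Delta> \<otimes> 1 \<otimes> 1)\<Phi> \<cdot> (1 \<otimes> 1 \<otimes> \<Delta>)\<Phi> \<cdot> (1 \<otimes> \<Phi>\<^sup>-\<^sup>1) = (\<Phi> \<otimes> 1) \<cdot> (1 \<otimes> \<Delta> \<otimes> 1)\<Phi>\<close> with
  \<open>x \<otimes> y \<otimes> z \<otimes> w \<mapsto> S(y \<beta> S(z) \<alpha> w) \<theta> x\<close>. Each of the three coproducts is absorbed by \<open>\<theta>\<close>, \<open>\<alpha>\<close> or \<open>\<beta>\<close> and
  leaves a counit of \<open>\<Phi>\<close>, so that the left side becomes \<open>S(\<Sum> X\<^sup>- \<beta> S(Y\<^sup>-) \<alpha> Z\<^sup>-) \<theta> = \<theta>\<close>, where
  \<open>\<Phi>\<^sup>-\<^sup>1 = \<Sum> X\<^sup>- \<otimes> Y\<^sup>- \<otimes> Z\<^sup>-\<close>, and the right side \<open>S(\<alpha>)\<close> times \<open>to_double_dual \<theta>\<close>.\<close>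

lemma S_\<alpha>_to_double_dual:
  assumes \<theta>: "twisted_pairing \<theta>"
  shows "S \<alpha> * to_double_dual \<theta> = \<theta>" (is "S \<alpha> * ?U = \<theta>")
proof -
  define F where "F = (\<lambda>p x (q::bit) y (r::bit) z (s::bit) w.
      scale (ksign (p * (q + r + s))) (S (y * \<beta> * S z * \<alpha> * w) * \<theta> * x))"
  have F: "ml4 F"
    unfolding F_def by (intro ml_intros)
  \<comment> \<open>\<open>\<theta>\<close> absorbs the coproduct in the leftmost factor, whatever stands to the right of it.\<close>
  have outer: "ev4 F (apply_at 0 \<Delta> \<Phi> \<odot> t) = ev4 F t" if t: "t \<in> tens 4" for t
  proof -
    have "ev4 F (apply_at 0 \<Delta> \<Phi> \<odot> t) = ev4 (\<lambda>p x q y r z v w. ev4 (\<lambda>p' x' q' y' r' z' v' w'.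
        scale (ksign (q * p' + r * (p' + q') + v * (p' + q' + r')))
          (F (p + p') (x * x') (q + q') (y * y') (r + r') (z * z') (v + v') (w * w'))) t)
        (apply_at 0 \<Delta> \<Phi>)"
      using t by (intro ev4_tmult F) simp_all
    also have "\<dots> = ev3 (\<lambda>p x q y r z. ev2 (\<lambda>p\<^sub>1 x\<^sub>1 p\<^sub>2 x\<^sub>2. ev4 (\<lambda>p' x' q' y' r' z' v' w'.
        scale (ksign (p\<^sub>2 * p' + q * (p' + q') + r * (p' + q' + r')))
          (F (p\<^sub>1 + p') (x\<^sub>1 * x') (p\<^sub>2 + q') (x\<^sub>2 * y') (q + r') (y * z') (r + v') (z * w'))) t)
        (\<Delta> x)) \<Phi>"
      unfolding F_def by (intro ev4_\<Delta>_0 \<Phi>_tens ml_intros)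
    also have "\<dots> = ev3 (\<lambda>p x q y r z. ev4 (\<lambda>p' x' q' y' r' z' v' w'. ev2 (\<lambda>p\<^sub>1 x\<^sub>1 p\<^sub>2 x\<^sub>2.
        scale (ksign (p\<^sub>2 * p' + q * (p' + q') + r * (p' + q' + r')))
          (F (p\<^sub>1 + p') (x\<^sub>1 * x') (p\<^sub>2 + q') (x\<^sub>2 * y') (q + r') (y * z') (r + v') (z * w')))
        (\<Delta> x)) t) \<Phi>"
      unfolding ev24_swap ..
    also have "\<dots> = ev3 (\<lambda>p x q y r z. ev4 (\<lambda>p' x' q' y' r' z' v' w'. scale (\<epsilon> x)
        (scale (ksign (q * (p' + q') + r * (p' + q' + r') + p' * (q + r + q' + r' + v')))
          (S (y' * \<beta> * S (y * z') * \<alpha> * (z * w')) * \<theta> * x'))) t) \<Phi>"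
    proof (intro ev3_cong ev4_cong)
      fix p q r p' q' r' v' x y z x' y' z' w'
      assume h: "x \<in> G p" "y \<in> G q" "z \<in> G r" "x' \<in> G p'" "y' \<in> G q'" "z' \<in> G r'" "w' \<in> G v'"
      let ?w = "y' * \<beta> * S (y * z') * \<alpha> * (z * w')"
      let ?k = "p * (q + r + q' + r' + v') + q * (p' + q') + r * (p' + q' + r') + p' * (q + r + q' + r' + v')"
      have w: "?w \<in> G (q' + (q + r') + (r + v'))"
        using G_mult[OF G_mult[OF G_mult[OF G_mult[OF h(5) \<beta>_even] S_grading[OF G_mult[OF h(2,6)]]] \<alpha>_even]
            G_mult[OF h(3,7)]] by simp
      have "ev2 (\<lambda>p\<^sub>1 x\<^sub>1 p\<^sub>2 x\<^sub>2. scale (ksign (p\<^sub>2 * p' + q * (p' + q') + r * (p' + q' + r')))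
          (F (p\<^sub>1 + p') (x\<^sub>1 * x') (p\<^sub>2 + q') (x\<^sub>2 * y') (q + r') (y * z') (r + v') (z * w'))) (\<Delta> x)
        = ev2 (\<lambda>p\<^sub>1 x\<^sub>1 p\<^sub>2 x\<^sub>2. scale (ksign ?k)
          (S ?w * scale (ksign (p\<^sub>1 * p\<^sub>2)) (S x\<^sub>2 * \<theta> * x\<^sub>1) * x')) (\<Delta> x)"
      proof (rule \<Delta>_degree[OF h(1)])
        fix p\<^sub>1 p\<^sub>2 x\<^sub>1 x\<^sub>2 assume c: "x\<^sub>1 \<in> G p\<^sub>1" "x\<^sub>2 \<in> G p\<^sub>2" "p\<^sub>1 + p\<^sub>2 = p"
        have "S (x\<^sub>2 * ?w) = scale (ksign (p\<^sub>2 * (q' + (q + r') + (r + v')))) (S ?w * S x\<^sub>2)"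
          by (rule S_antimult[OF c(2) w])
        then show "scale (ksign (p\<^sub>2 * p' + q * (p' + q') + r * (p' + q' + r')))
            (F (p\<^sub>1 + p') (x\<^sub>1 * x') (p\<^sub>2 + q') (x\<^sub>2 * y') (q + r') (y * z') (r + v') (z * w'))
          = scale (ksign ?k) (S ?w * scale (ksign (p\<^sub>1 * p\<^sub>2)) (S x\<^sub>2 * \<theta> * x\<^sub>1) * x')"
          unfolding c(3)[symmetric] F_def
          by (simp add: scale_mult_left scale_mult_right mult.assoc flip: ksign_add)
            (simp add: algebra_simps)
      qed (unfold F_def, (intro ml_intros)+)
      also have "\<dots> = scale (\<epsilon> x) (scale (ksign ?k) (S ?w * \<theta> * x'))"
        using h(1) by (intro twisted_pairing_ev[OF \<theta>] ml_intros)
      also have "\<dots> = scale (\<epsilon> x)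
        (scale (ksign (q * (p' + q') + r * (p' + q' + r') + p' * (q + r + q' + r' + v'))) (S ?w * \<theta> * x'))"
        using \<epsilon>_odd[OF h(1)] by (cases "p = 0") auto
      finally show "ev2 (\<lambda>p\<^sub>1 x\<^sub>1 p\<^sub>2 x\<^sub>2. scale (ksign (p\<^sub>2 * p' + q * (p' + q') + r * (p' + q' + r')))
          (F (p\<^sub>1 + p') (x\<^sub>1 * x') (p\<^sub>2 + q') (x\<^sub>2 * y') (q + r') (y * z') (r + v') (z * w'))) (\<Delta> x)
        = scale (\<epsilon> x)
        (scale (ksign (q * (p' + q') + r * (p' + q' + r') + p' * (q + r + q' + r' + v'))) (S ?w * \<theta> * x'))" .
    qed
    also have "\<dots> = ev3 (\<lambda>p x q y r z. scale (\<epsilon> x) (ev4 (\<lambda>p' x' q' y' r' z' v' w'.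
        scale (ksign (q * (p' + q') + r * (p' + q' + r') + p' * (q + r + q' + r' + v')))
          (S (y' * \<beta> * S (y * z') * \<alpha> * (z * w')) * \<theta> * x')) t)) \<Phi>"
      by (intro ev3_cong klin_ev4 ml_intros)
    also have "\<dots> = ev4 (\<lambda>p' x' q' y' r' z' v' w'.
        scale (ksign (0 * (p' + q') + 0 * (p' + q' + r') + p' * (0 + 0 + q' + r' + v')))
          (S (y' * \<beta> * S (1 * z') * \<alpha> * (1 * w')) * \<theta> * x')) t"
      by (rule counit_\<Phi>_first_ev) (intro ml_intros)
    also have "\<dots> = ev4 F t"
      by (simp add: F_def)
    finally show ?thesis .
  qed
  \<comment> \<open>\<open>\<alpha>\<close> absorbs the coproduct in the two rightmost factors.\<close>
  have "ev4 F (apply_at 2 \<Delta> \<Phi> \<odot> insert_one 0 \<Phi>inv) = \<theta>"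
  proof -
    have "ev4 F (apply_at 2 \<Delta> \<Phi> \<odot> insert_one 0 \<Phi>inv)
      = ev4 (\<lambda>p x q y r z v w. ev4 (\<lambda>p' x' q' y' r' z' v' w'.
        scale (ksign (q * p' + r * (p' + q') + v * (p' + q' + r')))
          (F (p + p') (x * x') (q + q') (y * y') (r + r') (z * z') (v + v') (w * w'))) (insert_one 0 \<Phi>inv))
        (apply_at 2 \<Delta> \<Phi>)"
      by (intro ev4_tmult F) simp_all
    also have "\<dots> = ev4 (\<lambda>p x q y r z v w. ev3 (\<lambda>q' y' r' z' v' w'.
        scale (ksign (q * 0 + r * (0 + q') + v * (0 + q' + r')))
          (F (p + 0) (x * 1) (q + q') (y * y') (r + r') (z * z') (v + v') (w * w'))) \<Phi>inv)
        (apply_at 2 \<Delta> \<Phi>)"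
      unfolding F_def by (intro ev4_cong ev4_insert_first \<Phi>inv_tens ml_intros)
    also have "\<dots> = ev3 (\<lambda>p x q y r z. ev2 (\<lambda>r\<^sub>1 z\<^sub>1 r\<^sub>2 z\<^sub>2. ev3 (\<lambda>q' y' r' z' v' w'.
        scale (ksign (q * 0 + r\<^sub>1 * (0 + q') + r\<^sub>2 * (0 + q' + r')))
          (F (p + 0) (x * 1) (q + q') (y * y') (r\<^sub>1 + r') (z\<^sub>1 * z') (r\<^sub>2 + v') (z\<^sub>2 * w'))) \<Phi>inv)
        (\<Delta> z)) \<Phi>"
      unfolding F_def by (intro ev4_\<Delta>_2 \<Phi>_tens ml_intros)
    also have "\<dots> = ev3 (\<lambda>p x q y r z. ev3 (\<lambda>q' y' r' z' v' w'. ev2 (\<lambda>r\<^sub>1 z\<^sub>1 r\<^sub>2 z\<^sub>2.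
        scale (ksign (q * 0 + r\<^sub>1 * (0 + q') + r\<^sub>2 * (0 + q' + r')))
          (F (p + 0) (x * 1) (q + q') (y * y') (r\<^sub>1 + r') (z\<^sub>1 * z') (r\<^sub>2 + v') (z\<^sub>2 * w')))
        (\<Delta> z)) \<Phi>inv) \<Phi>"
      unfolding ev23_swap ..
    also have "\<dots> = ev3 (\<lambda>p x q y r z. ev3 (\<lambda>q' y' r' z' v' w'. scale (\<epsilon> z)
        (scale (ksign (p * (q + q' + r' + v'))) (S (y * y' * \<beta> * S z' * \<alpha> * w') * \<theta> * x))) \<Phi>inv) \<Phi>"
    proof (intro ev3_cong)
      fix p q r q' r' v' x y z y' z' w'
      assume h: "x \<in> G p" "y \<in> G q" "z \<in> G r" "y' \<in> G q'" "z' \<in> G r'" "w' \<in> G v'"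
      let ?k = "r * (q' + r') + p * (q + r + q' + r' + v')"
      have "ev2 (\<lambda>r\<^sub>1 z\<^sub>1 r\<^sub>2 z\<^sub>2. scale (ksign (q * 0 + r\<^sub>1 * (0 + q') + r\<^sub>2 * (0 + q' + r')))
          (F (p + 0) (x * 1) (q + q') (y * y') (r\<^sub>1 + r') (z\<^sub>1 * z') (r\<^sub>2 + v') (z\<^sub>2 * w'))) (\<Delta> z)
        = ev2 (\<lambda>r\<^sub>1 z\<^sub>1 r\<^sub>2 z\<^sub>2. scale (ksign ?k)
          (S (y * y' * \<beta> * S z' * (S z\<^sub>1 * \<alpha> * z\<^sub>2) * w') * \<theta> * x)) (\<Delta> z)"
      proof (rule \<Delta>_degree[OF h(3)])
        fix r\<^sub>1 r\<^sub>2 z\<^sub>1 z\<^sub>2 assume c: "z\<^sub>1 \<in> G r\<^sub>1" "z\<^sub>2 \<in> G r\<^sub>2" "r\<^sub>1 + r\<^sub>2 = r"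
        have "S (z\<^sub>1 * z') = scale (ksign (r\<^sub>1 * r')) (S z' * S z\<^sub>1)"
          using S_antimult h c by blast
        then show "scale (ksign (q * 0 + r\<^sub>1 * (0 + q') + r\<^sub>2 * (0 + q' + r')))
            (F (p + 0) (x * 1) (q + q') (y * y') (r\<^sub>1 + r') (z\<^sub>1 * z') (r\<^sub>2 + v') (z\<^sub>2 * w'))
          = scale (ksign ?k) (S (y * y' * \<beta> * S z' * (S z\<^sub>1 * \<alpha> * z\<^sub>2) * w') * \<theta> * x)"
          unfolding c(3)[symmetric] F_def
          by (simp add: scale_mult_left scale_mult_right S_scale mult.assoc flip: ksign_add)
            (simp add: algebra_simps)
      qed (unfold F_def, (intro ml_intros)+)
      also have "\<dots> = scale (\<epsilon> z) (scale (ksign ?k) (S (y * y' * \<beta> * S z' * \<alpha> * w') * \<theta> * x))"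
        by (intro antipode_\<alpha>_ev ml_intros)
      also have "\<dots> = scale (\<epsilon> z) (scale (ksign (p * (q + q' + r' + v'))) (S (y * y' * \<beta> * S z' * \<alpha> * w') * \<theta> * x))"
        using \<epsilon>_odd[OF h(3)] by (cases "r = 0") auto
      finally show "ev2 (\<lambda>r\<^sub>1 z\<^sub>1 r\<^sub>2 z\<^sub>2. scale (ksign (q * 0 + r\<^sub>1 * (0 + q') + r\<^sub>2 * (0 + q' + r')))
          (F (p + 0) (x * 1) (q + q') (y * y') (r\<^sub>1 + r') (z\<^sub>1 * z') (r\<^sub>2 + v') (z\<^sub>2 * w'))) (\<Delta> z)
        = scale (\<epsilon> z) (scale (ksign (p * (q + q' + r' + v'))) (S (y * y' * \<beta> * S z' * \<alpha> * w') * \<theta> * x))" .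
    qed
    also have "\<dots> = ev3 (\<lambda>p x q y r z. scale (\<epsilon> z) (ev3 (\<lambda>q' y' r' z' v' w'.
        scale (ksign (p * (q + q' + r' + v'))) (S (y * y' * \<beta> * S z' * \<alpha> * w') * \<theta> * x)) \<Phi>inv)) \<Phi>"
      by (intro ev3_cong klin_ev3 ml_intros)
    also have "\<dots> = ev3 (\<lambda>q' y' r' z' v' w'.
        scale (ksign (0 * (0 + q' + r' + v'))) (S (1 * y' * \<beta> * S z' * \<alpha> * w') * \<theta> * 1)) \<Phi>inv"
      by (rule counit_\<Phi>_last_ev) (intro ml_intros)
    also have "\<dots> = S (ev3 (\<lambda>q' y' r' z' v' w'. y' * \<beta> * S z' * \<alpha> * w') \<Phi>inv) * \<theta>"
      using klin_ev3[of "\<lambda>v. S v * \<theta>"] by (simp add: ml_intros)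
    also have "\<dots> = \<theta>"
      by (simp add: antipode_\<Phi>inv_ev S_one)
    finally show ?thesis .
  qed
  \<comment> \<open>\<open>\<beta>\<close> absorbs the coproduct in the two middle factors.\<close>
  moreover have "ev4 F (insert_one 3 \<Phi> \<odot> apply_at 1 \<Delta> \<Phi>) = S \<alpha> * ?U"
  proof -
    have "ev4 F (insert_one 3 \<Phi> \<odot> apply_at 1 \<Delta> \<Phi>)
      = ev4 (\<lambda>p x q y r z v w. ev4 (\<lambda>p' x' q' y' r' z' v' w'.
        scale (ksign (q * p' + r * (p' + q') + v * (p' + q' + r')))
          (F (p + p') (x * x') (q + q') (y * y') (r + r') (z * z') (v + v') (w * w'))) (apply_at 1 \<Delta> \<Phi>))
        (insert_one 3 \<Phi>)"
      by (intro ev4_tmult F) simp_all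
    also have "\<dots> = ev3 (\<lambda>p x q y r z. ev4 (\<lambda>p' x' q' y' r' z' v' w'.
        scale (ksign (q * p' + r * (p' + q') + 0 * (p' + q' + r')))
          (F (p + p') (x * x') (q + q') (y * y') (r + r') (z * z') (0 + v') (1 * w'))) (apply_at 1 \<Delta> \<Phi>)) \<Phi>"
      unfolding F_def by (intro ev4_insert_last \<Phi>_tens ml_intros)
    also have "\<dots> = ev3 (\<lambda>p x q y r z. S \<alpha> * scale (ksign (p * (q + r))) (S (y * \<beta> * S z) * \<theta> * x)) \<Phi>"
    proof (rule ev3_cong)
      fix p q r x y z assume h: "x \<in> G p" "y \<in> G q" "z \<in> G r"
      have "ev4 (\<lambda>p' x' q' y' r' z' v' w'. scale (ksign (q * p' + r * (p' + q') + 0 * (p' + q' + r')))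
          (F (p + p') (x * x') (q + q') (y * y') (r + r') (z * z') (0 + v') (1 * w'))) (apply_at 1 \<Delta> \<Phi>)
        = ev3 (\<lambda>p' x' q' y' r' z'. ev2 (\<lambda>q\<^sub>1 y\<^sub>1 q\<^sub>2 y\<^sub>2.
          scale (ksign (q * p' + r * (p' + q\<^sub>1) + 0 * (p' + q\<^sub>1 + q\<^sub>2)))
          (F (p + p') (x * x') (q + q\<^sub>1) (y * y\<^sub>1) (r + q\<^sub>2) (z * y\<^sub>2) (0 + r') (1 * z'))) (\<Delta> y')) \<Phi>"
        unfolding F_def by (intro ev4_\<Delta>_1 \<Phi>_tens ml_intros)
      also have "\<dots> = ev3 (\<lambda>p' x' q' y' r' z'. scale (\<epsilon> y') (scale (ksign (p' * (q + r) + (p + p') * (q + r + r')))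
          (S (y * \<beta> * S z * \<alpha> * z') * \<theta> * (x * x')))) \<Phi>"
      proof (rule ev3_cong)
        fix p' q' r' x' y' z' assume h': "x' \<in> G p'" "y' \<in> G q'" "z' \<in> G r'"
        let ?k = "q * p' + r * (p' + q') + (p + p') * (q + r + q' + r')"
        have "ev2 (\<lambda>q\<^sub>1 y\<^sub>1 q\<^sub>2 y\<^sub>2. scale (ksign (q * p' + r * (p' + q\<^sub>1) + 0 * (p' + q\<^sub>1 + q\<^sub>2)))
            (F (p + p') (x * x') (q + q\<^sub>1) (y * y\<^sub>1) (r + q\<^sub>2) (z * y\<^sub>2) (0 + r') (1 * z'))) (\<Delta> y')
          = ev2 (\<lambda>q\<^sub>1 y\<^sub>1 q\<^sub>2 y\<^sub>2. scale (ksign ?k)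
            (S (y * (y\<^sub>1 * \<beta> * S y\<^sub>2) * S z * \<alpha> * z') * \<theta> * (x * x'))) (\<Delta> y')"
        proof (rule \<Delta>_degree[OF h'(2)])
          fix q\<^sub>1 q\<^sub>2 y\<^sub>1 y\<^sub>2 assume c: "y\<^sub>1 \<in> G q\<^sub>1" "y\<^sub>2 \<in> G q\<^sub>2" "q\<^sub>1 + q\<^sub>2 = q'"
          have "S (z * y\<^sub>2) = scale (ksign (r * q\<^sub>2)) (S y\<^sub>2 * S z)"
            using S_antimult h c by blast
          then show "scale (ksign (q * p' + r * (p' + q\<^sub>1) + 0 * (p' + q\<^sub>1 + q\<^sub>2)))
              (F (p + p') (x * x') (q + q\<^sub>1) (y * y\<^sub>1) (r + q\<^sub>2) (z * y\<^sub>2) (0 + r') (1 * z'))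
            = scale (ksign ?k) (S (y * (y\<^sub>1 * \<beta> * S y\<^sub>2) * S z * \<alpha> * z') * \<theta> * (x * x'))"
            unfolding c(3)[symmetric] F_def
            by (simp add: scale_mult_left scale_mult_right S_scale mult.assoc flip: ksign_add)
              (simp add: algebra_simps)
        qed (unfold F_def, (intro ml_intros)+)
        also have "\<dots> = scale (\<epsilon> y') (scale (ksign ?k) (S (y * \<beta> * S z * \<alpha> * z') * \<theta> * (x * x')))"
          by (intro antipode_\<beta>_ev ml_intros)
        also have "\<dots> = scale (\<epsilon> y') (scale (ksign (p' * (q + r) + (p + p') * (q + r + r')))
            (S (y * \<beta> * S z * \<alpha> * z') * \<theta> * (x * x')))"
          using \<epsilon>_odd[OF h'(2)] by (cases "q' = 0") (auto simp: algebra_simps)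
        finally show "ev2 (\<lambda>q\<^sub>1 y\<^sub>1 q\<^sub>2 y\<^sub>2. scale (ksign (q * p' + r * (p' + q\<^sub>1) + 0 * (p' + q\<^sub>1 + q\<^sub>2)))
            (F (p + p') (x * x') (q + q\<^sub>1) (y * y\<^sub>1) (r + q\<^sub>2) (z * y\<^sub>2) (0 + r') (1 * z'))) (\<Delta> y')
          = scale (\<epsilon> y') (scale (ksign (p' * (q + r) + (p + p') * (q + r + r')))
            (S (y * \<beta> * S z * \<alpha> * z') * \<theta> * (x * x')))" .
      qed
      also have "\<dots> = scale (ksign (0 * (q + r) + (p + 0) * (q + r + 0))) (S (y * \<beta> * S z * \<alpha> * 1) * \<theta> * (x * 1))"
        by (rule counit_\<Phi>_ev) (intro ml_intros)
      also have "\<dots> = S \<alpha> * scale (ksign (p * (q + r))) (S (y * \<beta> * S z) * \<theta> * x)"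
      proof -
        have "S (y * \<beta> * S z * \<alpha>) = S \<alpha> * S (y * \<beta> * S z)"
          using S_antimult[OF G_mult[OF G_mult[OF h(2) \<beta>_even] S_grading[OF h(3)]] \<alpha>_even] by simp
        then show ?thesis
          by (simp add: scale_mult_right mult.assoc)
      qed
      finally show "ev4 (\<lambda>p' x' q' y' r' z' v' w'. scale (ksign (q * p' + r * (p' + q') + 0 * (p' + q' + r')))
          (F (p + p') (x * x') (q + q') (y * y') (r + r') (z * z') (0 + v') (1 * w'))) (apply_at 1 \<Delta> \<Phi>)
        = S \<alpha> * scale (ksign (p * (q + r))) (S (y * \<beta> * S z) * \<theta> * x)" .
    qed
    also have "\<dots> = S \<alpha> * ?U"
      unfolding to_double_dual_def by (intro klin_ev3 ml_intros)
    finally show ?thesis .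
  qed
  ultimately show ?thesis
    using ev4_same[OF pentagon_cancelled F] outer[of "apply_at 2 \<Delta> \<Phi> \<odot> insert_one 0 \<Phi>inv"]
    by (simp add: tens_tmult)
qed

end

context quasi_triangular_quasi_hopf_superalgebra
begin

section \<open>The pairings of the universal R-matrix\<close>

lemma R_tens: "R \<in> tens 2"
  using R_homogeneous homogeneous_tens_tens by blast

lemma R_even: "of_degree 2 0 R"
  using R_homogeneous of_degree_invertible[OF _ Rinv_tens R_right_inv] by blast

lemma Rinv_even: "of_degree 2 0 Rinv"
  using R_even R_tens Rinv_tens tens_eq_same_ev[OF R_right_inv] tens_eq_same_ev[OF R_left_inv]
  by (rule of_degree_inverse)

text \<open>The evaluation \<open>V\<^sup>* \<otimes> V \<rightarrow> K\<close> precomposed with the braiding, and its analogue for the predual and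
  the inverse braiding.\<close>

definition \<theta> :: 'a where
  "\<theta> = ev2 (\<lambda>p x q y. scale (ksign (p * q)) (S y * \<alpha> * x)) R"

definition \<eta> :: 'a where
  "\<eta> = ev2 (\<lambda>p x q y. scale (ksign (p * q)) (inv S (\<alpha> * y) * x)) Rinv"

abbreviation drinfeld :: 'a where
  "drinfeld \<equiv> to_double_dual \<theta>"

abbreviation drinfeld_inv :: 'a where
  "drinfeld_inv \<equiv> from_double_dual \<eta>"

text \<open>Contract \<open>R \<Delta>(a) = \<Delta>\<^sup>T(a) R\<close> with the functional that takes \<open>R\<close> to \<open>\<theta>\<close>.\<close>

lemma twisted_pairing_\<theta>: "twisted_pairing \<theta>"
  unfolding twisted_pairing_def
proof (intro allI ballI)
  fix d a assume a: "a \<in> G d"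
  define g where "g = (\<lambda>p x q y. scale (ksign (p * q)) (S y * \<alpha> * x))"
  have g: "ml2 g"
    unfolding g_def by (intro ml_intros)
  have "ev2 g (R \<odot> \<Delta> a) = ev2 (\<lambda>p x q y. ev2 (\<lambda>r e s e'.
      scale (ksign (s * p)) (g (r + p) (e * x) (s + q) (e' * y))) R) (\<Delta> a)"
    unfolding ev2_tmult[OF g R_tens \<Delta>_tens] by (rule ev22_swap)
  also have "\<dots> = ev2 (\<lambda>p x q y. ev2 (\<lambda>r e s e'.
      scale (ksign (p * q)) (S y * scale (ksign (r * s)) (S e' * \<alpha> * e) * x)) R) (\<Delta> a)"
  proof (rule ev2_cong, rule ev2_degree[OF R_even])
    fix p q r s x y e e' assume h: "x \<in> G p" "y \<in> G q" "e \<in> G r" "e' \<in> G s" "r + s = 0"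
    have "S (e' * y) = scale (ksign (s * q)) (S y * S e')"
      using S_antimult h by blast
    moreover have "r = s"
      using h(5) by (cases r; cases s) auto
    ultimately show "scale (ksign (s * p)) (g (r + p) (e * x) (s + q) (e' * y))
        = scale (ksign (p * q)) (S y * scale (ksign (r * s)) (S e' * \<alpha> * e) * x)"
      unfolding g_def
      by (simp add: scale_mult_left scale_mult_right mult.assoc flip: ksign_add) (simp add: algebra_simps)
  qed (unfold g_def, (intro ml_intros)+)
  also have "\<dots> = ev2 (\<lambda>p x q y. scale (ksign (p * q)) (S y * \<theta> * x)) (\<Delta> a)"
    unfolding \<theta>_def by (intro ev2_cong klin_ev2 ml_intros)
  finally have left: "ev2 g (R \<odot> \<Delta> a) = ev2 (\<lambda>p x q y. scale (ksign (p * q)) (S y * \<theta> * x)) (\<Delta> a)" .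
  have "ev2 g (flip_at 0 (\<Delta> a) \<odot> R) = ev2 (\<lambda>q y p x. ev2 (\<lambda>r e s e'.
      scale (ksign (p * r)) (g (q + r) (y * e) (p + s) (x * e'))) R) (flip_at 0 (\<Delta> a))"
    by (intro ev2_tmult g tens_flip \<Delta>_tens R_tens)
  also have "\<dots> = ev2 (\<lambda>p x q y. scale (ksign (p * q)) (ev2 (\<lambda>r e s e'.
      scale (ksign (p * r)) (g (q + r) (y * e) (p + s) (x * e'))) R)) (\<Delta> a)"
    unfolding g_def by (intro ev2_flip \<Delta>_tens ml_intros)
  also have "\<dots> = ev2 (\<lambda>p x q y. ev2 (\<lambda>r e s e'.
      scale (ksign (r * s + s * d)) (S e' * (S x * \<alpha> * y) * e)) R) (\<Delta> a)"
  proof (rule \<Delta>_degree[OF a])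
    fix p q x y assume x: "x \<in> G p" "y \<in> G q" "p + q = d"
    have "scale (ksign (p * q)) (ev2 (\<lambda>r e s e'.
        scale (ksign (p * r)) (g (q + r) (y * e) (p + s) (x * e'))) R)
      = ev2 (\<lambda>r e s e'. scale (ksign (p * q)) (scale (ksign (p * r)) (g (q + r) (y * e) (p + s) (x * e')))) R"
      by (rule klin_ev2[symmetric]) (intro ml_intros)
    also have "\<dots> = ev2 (\<lambda>r e s e'. scale (ksign (r * s + s * d)) (S e' * (S x * \<alpha> * y) * e)) R"
    proof (rule ev2_cong)
      fix r s e e' assume h: "e \<in> G r" "e' \<in> G s"
      have "S (x * e') = scale (ksign (p * s)) (S e' * S x)"
        using S_antimult h x by blast
      then show "scale (ksign (p * q)) (scale (ksign (p * r)) (g (q + r) (y * e) (p + s) (x * e')))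
          = scale (ksign (r * s + s * d)) (S e' * (S x * \<alpha> * y) * e)"
        unfolding x(3)[symmetric] g_def
        by (simp add: scale_mult_left scale_mult_right mult.assoc flip: ksign_add) (simp add: algebra_simps)
    qed
    finally show "scale (ksign (p * q)) (ev2 (\<lambda>r e s e'.
        scale (ksign (p * r)) (g (q + r) (y * e) (p + s) (x * e'))) R)
      = ev2 (\<lambda>r e s e'. scale (ksign (r * s + s * d)) (S e' * (S x * \<alpha> * y) * e)) R" .
  qed (unfold g_def, (intro ml_intros)+)
  also have "\<dots> = ev2 (\<lambda>r e s e'. ev2 (\<lambda>p x q y.
      scale (ksign (r * s + s * d)) (S e' * (S x * \<alpha> * y) * e)) (\<Delta> a)) R"
    by (rule ev22_swap)
  also have "\<dots> = ev2 (\<lambda>r e s e'. scale (\<epsilon> a) (scale (ksign (r * s + s * d)) (S e' * \<alpha> * e))) R"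
    by (intro ev2_cong antipode_\<alpha>_ev ml_intros)
  also have "\<dots> = ev2 (\<lambda>r e s e'. scale (\<epsilon> a) (g r e s e')) R"
    using \<epsilon>_odd[OF a] by (cases "d = 0") (auto simp: g_def)
  also have "\<dots> = scale (\<epsilon> a) \<theta>"
    unfolding \<theta>_def g_def by (intro klin_ev2 ml_intros)
  finally show "ev2 (\<lambda>p x q y. scale (ksign (p * q)) (S y * \<theta> * x)) (\<Delta> a) = scale (\<epsilon> a) \<theta>"
    using left ev2_same[OF tens_eq_same_ev[OF R_intertwines] g] by simp
qed

lemma Rinv_intertwines: "same_ev 2 (Rinv \<odot> flip_at 0 (\<Delta> a)) (\<Delta> a \<odot> Rinv)"
proof -
  note [simp] = R_tens Rinv_tens \<Delta>_tens tens_flip tens_tmult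
  have "same_ev 2 (Rinv \<odot> flip_at 0 (\<Delta> a) \<odot> R) (Rinv \<odot> (flip_at 0 (\<Delta> a) \<odot> R))"
    by (intro same_ev_tmult_assoc) simp_all
  also have "same_ev 2 (Rinv \<odot> (flip_at 0 (\<Delta> a) \<odot> R)) (\<Delta> a)"
    by (intro same_ev_sym[OF same_ev_cancel_left[OF tens_eq_same_ev[OF R_left_inv]]]
        same_ev_sym[OF tens_eq_same_ev[OF R_intertwines]]) simp_all
  finally show ?thesis
    by (intro same_ev_cancel_right[OF tens_eq_same_ev[OF R_right_inv]]) simp_all
qed

text \<open>Contract \<open>R\<^sup>-\<^sup>1 \<Delta>\<^sup>T(a) = \<Delta>(a) R\<^sup>-\<^sup>1\<close> with the functional that takes \<open>R\<^sup>-\<^sup>1\<close> to \<open>\<eta>\<close>.\<close>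

lemma predual_pairing_\<eta>: "predual_pairing \<eta>"
  unfolding predual_pairing_def
proof (intro allI ballI)
  fix d a assume a: "a \<in> G d"
  define g where "g = (\<lambda>p x q y. scale (ksign (p * q)) (inv S (\<alpha> * y) * x))"
  have g: "ml2 g"
    unfolding g_def by (intro ml_intros)
  have "ev2 g (Rinv \<odot> flip_at 0 (\<Delta> a)) = ev2 (\<lambda>q y p x. ev2 (\<lambda>r f s f'.
      scale (ksign (s * q)) (g (r + q) (f * y) (s + p) (f' * x))) Rinv) (flip_at 0 (\<Delta> a))"
    unfolding ev2_tmult[OF g Rinv_tens tens_flip[OF \<Delta>_tens]] by (rule ev22_swap)
  also have "\<dots> = ev2 (\<lambda>p x q y. scale (ksign (p * q)) (ev2 (\<lambda>r f s f'.
      scale (ksign (s * q)) (g (r + q) (f * y) (s + p) (f' * x))) Rinv)) (\<Delta> a)"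
    unfolding g_def by (intro ev2_flip \<Delta>_tens ml_intros)
  also have "\<dots> = ev2 (\<lambda>p x q y. ev2 (\<lambda>r f s f'.
      scale (ksign (p * q)) (scale (ksign (s * q)) (g (r + q) (f * y) (s + p) (f' * x)))) Rinv) (\<Delta> a)"
    by (intro ev2_cong klin_ev2[symmetric] ml_intros)
  also have "\<dots> = ev2 (\<lambda>p x q y. ev2 (\<lambda>r f s f'. inv S x * g r f s f' * y) Rinv) (\<Delta> a)"
  proof (rule ev2_cong, rule ev2_degree[OF Rinv_even])
    fix p q r s x y f f' assume h: "x \<in> G p" "y \<in> G q" "f \<in> G r" "f' \<in> G s" "r + s = 0"
    have "inv S (\<alpha> * f' * x) = scale (ksign ((0 + s) * p)) (inv S x * inv S (\<alpha> * f'))"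
      by (rule inv_S_antimult[OF G_mult[OF \<alpha>_even h(4)] h(1)])
    moreover have "r = s"
      using h(5) by (cases r; cases s) auto
    ultimately show "scale (ksign (p * q)) (scale (ksign (s * q)) (g (r + q) (f * y) (s + p) (f' * x)))
        = inv S x * g r f s f' * y"
      unfolding g_def
      by (simp add: scale_mult_left scale_mult_right mult.assoc flip: ksign_add) (simp add: algebra_simps)
  qed (unfold g_def, (intro ml_intros)+)
  also have "\<dots> = ev2 (\<lambda>p x q y. inv S x * \<eta> * y) (\<Delta> a)"
    unfolding \<eta>_def g_def by (intro ev2_cong klin_ev2 ml_intros)
  finally have left: "ev2 g (Rinv \<odot> flip_at 0 (\<Delta> a)) = ev2 (\<lambda>p x q y. inv S x * \<eta> * y) (\<Delta> a)" .
  have "ev2 g (\<Delta> a \<odot> Rinv) = ev2 (\<lambda>p x q y. ev2 (\<lambda>r f s f'.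
      scale (ksign (q * r)) (g (p + r) (x * f) (q + s) (y * f'))) Rinv) (\<Delta> a)"
    by (intro ev2_tmult g \<Delta>_tens Rinv_tens)
  also have "\<dots> = ev2 (\<lambda>p x q y. ev2 (\<lambda>r f s f'.
      scale (ksign (r * s + s * d)) (inv S f' * inv S (S x * \<alpha> * y) * f)) Rinv) (\<Delta> a)"
  proof (rule \<Delta>_degree[OF a _ _ ev2_cong])
    fix p q r s x y f f' assume x: "x \<in> G p" "y \<in> G q" "p + q = d" and h: "f \<in> G r" "f' \<in> G s"
    have "inv S (\<alpha> * y * f') = scale (ksign ((0 + q) * s)) (inv S f' * inv S (\<alpha> * y))"
      by (rule inv_S_antimult[OF G_mult[OF \<alpha>_even x(2)] h(2)])
    moreover have "inv S (S x * (\<alpha> * y)) = scale (ksign (p * (0 + q))) (inv S (\<alpha> * y) * inv S (S x))"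
      by (rule inv_S_antimult[OF S_grading[OF x(1)] G_mult[OF \<alpha>_even x(2)]])
    ultimately show "scale (ksign (q * r)) (g (p + r) (x * f) (q + s) (y * f'))
        = scale (ksign (r * s + s * d)) (inv S f' * inv S (S x * \<alpha> * y) * f)"
      unfolding x(3)[symmetric] g_def
      by (simp add: scale_mult_left scale_mult_right mult.assoc flip: ksign_add) (simp add: algebra_simps)
  qed (unfold g_def, (intro ml_intros)+)
  also have "\<dots> = ev2 (\<lambda>r f s f'. ev2 (\<lambda>p x q y.
      scale (ksign (r * s + s * d)) (inv S f' * inv S (S x * \<alpha> * y) * f)) (\<Delta> a)) Rinv"
    by (rule ev22_swap)
  also have "\<dots> = ev2 (\<lambda>r f s f'. scale (\<epsilon> a) (scale (ksign (r * s + s * d)) (inv S f' * inv S \<alpha> * f))) Rinv"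
    by (intro ev2_cong antipode_\<alpha>_ev ml_intros)
  also have "\<dots> = ev2 (\<lambda>r f s f'. scale (\<epsilon> a) (g r f s f')) Rinv"
  proof (rule ev2_cong)
    fix r s f f' assume "f' \<in> G s"
    then have "inv S (\<alpha> * f') = inv S f' * inv S \<alpha>"
      using inv_S_antimult[OF \<alpha>_even] by simp
    then show "scale (\<epsilon> a) (scale (ksign (r * s + s * d)) (inv S f' * inv S \<alpha> * f)) = scale (\<epsilon> a) (g r f s f')"
      using \<epsilon>_odd[OF a] by (cases "d = 0") (auto simp: g_def)
  qed
  also have "\<dots> = scale (\<epsilon> a) \<eta>"
    unfolding \<eta>_def g_def by (intro klin_ev2 ml_intros)
  finally show "ev2 (\<lambda>p x q y. inv S x * \<eta> * y) (\<Delta> a) = scale (\<epsilon> a) \<eta>"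
    using left ev2_same[OF Rinv_intertwines g] by simp
qed

section \<open>The Drinfeld element and its inverse\<close>

lemma drinfeld_commute: "drinfeld * a = S (S a) * drinfeld"
proof -
  have *: "drinfeld * b = S (S b) * drinfeld" if "b \<in> G d" for b d
    using twisted_pairing_\<theta> that by (rule to_double_dual_commute)
  have "drinfeld * (hpart 0 a + hpart 1 a) = S (S (hpart 0 a + hpart 1 a)) * drinfeld"
    by (simp only: S_add distrib_left distrib_right *[OF hpart_in_G])
  then show ?thesis
    by (simp only: hpart_sum)
qed

lemma drinfeld_inv_commute: "a * drinfeld_inv = drinfeld_inv * S (S a)"
proof -
  have *: "inv S b * drinfeld_inv = drinfeld_inv * S b" if "b \<in> G d" for b d
    using predual_pairing_\<eta> that by (rule from_double_dual_commute)
  have **: "b * drinfeld_inv = drinfeld_inv * S (S b)" if "b \<in> G d" for b d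
    using *[OF S_grading[OF that]] by simp
  have "(hpart 0 a + hpart 1 a) * drinfeld_inv = drinfeld_inv * S (S (hpart 0 a + hpart 1 a))"
    by (simp only: S_add distrib_left distrib_right **[OF hpart_in_G])
  then show ?thesis
    by (simp only: hpart_sum)
qed

text \<open>Moving \<open>u\<close> past \<open>S\<^sup>-\<^sup>1(\<alpha> f')\<close> turns it into \<open>S(f') S(\<alpha>)\<close>, and \<open>S(\<alpha>)u = \<theta>\<close> is a contraction of \<open>R\<close>, so that
  \<open>u\<eta>\<close> is a contraction of \<open>R R\<^sup>-\<^sup>1 = 1 \<otimes> 1\<close>.\<close>

lemma drinfeld_\<eta>: "drinfeld * \<eta> = \<alpha>"
proof -
  define g where "g = (\<lambda>p x q y. scale (ksign (p * q)) (S y * \<alpha> * x))"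
  have g: "ml2 g"
    unfolding g_def by (intro ml_intros)
  have "drinfeld * \<eta> = ev2 (\<lambda>r f s f'. drinfeld * scale (ksign (r * s)) (inv S (\<alpha> * f') * f)) Rinv"
    unfolding \<eta>_def by (intro klin_ev2[symmetric] ml_intros)
  also have "\<dots> = ev2 (\<lambda>r f s f'. scale (ksign (r * s)) (S f' * \<theta> * f)) Rinv"
  proof (rule ev2_cong)
    fix r s f f' assume "f' \<in> G s"
    then have "S (\<alpha> * f') = S f' * S \<alpha>"
      using S_antimult[OF \<alpha>_even] by simp
    then have "drinfeld * inv S (\<alpha> * f') = S f' * \<theta>"
      using drinfeld_commute[of "inv S (\<alpha> * f')"] S_\<alpha>_to_double_dual[OF twisted_pairing_\<theta>] by (simp add: mult.assoc)
    then show "drinfeld * scale (ksign (r * s)) (inv S (\<alpha> * f') * f) = scale (ksign (r * s)) (S f' * \<theta> * f)"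
      by (simp add: scale_mult_right flip: mult.assoc)
  qed
  also have "\<dots> = ev2 (\<lambda>r f s f'. ev2 (\<lambda>t e w e'.
      scale (ksign (r * s)) (S f' * scale (ksign (t * w)) (S e' * \<alpha> * e) * f)) R) Rinv"
    unfolding \<theta>_def by (intro ev2_cong klin_ev2[symmetric] ml_intros)
  also have "\<dots> = ev2 (\<lambda>r f s f'. ev2 (\<lambda>t e w e'.
      scale (ksign (w * r)) (g (t + r) (e * f) (w + s) (e' * f'))) R) Rinv"
  proof (rule ev2_cong, rule ev2_degree[OF R_even])
    fix r s t w f f' e e' assume h: "f \<in> G r" "f' \<in> G s" "e \<in> G t" "e' \<in> G w" "t + w = 0"
    have "S (e' * f') = scale (ksign (w * s)) (S f' * S e')"
      using S_antimult h by blast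
    moreover have "t = w"
      using h(5) by (cases t; cases w) auto
    ultimately show "scale (ksign (r * s)) (S f' * scale (ksign (t * w)) (S e' * \<alpha> * e) * f)
        = scale (ksign (w * r)) (g (t + r) (e * f) (w + s) (e' * f'))"
      unfolding g_def
      by (simp add: scale_mult_left scale_mult_right mult.assoc flip: ksign_add) (simp add: algebra_simps)
  qed (unfold g_def, (intro ml_intros)+)
  also have "\<dots> = ev2 g (R \<odot> Rinv)"
    unfolding ev2_tmult[OF g R_tens Rinv_tens] by (rule ev22_swap)
  also have "\<dots> = \<alpha>"
    using ev2_same[OF tens_eq_same_ev[OF R_right_inv] g] ev2_tone[OF g] by (simp add: g_def S_one)
  finally show ?thesis .
qed

text \<open>\<open>\<Sum> u S\<^sup>-\<^sup>1(X) \<eta> Y \<beta> S(Z) = \<Sum> S(X) u \<eta> Y \<beta> S(Z) = \<Sum> S(X) \<alpha> Y \<beta> S(Z) = 1\<close>.\<close>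

lemma drinfeld_right_inverse: "drinfeld * drinfeld_inv = 1"
proof -
  have "drinfeld * drinfeld_inv = ev3 (\<lambda>p x q y r z. drinfeld * (inv S x * \<eta> * (y * \<beta> * S z))) \<Phi>"
    unfolding from_double_dual_def by (intro klin_ev3[symmetric] ml_intros)
  also have "\<dots> = ev3 (\<lambda>p x q y r z. S x * \<alpha> * y * \<beta> * S z) \<Phi>"
  proof (rule ev3_cong)
    fix x y z
    have "drinfeld * (inv S x * \<eta>) = S x * (drinfeld * \<eta>)"
      using drinfeld_commute[of "inv S x"] by (simp flip: mult.assoc)
    then show "drinfeld * (inv S x * \<eta> * (y * \<beta> * S z)) = S x * \<alpha> * y * \<beta> * S z"
      by (simp add: drinfeld_\<eta> flip: mult.assoc)
  qed
  also have "\<dots> = 1"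
    by (rule antipode_\<Phi>_ev)
  finally show ?thesis .
qed

text \<open>Commuting \<open>u\<close> past the candidate \<open>v\<close> for its inverse gives \<open>v S\<^sup>2(u) = u v = 1\<close>. So \<open>v\<close> has a right
  inverse besides its left inverse \<open>u\<close>, and the two agree.\<close>

lemma drinfeld_left_inverse: "drinfeld_inv * drinfeld = 1"
proof -
  have right: "drinfeld_inv * S (S drinfeld) = 1"
    using drinfeld_inv_commute[of drinfeld] drinfeld_right_inverse by simp
  then have "drinfeld_inv * drinfeld = drinfeld_inv * drinfeld * (drinfeld_inv * S (S drinfeld))"
    by simp
  also have "\<dots> = drinfeld_inv * (drinfeld * drinfeld_inv) * S (S drinfeld)"
    by (simp only: mult.assoc)
  also have "\<dots> = 1"
    by (simp only: drinfeld_right_inverse mult_1_right right)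
  finally show ?thesis .
qed

lemma S_square_drinfeld_inv: "S (S drinfeld_inv) = drinfeld_inv"
proof -
  have left: "S (S drinfeld_inv) * drinfeld = 1"
    using drinfeld_commute[of drinfeld_inv] drinfeld_right_inverse by simp
  have "S (S drinfeld_inv) = S (S drinfeld_inv) * (drinfeld * drinfeld_inv)"
    by (simp only: drinfeld_right_inverse mult_1_right)
  also have "\<dots> = drinfeld_inv"
    by (simp only: left mult.assoc[symmetric] mult_1_left)
  finally show ?thesis .
qed

lemma S_square_conj: "S (S a) = drinfeld * a * drinfeld_inv"
  using drinfeld_commute[of a] drinfeld_right_inverse by (simp add: mult.assoc)

text \<open>In the even tensors \<open>R\<close> and \<open>\<Phi>\<close> the signs \<open>(-1)\<^bsup>[x][y]\<^esup>\<close> and \<open>(-1)\<^bsup>[x]([y]+[z])\<^esup>\<close> reduce to \<open>(-1)\<^bsup>[x]\<^esup>\<close>.\<close>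

lemma drinfeld_expansion:
  assumes \<Phi>: "homogeneous_expansion scale G \<Phi> N (\<lambda>\<nu>. [X \<nu>, Y \<nu>, Z \<nu>])"
    and R: "homogeneous_expansion scale G R I (\<lambda>i. [e i, e' i])"
  shows "drinfeld = (\<Sum>\<nu>\<in>N. \<Sum>i\<in>I. scale (ksign (deg G (e i) + deg G (X \<nu>)))
    (S (Y \<nu> * \<beta> * S (Z \<nu>)) * S (e' i) * \<alpha> * e i * X \<nu>))"
proof -
  have "\<theta> = ev2 (\<lambda>p x q y. scale (ksign p) (S y * \<alpha> * x)) R"
    unfolding \<theta>_def
  proof (rule ev2_degree[OF R_even])
    fix p q x y assume "p + q = (0 :: bit)"
    then have "p * q = p"
      by (cases p; cases q) auto
    then show "scale (ksign (p * q)) (S y * \<alpha> * x) = scale (ksign p) (S y * \<alpha> * x)"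
      by (simp only:)
  qed (intro ml_intros)+
  also have "\<dots> = (\<Sum>i\<in>I. scale (ksign (deg G (e i))) (S (e' i) * \<alpha> * e i))"
    by (rule ev2_expansion[OF _ R]) (intro ml_intros)
  finally have \<theta>: "\<theta> = (\<Sum>i\<in>I. scale (ksign (deg G (e i))) (S (e' i) * \<alpha> * e i))" .
  have "drinfeld = ev3 (\<lambda>p x q y r z. scale (ksign p) (S (y * \<beta> * S z) * \<theta> * x)) \<Phi>"
    unfolding to_double_dual_def
  proof (rule ev3_degree[OF \<Phi>_even])
    fix p q r x y z assume "p + q + r = (0 :: bit)"
    then have "p * (q + r) = p"
      by (cases p; cases q; cases r) auto
    then show "scale (ksign (p * (q + r))) (S (y * \<beta> * S z) * \<theta> * x)
        = scale (ksign p) (S (y * \<beta> * S z) * \<theta> * x)"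
      by (simp only:)
  qed (intro ml_intros)+
  also have "\<dots> = (\<Sum>\<nu>\<in>N. scale (ksign (deg G (X \<nu>))) (S (Y \<nu> * \<beta> * S (Z \<nu>)) * \<theta> * X \<nu>))"
    by (rule ev3_expansion[OF _ \<Phi>]) (intro ml_intros)
  finally show ?thesis
    by (simp add: \<theta> sum_distrib_left sum_distrib_right scale_sum_right scale_mult_left scale_mult_right
        mult.assoc add.commute flip: ksign_add)
qed

lemma drinfeld_inv_expansion:
  assumes \<Phi>: "homogeneous_expansion scale G \<Phi> N (\<lambda>\<nu>. [X \<nu>, Y \<nu>, Z \<nu>])"
    and Rinv: "homogeneous_expansion scale G Rinv J (\<lambda>j. [f j, f' j])"
  shows "drinfeld_inv = (\<Sum>\<nu>\<in>N. \<Sum>j\<in>J. scale (ksign (deg G (f j)))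
    (inv S (X \<nu>) * inv S (\<alpha> * f' j) * f j * Y \<nu> * \<beta> * S (Z \<nu>)))"
proof -
  have "\<eta> = ev2 (\<lambda>p x q y. scale (ksign p) (inv S (\<alpha> * y) * x)) Rinv"
    unfolding \<eta>_def
  proof (rule ev2_degree[OF Rinv_even])
    fix p q x y assume "p + q = (0 :: bit)"
    then have "p * q = p"
      by (cases p; cases q) auto
    then show "scale (ksign (p * q)) (inv S (\<alpha> * y) * x) = scale (ksign p) (inv S (\<alpha> * y) * x)"
      by (simp only:)
  qed (intro ml_intros)+
  also have "\<dots> = (\<Sum>j\<in>J. scale (ksign (deg G (f j))) (inv S (\<alpha> * f' j) * f j))"
    by (rule ev2_expansion[OF _ Rinv]) (intro ml_intros)
  finally have \<eta>: "\<eta> = (\<Sum>j\<in>J. scale (ksign (deg G (f j))) (inv S (\<alpha> * f' j) * f j))" .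
  have "drinfeld_inv = (\<Sum>\<nu>\<in>N. inv S (X \<nu>) * \<eta> * (Y \<nu> * \<beta> * S (Z \<nu>)))"
    unfolding from_double_dual_def by (rule ev3_expansion[OF _ \<Phi>]) (intro ml_intros)
  then show ?thesis
    by (simp add: \<eta> sum_distrib_left sum_distrib_right scale_mult_left scale_mult_right mult.assoc)
qed

end

theorem proposition5:
  fixes scale :: "'k::field \<Rightarrow> 'a::ring_1 \<Rightarrow> 'a"
    and X Y Z :: "'n \<Rightarrow> 'a" and e e' :: "'i \<Rightarrow> 'a" and f f' :: "'j \<Rightarrow> 'a"
    and u :: 'a
  assumes "quasi_triangular_quasi_hopf_superalgebra scale G \<Delta> \<epsilon> \<Phi> \<Phi>inv S \<alpha> \<beta> R Rinv"
    and "homogeneous_expansion scale G \<Phi> N (\<lambda>\<nu>. [X \<nu>, Y \<nu>, Z \<nu>])"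
    and "homogeneous_expansion scale G R I (\<lambda>i. [e i, e' i])"
    and "homogeneous_expansion scale G Rinv J (\<lambda>j. [f j, f' j])"
    and "u = (\<Sum>\<nu>\<in>N. \<Sum>i\<in>I. scale (ksign (deg G (e i) + deg G (X \<nu>)))
            (S (Y \<nu> * \<beta> * S (Z \<nu>)) * S (e' i) * \<alpha> * e i * X \<nu>))"
  shows "\<exists>u_inv. u * u_inv = 1 \<and> u_inv * u = 1
     \<and> (\<forall>a. S (S a) = u * a * u_inv)
     \<and> u_inv = S (S u_inv)
     \<and> u_inv = (\<Sum>\<nu>\<in>N. \<Sum>j\<in>J. scale (ksign (deg G (f j)))
            (inv S (X \<nu>) * inv S (\<alpha> * f' j) * f j * Y \<nu> * \<beta> * S (Z \<nu>)))"
proof -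
  interpret quasi_triangular_quasi_hopf_superalgebra scale G \<Delta> \<epsilon> \<Phi> \<Phi>inv S \<alpha> \<beta> R Rinv
    by (rule assms(1))
  have u: "u = drinfeld"
    using drinfeld_expansion[OF assms(2,3)] assms(5) by simp
  show ?thesis
    unfolding u
    by (intro exI[of _ drinfeld_inv] conjI allI drinfeld_right_inverse drinfeld_left_inverse S_square_conj
        S_square_drinfeld_inv[symmetric] drinfeld_inv_expansion[OF assms(2,4)])
qed

end
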